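(* Let $n\ge 3$, let $\widetilde B_n$ have generators $r_0,\dots,r_n$, and for $U^W_{\widetilde B_n}(q):=\sum_{w\in\widetilde B_n}q^{\ell_W(\phi(w))}$ (with $\ell_W$ the length function of $W$) the following hold. \begin{enumerate} \item For $\phi:\widetilde B_n\to\widetilde D_{n+1}$ given by $\phi(r_0)=s_0s_1$ and $\phi(r_i)=s_{i+1}$ for $1\le i\le n$: $$U_{\widetilde B_n}^{\widetilde D_{n+1}}(q)=\frac{[2]_q[3]_{-q}[4]_q}{(1-q)(1-q^3)(1+q^n)}\prod_{k=3}^{n}\frac{[2k+1]_q-q^k}{1-q^{2k-1}}.$$ \item For $\phi:\widetilde B_n\to\widetilde D_{2n}$ given by $\phi(r_0)=s_n$, $\phi(r_i)=s_{n-i}s_{n+i}$ for $1\le i\le n-2$, $\phi(r_{n-1})=s_0s_{2n}$, $\phi(r_n)=s_1s_{2n-1}$: $$U_{\widetilde B_n}^{\widetilde D_{2n}}(q)=\left(\prod_{k=1}^{2n}[k]_{(-1)^kq}\right)\cdot\frac{\prod_{k=1}^{n-1}(1+q^{2k})}{\prod_{k=1}^{n}(1-q^{2(n+k)-3})}.$$ \item For $\phi:\widetilde B_n\to\widetilde D_{2n+1}$ given by $\phi(r_0)=s_ns_{n+1}s_n$, $\phi(r_i)=s_{n-i}s_{n+1+i}$ for $1\le i\le n-2$, $\phi(r_{n-1})=s_0s_{2n+1}$, $\phi(r_n)=s_1s_{2n}$: $$U_{\widetilde B_n}^{\widetilde D_{2n+1}}(q)=\left(\prod_{k=1}^{2n+1}[k]_{(-1)^kq}\right)\cdot\frac{\prod_{k=1}^{n-1}(1+q^{2k})}{\prod_{k=1}^{n}(1-q^{2(n+k)-1})}.$$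 \end{enumerate}
   Context: $[k]_q:=1+q+\cdots+q^{k-1}$ (and $[k]_{-q}$, $[k]_{(-1)^kq}$ denote its substitutions). All groups below are Coxeter groups: generators are involutions, and pairs of distinct generators not listed commute ($m=2$). $\widetilde B_n$ ($n\ge3$): generators $r_0,\dots,r_n$ with $(r_0r_1)^4=e$, $(r_ir_{i+1})^3=e$ for $1\le i\le n-3$, $(r_{n-2}r_{n-1})^3=(r_{n-2}r_n)^3=e$. $\widetilde D_N$ ($N\ge4$): generators $s_0,\dots,s_N$ with $(s_0s_2)^3=(s_1s_2)^3=e$, $(s_is_{i+1})^3=e$ for $2\le i\le N-3$, $(s_{N-2}s_{N-1})^3=(s_{N-2}s_N)^3=e$. In each part the assignment on generators extends to an injective group homomorphism (a folding by the nontrivial graph automorphism of the Coxeter graph of $\widetilde D$). *)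

theory Defs
  imports
    "HOL-Analysis.Infinite_Sum"
    "HOL-Computational_Algebra.Formal_Power_Series"
    "HOL-Algebra.Coset"
begin

section \<open>Coxeter groups\<close>

text \<open>
  The Coxeter group with generators indexed by \<open>S\<close> and Coxeter matrix \<open>m\<close> is
  presented by the relations \<open>(s t) ^ m s t = 1\<close>, where \<open>m s s = 1\<close>; the value \<open>m s t = 0\<close>
  means that there is no relation. Since every generator is its own inverse, positive words
  suffice: the group is the monoid of words over \<open>S\<close> modulo the congruence
  generated by the relations, and its elements are the congruence classes.
\<close>

inductive coxeter_eq :: "'s set \<Rightarrow> ('s \<Rightarrow> 's \<Rightarrow> nat) \<Rightarrow> 's list \<Rightarrow> 's list \<Rightarrow> bool"
  for S :: "'s set" and m :: "'s \<Rightarrow> 's \<Rightarrow> nat" where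
  relation: "\<lbrakk>u \<in> lists S; v \<in> lists S; s \<in> S; t \<in> S\<rbrakk>
    \<Longrightarrow> coxeter_eq S m (u @ concat (replicate (m s t) [s, t]) @ v) (u @ v)"
| refl: "u \<in> lists S \<Longrightarrow> coxeter_eq S m u u"
| sym: "coxeter_eq S m u v \<Longrightarrow> coxeter_eq S m v u"
| trans: "coxeter_eq S m u v \<Longrightarrow> coxeter_eq S m v w \<Longrightarrow> coxeter_eq S m u w"

definition coxeter_class :: "'s set \<Rightarrow> ('s \<Rightarrow> 's \<Rightarrow> nat) \<Rightarrow> 's list \<Rightarrow> 's list set" where
  "coxeter_class S m u = {v. coxeter_eq S m u v}"

definition coxeter_group :: "'s set \<Rightarrow> ('s \<Rightarrow> 's \<Rightarrow> nat) \<Rightarrow> 's list set monoid" where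
  "coxeter_group S m =
    \<lparr>carrier = coxeter_class S m ` lists S,
     monoid.mult = (\<lambda>A B. \<Union>a\<in>A. \<Union>b\<in>B. coxeter_class S m (a @ b)),
     one = coxeter_class S m []\<rparr>"

text \<open>An element is the set of all words representing it, so its length is that of a shortest member.\<close>

definition coxeter_length :: "'s list set \<Rightarrow> nat" where
  "coxeter_length w = (LEAST k. \<exists>u\<in>w. length u = k)"

lemma coxeter_eq_lists:
  assumes "coxeter_eq S m u v"
  shows "u \<in> lists S \<and> v \<in> lists S"
  using assms
proof induction
  case (relation u v s t)
  have "set (concat (replicate (m s t) [s, t])) \<subseteq> S"
    using relation by auto
  with relation show ?case by (auto simp: in_lists_conv_set)
qed auto

lemma coxeter_eq_append:
  assumes "coxeter_eq S m u v" "p \<in> lists S" "r \<in> lists S"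
  shows "coxeter_eq S m (p @ u @ r) (p @ v @ r)"
  using assms
proof induction
  case (relation u v s t)
  then show ?case
    using coxeter_eq.relation[of "p @ u" S "v @ r" s t m] by simp
next
  case (trans u v w)
  then show ?case by (meson coxeter_eq.trans)
qed (simp_all add: coxeter_eq.refl coxeter_eq.sym)

lemma coxeter_eq_append2:
  assumes "coxeter_eq S m a b" "coxeter_eq S m c d"
  shows "coxeter_eq S m (a @ c) (b @ d)"
proof (rule coxeter_eq.trans)
  show "coxeter_eq S m (a @ c) (b @ c)"
    using coxeter_eq_append[OF assms(1), of "[]" c] coxeter_eq_lists[OF assms(2)] by simp
  show "coxeter_eq S m (b @ c) (b @ d)"
    using coxeter_eq_append[OF assms(2), of b "[]"] coxeter_eq_lists[OF assms(1)] by simp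
qed

lemma coxeter_class_eq_iff:
  assumes "u \<in> lists S"
  shows "coxeter_class S m u = coxeter_class S m v \<longleftrightarrow> coxeter_eq S m u v"
  using assms unfolding coxeter_class_def
  by (blast intro: coxeter_eq.refl coxeter_eq.sym coxeter_eq.trans)

lemma coxeter_mult_class:
  assumes "u \<in> lists S" "v \<in> lists S"
  shows "coxeter_class S m u \<otimes>\<^bsub>coxeter_group S m\<^esub> coxeter_class S m v = coxeter_class S m (u @ v)"
proof -
  have "coxeter_class S m (a @ b) = coxeter_class S m (u @ v)"
    if "coxeter_eq S m u a" "coxeter_eq S m v b" for a b
    using coxeter_eq_append2[OF that] assms by (metis append_in_lists_conv coxeter_class_eq_iff)
  moreover have "u \<in> coxeter_class S m u" "v \<in> coxeter_class S m v"
    using assms by (auto simp: coxeter_class_def intro: coxeter_eq.refl)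
  ultimately have "(\<Union>a\<in>coxeter_class S m u. \<Union>b\<in>coxeter_class S m v. coxeter_class S m (a @ b))
      = coxeter_class S m (u @ v)"
    unfolding coxeter_class_def by blast
  then show ?thesis by (simp add: coxeter_group_def)
qed

lemma coxeter_generator_involution:
  assumes "s \<in> S" "m s s = 1"
  shows "coxeter_class S m [s] \<otimes>\<^bsub>coxeter_group S m\<^esub> coxeter_class S m [s] = \<one>\<^bsub>coxeter_group S m\<^esub>"
  using coxeter_eq.relation[of "[]" S "[]" s s m] assms
  by (subst coxeter_mult_class) (auto simp: coxeter_group_def coxeter_class_eq_iff)

lemma group_coxeter_group:
  assumes "\<And>s. s \<in> S \<Longrightarrow> m s s = 1"
  shows "group (coxeter_group S m)"
proof (rule groupI)
  fix x y z
  assume "x \<in> carrier (coxeter_group S m)" "y \<in> carrier (coxeter_group S m)"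
    "z \<in> carrier (coxeter_group S m)"
  then obtain a b c where "a \<in> lists S" "x = coxeter_class S m a" "b \<in> lists S"
    "y = coxeter_class S m b" "c \<in> lists S" "z = coxeter_class S m c"
    by (auto simp: coxeter_group_def)
  then show "x \<otimes>\<^bsub>coxeter_group S m\<^esub> y \<otimes>\<^bsub>coxeter_group S m\<^esub> z
      = x \<otimes>\<^bsub>coxeter_group S m\<^esub> (y \<otimes>\<^bsub>coxeter_group S m\<^esub> z)"
    by (simp add: coxeter_mult_class)
next
  fix x y
  assume "x \<in> carrier (coxeter_group S m)" "y \<in> carrier (coxeter_group S m)"
  then obtain a b where ab: "a \<in> lists S" "x = coxeter_class S m a" "b \<in> lists S"
    "y = coxeter_class S m b"
    by (auto simp: coxeter_group_def)
  then have "x \<otimes>\<^bsub>coxeter_group S m\<^esub> y = coxeter_class S m (a @ b)"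
    by (simp add: coxeter_mult_class)
  then show "x \<otimes>\<^bsub>coxeter_group S m\<^esub> y \<in> carrier (coxeter_group S m)"
    using ab by (auto simp: coxeter_group_def)
next
  show "\<one>\<^bsub>coxeter_group S m\<^esub> \<in> carrier (coxeter_group S m)"
    by (auto simp: coxeter_group_def)
next
  fix x
  assume "x \<in> carrier (coxeter_group S m)"
  then obtain a where a: "a \<in> lists S" "x = coxeter_class S m a"
    by (auto simp: coxeter_group_def)
  show "\<one>\<^bsub>coxeter_group S m\<^esub> \<otimes>\<^bsub>coxeter_group S m\<^esub> x = x"
    using coxeter_mult_class[of "[]" S a m] a by (simp add: coxeter_group_def)
  have "coxeter_eq S m (rev b @ b) []" if "b \<in> lists S" for b
    using that
  proof (induction b)
    case (Cons s b)
    have "coxeter_eq S m (rev b @ concat (replicate (m s s) [s, s]) @ b) (rev b @ b)"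
      using Cons.hyps by (intro coxeter_eq.relation) auto
    then have "coxeter_eq S m (rev b @ [s, s] @ b) (rev b @ b)"
      using assms[of s] Cons.hyps by simp
    with Cons.IH show ?case by (metis append.assoc append_Cons append_Nil coxeter_eq.trans rev.simps(2))
  qed (simp add: coxeter_eq.refl)
  then have "coxeter_class S m (rev a) \<otimes>\<^bsub>coxeter_group S m\<^esub> x = \<one>\<^bsub>coxeter_group S m\<^esub>"
    using a coxeter_mult_class[of "rev a" S a m]
    by (auto simp: in_lists_conv_set coxeter_group_def coxeter_class_eq_iff)
  then show "\<exists>y\<in>carrier (coxeter_group S m). y \<otimes>\<^bsub>coxeter_group S m\<^esub> x = \<one>\<^bsub>coxeter_group S m\<^esub>"
    using a by (intro bexI[of _ "coxeter_class S m (rev a)"]) (auto simp: coxeter_group_def in_lists_conv_set)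
qed


section \<open>The affine Coxeter groups of types B and D\<close>

text \<open>Unlisted pairs of distinct generators commute.\<close>

definition affine_B_matrix :: "nat \<Rightarrow> nat \<Rightarrow> nat \<Rightarrow> nat" where
  "affine_B_matrix n i j =
    (if i = j then 1
     else if {i, j} = {0, 1} then 4
     else if (\<exists>k. 1 \<le> k \<and> k \<le> n - 3 \<and> {i, j} = {k, k + 1})
       \<or> {i, j} = {n - 2, n - 1} \<or> {i, j} = {n - 2, n} then 3
     else 2)"

definition affine_D_matrix :: "nat \<Rightarrow> nat \<Rightarrow> nat \<Rightarrow> nat" where
  "affine_D_matrix N i j =
    (if i = j then 1
     else if {i, j} = {0, 2} \<or> {i, j} = {1, 2}
       \<or> (\<exists>k. 2 \<le> k \<and> k \<le> N - 3 \<and> {i, j} = {k, k + 1})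
       \<or> {i, j} = {N - 2, N - 1} \<or> {i, j} = {N - 2, N} then 3
     else 2)"

definition affine_B :: "nat \<Rightarrow> nat list set monoid" where
  "affine_B n = coxeter_group {0..n} (affine_B_matrix n)"

definition affine_D :: "nat \<Rightarrow> nat list set monoid" where
  "affine_D N = coxeter_group {0..N} (affine_D_matrix N)"

definition B_gen :: "nat \<Rightarrow> nat \<Rightarrow> nat list set" where
  "B_gen n i = coxeter_class {0..n} (affine_B_matrix n) [i]"

definition D_gen :: "nat \<Rightarrow> nat \<Rightarrow> nat list set" where
  "D_gen N i = coxeter_class {0..N} (affine_D_matrix N) [i]"

lemma group_affine_B: "group (affine_B n)"
  unfolding affine_B_def by (rule group_coxeter_group) (simp add: affine_B_matrix_def)

lemma group_affine_D: "group (affine_D N)"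
  unfolding affine_D_def by (rule group_coxeter_group) (simp add: affine_D_matrix_def)


section \<open>Generating functions\<close>

text \<open>
  The infinite sum is taken in the metric topology of formal power series, where convergence is
  coefficientwise stabilisation. A divergent \<open>infsum\<close> is \<open>0\<close>, so an equation
  with a non-zero series as right-hand side includes convergence.
\<close>

definition length_series ::
    "('a, 'b) monoid_scheme \<Rightarrow> ('a \<Rightarrow> 's list set) \<Rightarrow> rat fps" where
  "length_series G \<phi> = (\<Sum>\<^sub>\<infinity>w\<in>carrier G. fps_X ^ coxeter_length (\<phi> w))"

definition q_number :: "nat \<Rightarrow> 'a::comm_semiring_1 \<Rightarrow> 'a" where
  "q_number k x = (\<Sum>i<k. x ^ i)"

end

theory Submission
  imports Defs
begin

text \<open>
  The homomorphisms \<open>\<phi>\<close> are foldings: they send each generator of affine \<open>B\<close> to the longest element of a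
  finite parabolic subgroup of affine \<open>D\<close>, and a rank-two check shows that the length in affine \<open>D\<close> is
  additive along reduced words of affine \<open>B\<close>. So the series is the Poincare series of affine \<open>B\<close> in which
  \<open>r\<^sub>0\<close> has weight \<open>A\<close> and all other generators have weight \<open>T\<close>, with \<open>(A, T)\<close> equal to \<open>(2, 1)\<close>,
  \<open>(1, 2)\<close> and \<open>(3, 2)\<close>.

  To compute it, count the elements which have all of \<open>r\<^sub>0, \<dots>, r\<^sub>m\<^sub>-\<^sub>1\<close> and none of \<open>r\<^sub>m\<^sub>+\<^sub>1, \<dots>, r\<^sub>n\<close> as
  right descents. Their series is the full series times a monomial, divided by the series of the
  parabolic subgroups \<open>B\<^sub>m\<close> and \<open>D\<^sub>n\<^sub>-\<^sub>m\<close>. The alternating sum over \<open>m\<close>, corrected at the fork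
  of the diagram, counts only the identity, because no element of an infinite Coxeter group has all
  generators as descents. The series of \<open>B\<^sub>m\<close> and \<open>D\<^sub>m\<close> come from the orbit of a unit vector, and the
  resulting sum is evaluated by a \<open>q\<close>-Vandermonde identity.
\<close>

section \<open>Coxeter groups and the exchange condition\<close>

text \<open>Descents are read off from a numbers game. It is integral because distinct generators
  only have m = 2, 3, 4, and a positive coordinate of a dominant weight after playing
  \<open>w\<close> certifies an ascent. So the rank-two check for a folding becomes a finite integer
  computation, and no element has all generators as descents because a positive linear form, the
  pairing with the null root, is invariant. In the count by descent sets the generator m is left
  free. Away from the fork, an element with least ascent q can be counted only for m = q - 1 and m =
  q, with opposite signs, so that all but the identity cancel. At the fork the last set has two
  versions, one containing n - 1 and one containing n. These two subgroups of type B_n, and the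
  trivial group at m = n - 1, are just what the general term of the q-Vandermonde sum gives for c =
  1: at m = n a factor 1 + c becomes 2. Identities of series are kept multiplied out; division
  enters only in the final formulas.\<close>

lemma rev_in_lists [simp]: "rev u \<in> lists A \<longleftrightarrow> u \<in> lists A"
  by (auto simp: in_lists_conv_set)

primrec alt :: "nat \<Rightarrow> 'a \<Rightarrow> 'a \<Rightarrow> 'a list" where
  "alt 0 s t = []"
| "alt (Suc k) s t = s # alt k t s"

lemma length_alt [simp]: "length (alt k s t) = k"
  by (induction k arbitrary: s t) auto

lemma alt_in_lists: "s \<in> A \<Longrightarrow> t \<in> A \<Longrightarrow> alt k s t \<in> lists A"
  by (induction k arbitrary: s t) auto

lemma alt_add: "alt (k + l) s t = alt k s t @ (if even k then alt l s t else alt l t s)"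
  by (induction k arbitrary: s t) auto

lemma alt_Suc_snoc: "alt (Suc k) s t = alt k s t @ [if even k then s else t]"
  using alt_add[of k 1 s t] by simp

lemma alt_Cons_snoc: "s # alt k t s = alt k s t @ [if even k then s else t]"
  using alt_Suc_snoc[of k s t] by simp

lemma rev_alt: "rev (alt k s t) = (if odd k then alt k s t else alt k t s)"
  by (induction k arbitrary: s t) (auto simp: alt_Cons_snoc)

lemma alt_double: "alt (2 * k) s t = concat (replicate k [s, t])"
  by (induction k) auto

locale coxeter_system =
  fixes S :: "'s set" and m :: "'s \<Rightarrow> 's \<Rightarrow> nat"
  assumes m_diag: "s \<in> S \<Longrightarrow> m s s = 1"
begin

abbreviation eqv :: "'s list \<Rightarrow> 's list \<Rightarrow> bool" (infix "\<approx>" 50) where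
  "eqv \<equiv> coxeter_eq S m"

abbreviation cl :: "'s list \<Rightarrow> 's list set" where
  "cl \<equiv> coxeter_class S m"

definition len :: "'s list \<Rightarrow> nat" where
  "len u = coxeter_length (cl u)"

declare coxeter_eq.trans [trans]

lemma eqv_refl [simp, intro]: "u \<in> lists S \<Longrightarrow> u \<approx> u"
  by (rule coxeter_eq.refl)

lemma eqv_in_lists: "u \<approx> v \<Longrightarrow> u \<in> lists S" "u \<approx> v \<Longrightarrow> v \<in> lists S"
  using coxeter_eq_lists by blast+

lemma eqv_cong: "a \<approx> b \<Longrightarrow> c \<approx> d \<Longrightarrow> a @ c \<approx> b @ d"
  by (rule coxeter_eq_append2)

lemma eqv_cong_left: "a \<approx> b \<Longrightarrow> c \<in> lists S \<Longrightarrow> a @ c \<approx> b @ c"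
  by (simp add: eqv_cong)

lemma eqv_cong_right: "a \<approx> b \<Longrightarrow> c \<in> lists S \<Longrightarrow> c @ a \<approx> c @ b"
  by (simp add: eqv_cong)

lemma double: "s \<in> S \<Longrightarrow> [s, s] \<approx> []"
  using coxeter_eq.relation[of "[]" S "[]" s s m] m_diag[of s] by simp

lemma rev_append_self: "u \<in> lists S \<Longrightarrow> rev u @ u \<approx> []"
proof (induction u)
  case (Cons s u)
  have "rev u @ [s, s] @ u \<approx> rev u @ [] @ u"
    using Cons.prems double by (intro eqv_cong eqv_refl) auto
  also have "\<dots> \<approx> []" using Cons by simp
  finally show ?case by simp
qed auto

lemma append_rev_self: "u \<in> lists S \<Longrightarrow> u @ rev u \<approx> []"
  using rev_append_self[of "rev u"] by simp

lemma eqv_rev: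
  assumes "u \<approx> v"
  shows "rev u \<approx> rev v"
proof -
  note l = eqv_in_lists[OF assms]
  have "rev u \<approx> rev u @ v @ rev v"
    using eqv_cong_right[OF coxeter_eq.sym[OF append_rev_self[of v]], of "rev u"] l by simp
  also have "\<dots> \<approx> rev u @ u @ rev v"
    using l by (intro eqv_cong eqv_refl coxeter_eq.sym[OF assms]) auto
  also have "\<dots> \<approx> rev v"
    using eqv_cong_left[OF rev_append_self[of u], of "rev v"] l by simp
  finally show ?thesis .
qed

lemma eqv_rev_iff: "rev u \<approx> rev v \<longleftrightarrow> u \<approx> v"
  using eqv_rev[of u v] eqv_rev[of "rev u" "rev v"] by auto

lemma cancel_right:
  assumes "a @ c \<approx> b @ c" "a \<in> lists S" "b \<in> lists S" "c \<in> lists S"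
  shows "a \<approx> b"
proof -
  have "a \<approx> a @ c @ rev c"
    using eqv_cong_right[OF coxeter_eq.sym[OF append_rev_self[of c]], of a] assms by simp
  also have "\<dots> \<approx> b @ c @ rev c"
    using eqv_cong_left[OF assms(1), of "rev c"] assms by simp
  also have "\<dots> \<approx> b"
    using eqv_cong_right[OF append_rev_self[of c], of b] assms by simp
  finally show ?thesis .
qed

lemma cancel_left:
  assumes "c @ a \<approx> c @ b" "a \<in> lists S" "b \<in> lists S" "c \<in> lists S"
  shows "a \<approx> b"
  using eqv_rev[OF assms(1)] assms(2-4) cancel_right[of "rev a" "rev c" "rev b"]
  by (simp add: eqv_rev_iff)

lemma move_right:
  assumes "a @ c \<approx> b" "a \<in> lists S" "c \<in> lists S"
  shows "a \<approx> b @ rev c"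
proof (rule cancel_right[of _ c])
  have "b \<approx> (b @ rev c) @ c"
    using eqv_cong_right[OF coxeter_eq.sym[OF rev_append_self[of c]], of b] assms eqv_in_lists[OF assms(1)]
    by simp
  with assms(1) show "a @ c \<approx> (b @ rev c) @ c" by (rule coxeter_eq.trans)
qed (use assms eqv_in_lists[OF assms(1)] in auto)

lemma move_left:
  assumes "c @ a \<approx> b" "a \<in> lists S" "c \<in> lists S"
  shows "a \<approx> rev c @ b"
  using move_right[of "rev a" "rev c" "rev b"] eqv_rev[OF assms(1)] assms(2,3)
    eqv_rev_iff[of a "rev c @ b"] by simp

lemma conjugate_iff:
  assumes "s \<in> S" "a \<in> lists S" "b \<in> lists S"
  shows "[s] @ a @ [s] \<approx> b \<longleftrightarrow> a \<approx> [s] @ b @ [s]"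
proof
  assume "[s] @ a @ [s] \<approx> b"
  then have "a @ [s] \<approx> [s] @ b" using move_left[of "[s]" "a @ [s]" b] assms by simp
  then show "a \<approx> [s] @ b @ [s]" using move_right[of a "[s]" "[s] @ b"] assms by simp
next
  assume "a \<approx> [s] @ b @ [s]"
  then have "b @ [s] \<approx> [s] @ a"
    using move_left[OF coxeter_eq.sym, of a "[s]" "b @ [s]"] assms by simp
  then show "[s] @ a @ [s] \<approx> b"
    using coxeter_eq.sym[OF move_right[of b "[s]" "[s] @ a"]] assms by simp
qed

lemma cl_eq_iff: "u \<in> lists S \<Longrightarrow> cl u = cl v \<longleftrightarrow> u \<approx> v"
  by (rule coxeter_class_eq_iff)

lemma len_le: "u \<approx> v \<Longrightarrow> len u \<le> length v"
  unfolding len_def coxeter_length_def by (rule Least_le) (auto simp: coxeter_class_def)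

lemma reduced_word:
  assumes "u \<in> lists S"
  obtains v where "u \<approx> v" "length v = len u" "v \<in> lists S"
proof -
  have "\<exists>v\<in>cl u. length v = len u"
    unfolding len_def coxeter_length_def
    by (rule LeastI_ex) (use assms in \<open>auto simp: coxeter_class_def intro!: exI[of _ u]\<close>)
  then show ?thesis
    using that eqv_in_lists by (auto simp: coxeter_class_def)
qed

lemma len_cong: "u \<approx> v \<Longrightarrow> len u = len v"
  using eqv_in_lists[of u v] cl_eq_iff[of u v] by (simp add: len_def)

lemma len_le_length: "u \<in> lists S \<Longrightarrow> len u \<le> length u"
  by (simp add: len_le)

lemma len_Nil [simp]: "len [] = 0"
  using len_le_length[of "[]"] by simp

lemma len_eq_0: "u \<in> lists S \<Longrightarrow> len u = 0 \<longleftrightarrow> u \<approx> []"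
  by (metis len_Nil len_cong length_0_conv reduced_word)

lemma len_append_le:
  assumes "u \<in> lists S" "v \<in> lists S"
  shows "len (u @ v) \<le> len u + len v"
proof -
  obtain u' v' where "u \<approx> u'" "length u' = len u" "v \<approx> v'" "length v' = len v"
    using assms by (metis reduced_word)
  then show ?thesis using len_le[OF eqv_cong[of u u' v v']] by simp
qed

lemma len_rev:
  assumes "u \<in> lists S"
  shows "len (rev u) = len u"
proof -
  have "len (rev v) \<le> len v" if "v \<in> lists S" for v
    using that by (metis reduced_word eqv_rev len_le length_rev)
  from this[of u] this[of "rev u"] assms show ?thesis by simp
qed

lemma len_append_ge: "u \<in> lists S \<Longrightarrow> v \<in> lists S \<Longrightarrow> len u \<le> len (u @ v) + len v"
proof -
  assume uv: "u \<in> lists S" "v \<in> lists S"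
  have "u \<approx> (u @ v) @ rev v"
    using eqv_cong_right[OF coxeter_eq.sym[OF append_rev_self[of v]], of u] uv by simp
  then have "len u = len ((u @ v) @ rev v)" by (rule len_cong)
  also have "\<dots> \<le> len (u @ v) + len v"
    using len_append_le[of "u @ v" "rev v"] uv by (simp add: len_rev)
  finally show ?thesis .
qed


text \<open>
  \<open>par w \<tau>\<close> is the parity of the number of prefixes \<open>p @ [s]\<close> of \<open>w\<close> with
  \<open>\<tau> = p s p\<^sup>-\<^sup>1\<close>. It depends only on the group elements; this is Tits' argument for the exchange condition.
\<close>

primrec par :: "'s list \<Rightarrow> 's list \<Rightarrow> bool" where
  "par [] \<tau> = False"
| "par (s # w) \<tau> = ((\<tau> \<approx> [s]) \<noteq> par w (s # \<tau> @ [s]))"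

lemma par_append: "par (u @ v) \<tau> = (par u \<tau> \<noteq> par v (rev u @ \<tau> @ u))"
  by (induction u arbitrary: \<tau>) auto

lemma eqv_trans_iff: "\<tau> \<approx> \<tau>' \<Longrightarrow> \<tau> \<approx> v \<longleftrightarrow> \<tau>' \<approx> v"
  using coxeter_eq.trans[of S m \<tau> \<tau>' v] coxeter_eq.trans[OF coxeter_eq.sym, of S m \<tau> \<tau>' v] by blast

lemma eqv_trans_iff_right: "a \<approx> b \<Longrightarrow> v \<approx> a \<longleftrightarrow> v \<approx> b"
  using coxeter_eq.trans[of S m v a b] coxeter_eq.trans[OF _ coxeter_eq.sym, of S m v b a] by blast

lemma par_cong:
  assumes "\<tau> \<approx> \<tau>'" "w \<in> lists S"
  shows "par w \<tau> = par w \<tau>'"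
  using assms
proof (induction w arbitrary: \<tau> \<tau>')
  case (Cons s w)
  then have "s # \<tau> @ [s] \<approx> s # \<tau>' @ [s]"
    using eqv_cong[OF eqv_refl[of "[s]"] eqv_cong[OF Cons.prems(1) eqv_refl[of "[s]"]]] by simp
  with Cons show ?case using eqv_trans_iff[OF Cons.prems(1)] by simp
qed simp

lemma alt_relation: "s \<in> S \<Longrightarrow> t \<in> S \<Longrightarrow> alt (2 * m s t) s t \<approx> []"
  using coxeter_eq.relation[of "[]" S "[]" s t m] by (simp add: alt_double)

text \<open>The reflection attached to the prefix of length i + 1 of an alternating word is itself
  the alternating word of length 2i + 1, so \<open>par\<close> counts matches among these
  palindromes.\<close>

lemma par_alt:
  "par (alt k s t) \<tau> = odd (card {i. i < k \<and> \<tau> \<approx> alt (2 * i + 1) s t})" if st: "s \<in> S" "t \<in> S" and "\<tau> \<in> lists S"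
  using that
proof (induction k arbitrary: s t \<tau>)
  case (Suc k)
  \<comment> \<open>Conjugation by \<open>s\<close> turns a palindrome in \<open>t\<close>,
    \<open>s\<close> into the next longer one in \<open>s\<close>, \<open>t\<close>, which shifts
    the index by one.\<close>
  have conj: "s # \<tau> @ [s] \<approx> alt (2 * i + 1) t s \<longleftrightarrow> \<tau> \<approx> alt (2 * (Suc i) + 1) s t" for i
  proof -
    have l: "alt (2 * i + 1) t s \<in> lists S" "[s] \<in> lists S" "\<tau> \<in> lists S"
      using Suc.prems alt_in_lists[of t S s "2 * i + 1"] by simp_all
    have e: "alt (2 * (Suc i) + 1) s t = [s] @ alt (2 * i + 1) t s @ [s]"
      using alt_add[of "Suc (Suc (2 * i))" 1 s t] alt_add[of 1 "Suc (2 * i)" s t] by simp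
    show ?thesis using conjugate_iff[of s \<tau> "alt (2 * i + 1) t s"] l e by simp
  qed
  have "{i. i < Suc k \<and> \<tau> \<approx> alt (2 * i + 1) s t} =
     (if \<tau> \<approx> [s] then {0} else {}) \<union> Suc ` {i. i < k \<and> \<tau> \<approx> alt (2 * (Suc i) + 1) s t}"
    (is "?A = _ \<union> Suc ` ?B")
    by (auto simp: image_iff less_Suc_eq_0_disj)
  then have "card ?A = card ((if \<tau> \<approx> [s] then {0} else {}) \<union> Suc ` ?B)" by simp
  also have "\<dots> = (if \<tau> \<approx> [s] then 1 else 0) + card ?B"
    by (subst card_Un_disjoint) (auto simp: card_image)
  finally have "card ?A = (if \<tau> \<approx> [s] then 1 else 0) + card ?B" .
  moreover have "par (alt k t s) (s # \<tau> @ [s]) = odd (card ?B)"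
    using Suc.IH[of t s "s # \<tau> @ [s]"] Suc.prems conj by simp
  ultimately show ?case by auto
qed simp

text \<open>The reflections along the relator are periodic with period \<open>m s t\<close>, so each
  one occurs equally often in its two halves.\<close>

lemma par_relation:
  assumes "s \<in> S" "t \<in> S" "\<tau> \<in> lists S"
  shows "\<not> par (concat (replicate (m s t) [s, t])) \<tau>"
proof -
  let ?k = "m s t"
  let ?P = "\<lambda>i. \<tau> \<approx> alt (2 * i + 1) s t"
  have P: "?P (?k + i) \<longleftrightarrow> ?P i" for i
  proof -
    have "alt (2 * (?k + i) + 1) s t = alt (2 * ?k) s t @ alt (2 * i + 1) s t"
      using alt_add[of "2 * ?k" "2 * i + 1" s t] by (simp add: algebra_simps)
    also have "\<dots> \<approx> alt (2 * i + 1) s t"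
      using eqv_cong_left[OF alt_relation[OF assms(1,2)] alt_in_lists[OF assms(1,2)], of "2 * i + 1"] by simp
    finally show ?thesis by (rule eqv_trans_iff_right)
  qed
  define A where "A = {i. i < ?k \<and> ?P i}"
  have "{i. i < 2 * ?k \<and> ?P i} = A \<union> (+) ?k ` A"
  proof (intro equalityI subsetI)
    fix i assume i: "i \<in> {i. i < 2 * ?k \<and> ?P i}"
    show "i \<in> A \<union> (+) ?k ` A"
    proof (cases "i < ?k")
      case False
      define j where "j = i - ?k"
      have j: "?k + j = i" using False by (simp add: j_def)
      have "j < ?k" using i j by simp
      moreover have "?P j" using i P[of j] unfolding j by blast
      ultimately show ?thesis unfolding A_def using j by (intro UnI2 image_eqI[of _ _ j]) simp_all
    qed (use i in \<open>simp add: A_def\<close>)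
  next
    fix i assume "i \<in> A \<union> (+) ?k ` A"
    then show "i \<in> {i. i < 2 * ?k \<and> ?P i}"
    proof
      assume "i \<in> (+) ?k ` A"
      then obtain j where j: "i = ?k + j" "j < ?k" "?P j" unfolding A_def by blast
      then have "?P i" using P[of j] by blast
      then show ?thesis using j by simp
    qed (simp add: A_def)
  qed
  moreover have "A \<inter> (+) ?k ` A = {}" "finite A" by (auto simp: A_def)
  ultimately have "card {i. i < 2 * ?k \<and> ?P i} = 2 * card A"
    by (simp add: card_Un_disjoint card_image)
  then show ?thesis
    using par_alt[of s t \<tau> "2 * ?k"] assms by (simp add: alt_double)
qed

text \<open>A relator contributes evenly to every count, and being trivial in the group it does not
  disturb the conjugations seen by the letters after it.\<close>

lemma par_eqv:
  assumes "u \<approx> v" "\<tau> \<in> lists S"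
  shows "par u \<tau> = par v \<tau>"
  using assms
proof (induction arbitrary: \<tau>)
  case (relation u v s t)
  let ?R = "concat (replicate (m s t) [s, t])"
  have R: "?R \<approx> []" using alt_relation[of s t] relation by (simp add: alt_double)
  have l: "?R \<in> lists S" "rev u @ \<tau> @ u \<in> lists S"
    using eqv_in_lists[OF R] relation by auto
  have "rev ?R @ (rev u @ \<tau> @ u) @ ?R \<approx> rev u @ \<tau> @ u"
    using eqv_cong[OF eqv_rev[OF R] eqv_cong[OF eqv_refl[OF l(2)] R]] by simp
  then have "par v (rev ?R @ (rev u @ \<tau> @ u) @ ?R) = par v (rev u @ \<tau> @ u)"
    using relation by (intro par_cong) auto
  with relation l par_relation[of s t "rev u @ \<tau> @ u"] show ?case by (simp add: par_append)
qed simp_all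

text \<open>An odd count yields a prefix \<open>p @ [s]\<close> with reflection
  \<open>\<tau>\<close>, and multiplying \<open>w\<close> by that reflection on the left deletes the
  letter \<open>s\<close> after \<open>p\<close>.\<close>

lemma par_delete:
  assumes "par w \<tau>" "w \<in> lists S" "\<tau> \<in> lists S"
  shows "\<exists>i<length w. \<tau> @ w \<approx> take i w @ drop (Suc i) w"
  using assms
proof (induction w arbitrary: \<tau>)
  case (Cons s w)
  have sS: "[s] \<in> lists S" "w \<in> lists S" using Cons.prems by simp_all
  show ?case
  proof (cases "\<tau> \<approx> [s]")
    case True
    then have "\<tau> @ s # w \<approx> [s, s] @ w" using eqv_cong_left[OF True, of "s # w"] sS by simp
    also have "\<dots> \<approx> w" using eqv_cong_left[OF double[of s], of w] sS by simp
    finally show ?thesis by (intro exI[of _ 0]) simp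
  next
    case False
    then obtain i where i: "i < length w" "(s # \<tau> @ [s]) @ w \<approx> take i w @ drop (Suc i) w"
      using Cons.IH[of "s # \<tau> @ [s]"] Cons.prems by auto
    have "[s] @ (\<tau> @ s # w) \<approx> take i w @ drop (Suc i) w" using i by simp
    then have "\<tau> @ s # w \<approx> rev [s] @ (take i w @ drop (Suc i) w)"
      using sS Cons.prems by (intro move_left) auto
    with i(1) show ?thesis by (intro exI[of _ "Suc i"]) simp
  qed
qed simp

text \<open>An odd count gives a deletion, hence a shorter word. If the count is even for
  \<open>w\<close>, it is odd for \<open>s # w\<close>, so that passing back to \<open>w\<close>
  shortens.\<close>

lemma left_descent_iff_par:
  assumes "s \<in> S" "w \<in> lists S"
  shows "len (s # w) < len w \<longleftrightarrow> par w [s]" and "len w < len (s # w) \<longleftrightarrow> \<not> par w [s]"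
proof -
  have desc: "len (s # v) < len v" if v: "par v [s]" "v \<in> lists S" for v
  proof -
    obtain v' where v': "v \<approx> v'" "length v' = len v" "v' \<in> lists S"
      using reduced_word[OF v(2)] .
    then have "par v' [s]" using v(1) par_eqv[OF v'(1), of "[s]"] assms by simp
    then obtain i where i: "i < length v'" "[s] @ v' \<approx> take i v' @ drop (Suc i) v'"
      using par_delete[of v' "[s]"] v' assms by auto
    have "[s] @ v \<approx> [s] @ v'" using v' assms by (intro eqv_cong_right) auto
    also note i(2)
    finally have "len ([s] @ v) \<le> length (take i v' @ drop (Suc i) v')" by (rule len_le)
    with i(1) v' show ?thesis by simp
  qed
  have asc: "len w < len (s # w)" if "\<not> par w [s]"
  proof -
    \<comment> \<open>The first letter of \<open>s # w\<close> contributes the reflection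
      \<open>[s]\<close>, and conjugating \<open>[s]\<close> by \<open>s\<close> does not change it;
      so the parity flips.\<close>
    have "[s, s, s] \<approx> [s]" using eqv_cong_left[OF double[of s], of "[s]"] assms by simp
    then have "par w [s, s, s] = par w [s]" using assms by (intro par_cong) auto
    then have "par (s # w) [s]" using that assms by simp
    then have "len (s # s # w) < len (s # w)" using desc[of "s # w"] assms by simp
    moreover have "len (s # s # w) = len w"
      using len_cong[OF eqv_cong_left[OF double[of s], of w]] assms by simp
    ultimately show ?thesis by simp
  qed
  show "len (s # w) < len w \<longleftrightarrow> par w [s]" "len w < len (s # w) \<longleftrightarrow> \<not> par w [s]"
    using desc[of w] asc assms(2) by (cases "par w [s]"; simp)+
qed

lemma len_snoc_conv: "s \<in> S \<Longrightarrow> w \<in> lists S \<Longrightarrow> len (w @ [s]) = len (s # rev w)"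
  using len_rev[of "w @ [s]"] by simp

lemma len_snoc_cases:
  assumes "s \<in> S" "w \<in> lists S"
  obtains (asc) "len (w @ [s]) = Suc (len w)" | (desc) "len w = Suc (len (w @ [s]))"
proof -
  have "len (w @ [s]) \<le> Suc (len w)" "len w \<le> Suc (len (w @ [s]))"
    using len_append_le[of w "[s]"] len_append_ge[of w "[s]"] len_le_length[of "[s]"] assms by simp_all
  moreover have "len (w @ [s]) \<noteq> len w"
    using left_descent_iff_par[of s "rev w"] len_snoc_conv[OF assms] len_rev[OF assms(2)] assms
    by (cases "par (rev w) [s]") simp_all
  ultimately show ?thesis using asc desc by linarith
qed

definition asc :: "'s list \<Rightarrow> 's \<Rightarrow> bool" where
  "asc w s \<longleftrightarrow> len w < len (w @ [s])"

lemma asc_iff: "s \<in> S \<Longrightarrow> w \<in> lists S \<Longrightarrow> asc w s \<longleftrightarrow> len (w @ [s]) = Suc (len w)"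
  unfolding asc_def by (rule len_snoc_cases[of s w]) simp_all

lemma not_asc_iff: "s \<in> S \<Longrightarrow> w \<in> lists S \<Longrightarrow> \<not> asc w s \<longleftrightarrow> len w = Suc (len (w @ [s]))"
  unfolding asc_def by (rule len_snoc_cases[of s w]) simp_all

lemma asc_cong: "u \<approx> v \<Longrightarrow> s \<in> S \<Longrightarrow> asc u s = asc v s"
  unfolding asc_def using len_cong[OF eqv_cong_left[of u v "[s]"]] len_cong[of u v] by simp

lemma asc_Nil: "s \<in> S \<Longrightarrow> asc [] s"
  using not_asc_iff[of s "[]"] by auto

lemma len_single: "s \<in> S \<Longrightarrow> len [s] = 1"
  using asc_Nil[of s] asc_iff[of s "[]"] by simp

lemma asc_snoc_self: "s \<in> S \<Longrightarrow> w \<in> lists S \<Longrightarrow> asc (w @ [s]) s \<longleftrightarrow> \<not> asc w s"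
proof -
  assume a: "s \<in> S" "w \<in> lists S"
  have "w @ [s, s] \<approx> w" using eqv_cong_right[OF double[of s], of w] a by simp
  then have "len (w @ [s, s]) = len w" by (rule len_cong)
  then show ?thesis
    using len_snoc_cases[OF a] unfolding asc_def by (metis append_Cons append_Nil append_assoc lessI not_less_iff_gr_or_eq)
qed

lemma exchange:
  assumes "\<not> asc w s" "w \<in> lists S" "s \<in> S"
  shows "\<exists>i<length w. w @ [s] \<approx> take i w @ drop (Suc i) w"
proof -
  have "len (s # rev w) < len (rev w)"
    using assms not_asc_iff[of s w] by (simp add: len_snoc_conv len_rev)
  then obtain i where i: "i < length w" "[s] @ rev w \<approx> take i (rev w) @ drop (Suc i) (rev w)"
    using par_delete[of "rev w" "[s]"] left_descent_iff_par[of s "rev w"] assms by auto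
  have "w @ [s] \<approx> rev (take i (rev w) @ drop (Suc i) (rev w))" using eqv_rev[OF i(2)] by simp
  also have "\<dots> = take (length w - Suc i) w @ drop (length w - i) w"
    by (simp add: take_rev drop_rev)
  finally show ?thesis using i(1) by (intro exI[of _ "length w - Suc i"]) (auto simp: Suc_diff_Suc)
qed

text \<open>The shorter word uses only letters of the old one; this is what makes lengths in a
  parabolic subgroup agree with lengths in the whole group.\<close>

lemma deletion:
  assumes "u \<in> lists S" "len u < length u"
  shows "\<exists>v. u \<approx> v \<and> set v \<subseteq> set u \<and> length v < length u"
  using assms
proof (induction u rule: rev_induct)
  case (snoc s u)
  then have l: "u \<in> lists S" "s \<in> S" by auto
  show ?case
  proof (cases "len u < length u")
    case True
    then obtain v where v: "u \<approx> v" "set v \<subseteq> set u" "length v < length u" using snoc.IH l by blast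
    then show ?thesis using eqv_cong_left[OF v(1), of "[s]"] l
      by (intro exI[of _ "v @ [s]"]) auto
  next
    case False
    then have "\<not> asc u s" using snoc.prems len_le_length[OF l(1)] asc_iff[OF l(2,1)] by auto
    then obtain i where "i < length u" "u @ [s] \<approx> take i u @ drop (Suc i) u" using exchange l by blast
    then show ?thesis
      using set_take_subset[of i u] set_drop_subset[of "Suc i" u] by (intro exI[of _ "take i u @ drop (Suc i) u"]) auto
  qed
qed simp

lemma reduced_subword:
  assumes "u \<in> lists J" "J \<subseteq> S"
  obtains v where "u \<approx> v" "length v = len u" "v \<in> lists J"
proof -
  have "\<exists>v. u \<approx> v \<and> length v = len u \<and> v \<in> lists J"
    using assms(1)
  proof (induction u rule: length_induct)
    case (1 u)
    have uS: "u \<in> lists S" using 1 assms by blast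
    show ?case
    proof (cases "len u < length u")
      case True
      then obtain v where v: "u \<approx> v" "set v \<subseteq> set u" "length v < length u"
        using deletion uS by blast
      moreover then have "v \<in> lists J" using 1 by (auto simp: in_lists_conv_set)
      ultimately show ?thesis using 1 len_cong[OF v(1)] by (metis coxeter_eq.trans)
    next
      case False
      then show ?thesis using len_le_length[OF uS] uS 1 by (intro exI[of _ u]) auto
    qed
  qed
  then show ?thesis using that by blast
qed

section \<open>Parabolic subgroups\<close>

definition jmin :: "'s set \<Rightarrow> 's list \<Rightarrow> bool" where
  "jmin J x \<longleftrightarrow> (\<forall>s\<in>J. asc x s)"

lemma jmin_cong: "x \<approx> y \<Longrightarrow> J \<subseteq> S \<Longrightarrow> jmin J x = jmin J y"
  unfolding jmin_def using asc_cong by blast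

text \<open>Take \<open>x\<close> of least length in the coset and append a reduced word over
  \<open>J\<close> letter by letter. A descent would delete a letter by exchange: inside
  \<open>x\<close> this gives a shorter member of the coset, inside the appended word it contradicts
  reducedness.\<close>

lemma coset_rep:
  assumes "w \<in> lists S" "J \<subseteq> S"
  shows "\<exists>x u. x \<in> lists S \<and> u \<in> lists J \<and> w \<approx> x @ u \<and> (\<forall>v\<in>lists J. len (x @ v) = len x + len v)"
proof -
  define P where "P x \<longleftrightarrow> x \<in> lists S \<and> (\<exists>u\<in>lists J. w \<approx> x @ u)" for x
  have "P w" unfolding P_def using assms by (auto intro!: bexI[of _ "[]"])
  then obtain x where x: "P x" "\<And>y. P y \<Longrightarrow> len x \<le> len y"
    using arg_min_nat_lemma[of P w len] by blast
  from x(1) obtain u where u: "u \<in> lists J" "w \<approx> x @ u" and xS: "x \<in> lists S" by (auto simp: P_def)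
  have JS: "v \<in> lists S" if "v \<in> lists J" for v using that assms by blast
  have add: "len (x @ v) = len x + length v" if "v \<in> lists J" "len v = length v" for v
    using that
  proof (induction v rule: rev_induct)
    case (snoc s v)
    have s: "s \<in> J" "s \<in> S" "v \<in> lists J" "v \<in> lists S" using snoc.prems JS assms by auto
    have lv: "len v = length v"
      using snoc.prems len_append_le[of v "[s]"] len_le_length[of v] len_single[of s] s by simp
    have xv: "len (x @ v) = len x + length v" using snoc.IH s lv by blast
    have "asc (x @ v) s"
    proof (rule ccontr)
      assume nasc: "\<not> asc (x @ v) s"
      obtain x' where x': "x \<approx> x'" "length x' = len x" "x' \<in> lists S" using reduced_word[OF xS] .
      have e: "x @ v \<approx> x' @ v" using eqv_cong_left[OF x'(1)] s by simp
      then have "\<not> asc (x' @ v) s" using nasc asc_cong s by blast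
      then obtain i where i: "i < length (x' @ v)"
        "(x' @ v) @ [s] \<approx> take i (x' @ v) @ drop (Suc i) (x' @ v)"
        using exchange[of "x' @ v" s] x' s by auto
      show False
      proof (cases "i < length x'")
        case True
        define y where "y = take i x' @ drop (Suc i) x'"
        have yS: "y \<in> lists S" using x'(3) unfolding y_def
          by (auto simp: in_lists_conv_set dest: in_set_takeD in_set_dropD)
        have "x' @ v @ [s] \<approx> y @ v" using i True by (simp add: y_def)
        then have "x' \<approx> (y @ v) @ rev (v @ [s])" using x' s by (intro move_right) auto
        then have "x \<approx> y @ (v @ [s] @ rev v)" using coxeter_eq.trans[OF x'(1)] by simp
        then have "w \<approx> (y @ (v @ [s] @ rev v)) @ u"
          using coxeter_eq.trans[OF u(2) eqv_cong_left[OF _ JS[OF u(1)]]] by blast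
        then have "P y" unfolding P_def using yS s u
          by (auto intro!: bexI[of _ "v @ [s] @ rev v @ u"])
        then have "len x \<le> len y" using x by blast
        also have "len y \<le> length y" using len_le_length yS by simp
        also have "\<dots> < length x'" using True by (simp add: y_def)
        finally show False using x' by simp
      next
        case False
        define j where "j = i - length x'"
        have j: "j < length v" "x' @ v @ [s] \<approx> x' @ (take j v @ drop (Suc j) v)"
          using i False by (auto simp: j_def Suc_diff_le)
        have "take j v @ drop (Suc j) v \<in> lists S" using s
          by (auto simp: in_lists_conv_set dest: in_set_takeD in_set_dropD)
        then have "v @ [s] \<approx> take j v @ drop (Suc j) v"
          using cancel_left[OF j(2)] x' s by simp
        then have "len (v @ [s]) < length v" using len_le j(1) by fastforce
        then show False using snoc.prems by simp
      qed
    qed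
    then show ?case using xv asc_iff[of s "x @ v"] s xS by simp
  qed simp
  have "len (x @ v) = len x + len v" if v: "v \<in> lists J" for v
  proof -
    obtain v' where v': "v \<approx> v'" "length v' = len v" "v' \<in> lists J"
      using reduced_subword[OF v assms(2)] .
    then have "len (x @ v') = len x + length v'" using add len_cong[OF v'(1)] by simp
    then show ?thesis using v' len_cong[OF eqv_cong_right[OF v'(1) xS]] by simp
  qed
  with u xS show ?thesis by blast
qed

text \<open>Minimality with respect to single generators already forces least length in the whole
  coset: otherwise the last letter of the nonempty \<open>J\<close>-part of \<open>x\<close> would
  be a descent in \<open>J\<close>.\<close>

lemma jmin_additive:
  assumes "jmin J x" "x \<in> lists S" "J \<subseteq> S" "v \<in> lists J"
  shows "len (x @ v) = len x + len v"
proof -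
  obtain y u where y: "y \<in> lists S" "u \<in> lists J" "x \<approx> y @ u"
    "\<And>v. v \<in> lists J \<Longrightarrow> len (y @ v) = len y + len v"
    using coset_rep[OF assms(2,3)] by blast
  obtain u' where u': "u \<approx> u'" "length u' = len u" "u' \<in> lists J"
    using reduced_subword[OF y(2) assms(3)] .
  have xu': "x \<approx> y @ u'" using y u' eqv_cong_right coxeter_eq.trans by blast
  have "u' = []"
  proof (cases u' rule: rev_cases)
    case (snoc u2 s)
    have s: "s \<in> J" "s \<in> S" "u2 \<in> lists J" "u2 \<in> lists S" using u' snoc assms by auto
    have "x @ [s] \<approx> y @ u2 @ [s, s]" using eqv_cong_left[OF xu', of "[s]"] s snoc by simp
    also have "\<dots> \<approx> y @ u2" using eqv_cong_right[OF double[of s], of "y @ u2"] s y by simp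
    finally have "len (x @ [s]) \<le> len y + len u2" using len_cong y(4)[OF s(3)] by simp
    also have "\<dots> \<le> len y + length u2" using len_le_length s by simp
    also have "\<dots> < len y + len u" using u' snoc by simp
    also have "\<dots> = len x" using len_cong[OF y(3)] y(4)[OF y(2)] by simp
    finally show ?thesis using assms(1) s unfolding jmin_def asc_def by force
  qed simp
  then have xy: "x \<approx> y" using xu' by simp
  have "v \<in> lists S" using assms by blast
  then show ?thesis using len_cong[OF eqv_cong_left[OF xy, of v]] y(4)[OF assms(4)] len_cong[OF xy] by simp
qed

lemma jmin_decomp:
  assumes "w \<in> lists S" "J \<subseteq> S"
  obtains x u where "x \<in> lists S" "u \<in> lists J" "w \<approx> x @ u" "jmin J x"
proof -
  obtain x u where x: "x \<in> lists S" "u \<in> lists J" "w \<approx> x @ u"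
     "\<forall>v\<in>lists J. len (x @ v) = len x + len v"
    using coset_rep[OF assms] by blast
  have "jmin J x" unfolding jmin_def asc_def
    using x(4) assms(2) len_single by (auto simp: subset_iff)
  with x that show ?thesis by blast
qed

lemma jmin_asc:
  assumes "jmin J x" "x \<in> lists S" "J \<subseteq> S" "u \<in> lists J" "s \<in> J"
  shows "asc (x @ u) s = asc u s"
  using jmin_additive[OF assms(1-3), of u] jmin_additive[OF assms(1-3), of "u @ [s]"] assms
  by (auto simp: asc_def)

text \<open>Additivity applied to the inverse of \<open>x\<close> says that twice
  \<open>len x\<close> is 0.\<close>

lemma jmin_trivial:
  assumes "jmin J x" "x \<in> lists J" "J \<subseteq> S"
  shows "x \<approx> []"
proof -
  have xS: "x \<in> lists S" using assms by blast
  have "len (x @ rev x) = len x + len (rev x)" using jmin_additive[OF assms(1) xS assms(3)] assms by simp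
  moreover have "len (x @ rev x) = 0" using len_cong[OF append_rev_self[OF xS]] by simp
  ultimately show ?thesis using len_eq_0[OF xS] by simp
qed

text \<open>Each of \<open>x\<close> and \<open>y\<close> is the other times an element of the
  parabolic subgroup, so each length is at least the other; the connecting element then has length
  0.\<close>

lemma jmin_unique:
  assumes "jmin J x" "jmin J y" "x \<in> lists S" "y \<in> lists S" "J \<subseteq> S" "u \<in> lists J" "v \<in> lists J"
    and "x @ u \<approx> y @ v"
  shows "x \<approx> y" "u \<approx> v"
proof -
  have uv: "u \<in> lists S" "v \<in> lists S" using assms by auto
  have "x \<approx> (y @ v) @ rev u" using move_right assms uv by blast
  then have e: "x \<approx> y @ (v @ rev u)" by simp
  then have "y \<approx> x @ rev (v @ rev u)"
    using move_right[OF coxeter_eq.sym[OF e]] assms uv by simp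
  then have e2: "len y = len x + len (u @ rev v)"
    using jmin_additive[of J x "u @ rev v"] assms len_cong by auto
  have "len x = len y + len (v @ rev u)"
    using jmin_additive[of J y "v @ rev u"] assms len_cong[OF e] by auto
  then have "len (u @ rev v) = 0" using e2 by simp
  then have "u @ rev v \<approx> []" using len_eq_0[of "u @ rev v"] uv by simp
  then show uv': "u \<approx> v" using move_right[of u "rev v" "[]"] uv by simp
  have "x @ u \<approx> y @ u"
    using coxeter_eq.trans[OF assms(8) eqv_cong_right[OF coxeter_eq.sym[OF uv'] assms(4)]] .
  then show "x \<approx> y" using cancel_right assms uv by blast
qed

text \<open>The counterpart of \<open>jmin_additive\<close> for the longest element of a coset.
  Write \<open>w\<close> as \<open>z @ v\<close>; appending a descent \<open>s\<close> in
  \<open>J\<close> deletes a letter by exchange, and as \<open>v @ [s]\<close> is reduced, that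
  letter lies in \<open>z\<close>.\<close>

lemma full_descent_additive:
  assumes "w \<in> lists S" "J \<subseteq> S" "\<forall>s\<in>J. \<not> asc w s" "v \<in> lists J"
  shows "len w = len (w @ rev v) + len v"
proof -
  have main: "len w = len (w @ rev v) + length v" if "v \<in> lists J" "len v = length v" for v
    using that
  proof (induction v rule: rev_induct)
    case (snoc s v)
    have s: "s \<in> J" "s \<in> S" "v \<in> lists J" "v \<in> lists S"
      using snoc.prems assms(2) by auto
    have lv: "len v = length v"
      using snoc.prems len_append_le[of v "[s]"] len_le_length[of v] len_single[of s] s by simp
    have IH: "len w = len (w @ rev v) + length v" using snoc.IH s lv by blast
    obtain z where z: "w @ rev v \<approx> z" "length z = len (w @ rev v)" "z \<in> lists S"
      using reduced_word[of "w @ rev v"] s assms by auto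
    have w: "w \<approx> z @ v" using move_right[OF z(1)] s assms by simp
    then have "\<not> asc (z @ v) s" using assms(3) s asc_cong by blast
    then obtain i where i: "i < length (z @ v)"
        "(z @ v) @ [s] \<approx> take i (z @ v) @ drop (Suc i) (z @ v)"
      using exchange[of "z @ v" s] z s by auto
    have "i < length z"
    proof (rule ccontr)
      assume "\<not> i < length z"
      define j where "j = i - length z"
      have j: "j < length v" "z @ v @ [s] \<approx> z @ (take j v @ drop (Suc j) v)"
        using i \<open>\<not> i < length z\<close> by (auto simp: j_def Suc_diff_le)
      have "take j v @ drop (Suc j) v \<in> lists S" using s
        by (auto simp: in_lists_conv_set dest: in_set_takeD in_set_dropD)
      then have "v @ [s] \<approx> take j v @ drop (Suc j) v"
        using cancel_left[OF j(2)] z s by simp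
      then have "len (v @ [s]) < length v" using len_le j(1) by fastforce
      then show False using snoc.prems by simp
    qed
    define y where "y = take i z @ drop (Suc i) z"
    have yS: "y \<in> lists S" using z(3) unfolding y_def
      by (auto simp: in_lists_conv_set dest: in_set_takeD in_set_dropD)
    have "w @ [s] \<approx> (z @ v) @ [s]" using eqv_cong_left[OF w] s by simp
    also have "\<dots> \<approx> y @ v" using i \<open>i < length z\<close> by (simp add: y_def)
    finally have "(w @ [s]) @ rev v \<approx> y"
      using move_right[OF coxeter_eq.sym, of "w @ [s]" y v] s yS coxeter_eq.sym by blast
    then have "len (w @ rev (v @ [s])) \<le> length y" using len_le by simp
    then have "len (w @ rev (v @ [s])) < length z" using \<open>i < length z\<close> by (simp add: y_def)
    moreover have "len w \<le> len (w @ rev (v @ [s])) + length (v @ [s])"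
      using len_append_ge[of w "rev (v @ [s])"] len_le_length[of "rev (v @ [s])"] assms s by simp
    ultimately show ?case using IH z by simp
  qed simp
  obtain v' where v': "v \<approx> v'" "length v' = len v" "v' \<in> lists J"
    using reduced_subword[OF assms(4,2)] .
  have "w @ rev v \<approx> w @ rev v'" using eqv_cong_right[OF eqv_rev[OF v'(1)] assms(1)] .
  then show ?thesis using main[of v'] v' len_cong[OF v'(1)] len_cong by fastforce
qed

text \<open>Peeling each element off the other gives two length equations whose sum leaves length 0
  for \<open>w @ rev w'\<close>.\<close>

lemma full_descent_unique:
  assumes "w \<in> lists J" "w' \<in> lists J" "J \<subseteq> S" "\<forall>s\<in>J. \<not> asc w s" "\<forall>s\<in>J. \<not> asc w' s"
  shows "w \<approx> w'"
proof -
  have S: "w \<in> lists S" "w' \<in> lists S" using assms by auto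
  have "len w = len (w @ rev w') + len w'" "len w' = len (w' @ rev w) + len w"
    using full_descent_additive[of w J w'] full_descent_additive[of w' J w] assms S by auto
  then have "len (w @ rev w') = 0" by linarith
  then have "w @ rev w' \<approx> []" using len_eq_0[of "w @ rev w'"] S by simp
  from move_right[OF this] S show ?thesis by simp
qed


section \<open>Words in two generators\<close>

lemma alt_braid:
  assumes "s \<in> S" "t \<in> S"
  shows "alt (m s t) s t \<approx> alt (m s t) t s"
proof -
  let ?r = "if even (m s t) then alt (m s t) s t else alt (m s t) t s"
  have "alt (m s t) s t @ ?r \<approx> []"
    using alt_relation[OF assms] alt_add[of "m s t" "m s t" s t] by (simp add: mult_2)
  moreover have "?r \<in> lists S" "alt (m s t) s t \<in> lists S"
    using assms by (simp_all add: alt_in_lists)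
  ultimately have "alt (m s t) s t \<approx> [] @ rev ?r" by (intro move_right)
  then show ?thesis by (simp add: rev_alt split: if_splits)
qed

lemma reduced_butlast:
  assumes "len (u @ v) = length (u @ v)" "u \<in> lists S" "v \<in> lists S"
  shows "len u = length u"
  using assms len_append_le[of u v] len_le_length[of u] len_le_length[of v] by simp

lemma reduced_last_not_asc:
  assumes "len (u @ [s]) = length (u @ [s])" "u \<in> lists S" "s \<in> S"
  shows "\<not> asc (u @ [s]) s"
  using assms reduced_butlast[of u "[s]"] asc_snoc_self[of s u] asc_iff[of s u] by simp

lemma reduced_two_letters:
  assumes "u \<in> lists {s, t}" "s \<in> S" "t \<in> S" "len u = length u" "u = [] \<or> last u = t"
  shows "u = rev (alt (length u) t s)"
  using assms
proof (induction u arbitrary: s t rule: rev_induct)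
  case (snoc x u)
  have x: "x = t" using snoc.prems by simp
  have uS: "u \<in> lists S" "u \<in> lists {t, s}" using snoc.prems by auto
  have lu: "len u = length u" using reduced_butlast[of u "[x]"] snoc.prems uS by auto
  have "u = [] \<or> last u = s"
  proof (rule ccontr)
    assume a: "\<not> (u = [] \<or> last u = s)"
    then obtain u' y where u': "u = u' @ [y]" by (cases u rule: rev_cases) auto
    then have "y = t" using a uS by auto
    then have "\<not> asc u t" using reduced_last_not_asc[of u' y] lu u' uS by auto
    then show False using snoc.prems lu x asc_iff[of t u] uS by auto
  qed
  then have "u = rev (alt (length u) s t)" using snoc.IH[of t s] uS snoc.prems lu by auto
  then show ?case using x by simp
qed simp

text \<open>From \<open>m t s\<close> letters on, the braid relation makes the alternating word
  begin with \<open>s\<close>, and then \<open>s\<close> would be a descent of its reverse.\<close>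

lemma reduced_alt_bound:
  assumes "s \<in> S" "t \<in> S" "asc (rev (alt k t s)) s" "len (alt k t s) = k"
    and "m t s > 0"
  shows "k < m t s"
proof (rule ccontr)
  assume "\<not> k < m t s"
  then obtain l where k: "k = m t s + l" using le_Suc_ex[of "m t s" k] by auto
  define r where "r = (if even (m t s) then alt l t s else alt l s t)"
  have r: "r \<in> lists S" "length r = l" using assms by (simp_all add: r_def alt_in_lists)
  have "alt k t s = alt (m t s) t s @ r" unfolding k r_def by (rule alt_add)
  also have "\<dots> \<approx> alt (m t s) s t @ r" using eqv_cong_left[OF alt_braid] assms r by blast
  also have "alt (m t s) s t = s # alt (m t s - 1) t s" using assms(5) by (cases "m t s") auto
  finally have e: "alt k t s \<approx> s # (alt (m t s - 1) t s @ r)" (is "_ \<approx> s # ?z") by simp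
  have z: "?z \<in> lists S" "length ?z < k" using assms r k by (simp_all add: alt_in_lists)
  have "[s] @ alt k t s \<approx> [s, s] @ ?z" using eqv_cong_right[OF e, of "[s]"] assms by simp
  also have "\<dots> \<approx> ?z" using eqv_cong_left[OF double z(1)] assms by simp
  finally have "len ([s] @ alt k t s) < k" using len_le z(2) by fastforce
  moreover have "len ([s] @ alt k t s) = len (rev (alt k t s) @ [s])"
    using len_rev[of "[s] @ alt k t s"] assms alt_in_lists[of t S s k] by simp
  ultimately show False
    using assms(3,4) len_rev[of "alt k t s"] alt_in_lists[of t S s k] assms(1,2) unfolding asc_def by simp
qed

text \<open>Write \<open>w\<close> as a minimal coset representative times an element of the dihedral
  subgroup generated by \<open>s\<close> and a right descent of \<open>w\<close>.\<close>

lemma rank_two_induct: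
  assumes cong: "\<And>u v s. u \<approx> v \<Longrightarrow> s \<in> S \<Longrightarrow> Q u s \<Longrightarrow> Q v s"
    and base: "\<And>s. s \<in> S \<Longrightarrow> Q [] s"
    and step: "\<And>v s t k. \<lbrakk>v \<in> lists S; s \<in> S; t \<in> S; s \<noteq> t; Q v s; Q v t; 0 < k; k < m t s\<rbrakk>
        \<Longrightarrow> Q (v @ rev (alt k t s)) s"
    and pos: "\<And>s t. s \<in> S \<Longrightarrow> t \<in> S \<Longrightarrow> m s t > 0"
    and "w \<in> lists S" "s \<in> S" "asc w s"
  shows "Q w s"
  using assms(5-7)
proof (induction "len w" arbitrary: w s rule: less_induct)
  case less
  note w = less.prems
  obtain w' where w': "w \<approx> w'" "length w' = len w" "w' \<in> lists S" using reduced_word[OF w(1)] .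
  show ?case
  proof (cases w' rule: rev_cases)
    case Nil
    then show ?thesis using cong[OF coxeter_eq.sym[of S m w "[]"]] w' base w by simp
  next
    case (snoc w2 t)
    have t: "t \<in> S" "w2 \<in> lists S" using w' snoc by auto
    have "\<not> asc w' t" using reduced_last_not_asc[of w2 t] t w' snoc len_cong[OF w'(1)] by simp
    then have nt: "\<not> asc w t" using asc_cong[OF w'(1) t(1)] by simp
    then have st: "s \<noteq> t" using w by auto
    have J: "{s, t} \<subseteq> S" using w t by simp
    obtain v u where vu: "v \<in> lists S" "u \<in> lists {s, t}" "w \<approx> v @ u" "jmin {s, t} v"
      using jmin_decomp[OF w(1) J] .
    obtain u' where u': "u \<approx> u'" "length u' = len u" "u' \<in> lists {s, t}"
      using reduced_subword[OF vu(2) J] .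
    have u'S: "u' \<in> lists S" using u' J by blast
    have wvu: "w \<approx> v @ u'" using coxeter_eq.trans[OF vu(3) eqv_cong_right[OF u'(1) vu(1)]] .
    have lu': "len u' = length u'" using u' len_cong[OF u'(1)] by simp
    have "u' \<noteq> []"
    proof
      assume "u' = []"
      then have "asc w t = asc v t" using asc_cong[OF wvu t(1)] by simp
      then show False using nt vu(4) by (simp add: jmin_def)
    qed
    then have lv: "len v < len w"
      using len_cong[OF wvu] jmin_additive[OF vu(4,1) J u'(3)] lu' by simp
    have Qs: "Q v s" "Q v t"
      using less.hyps[OF lv vu(1)] w t vu(4) by (auto simp: jmin_def)
    have as: "asc u' s"
      using asc_cong[OF wvu w(2)] jmin_asc[OF vu(4,1) J u'(3), of s] w by simp
    have "last u' = t"
    proof (rule ccontr)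
      assume a: "last u' \<noteq> t"
      obtain u2 y where u2: "u' = u2 @ [y]" using \<open>u' \<noteq> []\<close> by (cases u' rule: rev_cases) auto
      then have "y = s" using a u' by auto
      then show False using as reduced_last_not_asc[of u2 s] lu' u2 u'S w by auto
    qed
    define k where "k = length u'"
    have u'alt: "u' = rev (alt k t s)"
      using reduced_two_letters[OF u'(3) w(2) t(1) lu'] \<open>last u' = t\<close> by (simp add: k_def)
    have "k < m t s"
    proof (rule reduced_alt_bound[OF w(2) t(1)])
      show "asc (rev (alt k t s)) s" using as u'alt by simp
      show "len (alt k t s) = k" using lu' len_rev[of "alt k t s"] alt_in_lists[OF t(1) w(2)]
        unfolding u'alt[symmetric] by (simp add: k_def)
      show "m t s > 0" using pos t w by blast
    qed
    moreover have "k > 0" using \<open>u' \<noteq> []\<close> by (simp add: k_def)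
    ultimately have "Q (v @ u') s" using step[OF vu(1) w(2) t(1) st Qs] u'alt by blast
    then show ?thesis using cong[OF coxeter_eq.sym[OF wvu] w(2)] by blast
  qed
qed

end

section \<open>The numbers game\<close>

text \<open>For distinct generators the product of the two entries is 0, 1 or 2 for m = 2, 3, 4,
  that is 4 cos^2 (pi / m). A double bond may have either orientation.\<close>

locale coxeter_cartan = coxeter_system S m for S :: "'s set" and m +
  fixes C :: "'s \<Rightarrow> 's \<Rightarrow> int"
  assumes C_diag: "s \<in> S \<Longrightarrow> C s s = 2"
    and cartan: "s \<in> S \<Longrightarrow> t \<in> S \<Longrightarrow> s \<noteq> t \<Longrightarrow>
      m s t = 2 \<and> m t s = 2 \<and> C s t = 0 \<and> C t s = 0 \<or>
      m s t = 3 \<and> m t s = 3 \<and> C s t = -1 \<and> C t s = -1 \<or>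
      m s t = 4 \<and> m t s = 4 \<and> C s t = -1 \<and> C t s = -2 \<or>
      m s t = 4 \<and> m t s = 4 \<and> C s t = -2 \<and> C t s = -1"
begin

text \<open>
  Mozes' numbers game: \<open>f\<close> is a weight in coordinates with respect to the fundamental weights,
  and \<open>play w f s\<close> is the pairing of \<open>f\<close> with the root \<open>w \<alpha>\<^sub>s\<close>.
\<close>

definition fire :: "'s \<Rightarrow> ('s \<Rightarrow> int) \<Rightarrow> 's \<Rightarrow> int" where
  "fire s f = (\<lambda>t. f t - C s t * f s)"

primrec play :: "'s list \<Rightarrow> ('s \<Rightarrow> int) \<Rightarrow> 's \<Rightarrow> int" where
  "play [] f = f"
| "play (s # w) f = play w (fire s f)"

lemma play_append: "play (u @ v) f = play v (play u f)"
  by (induction u arbitrary: f) auto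

lemma fire_self: "s \<in> S \<Longrightarrow> fire s f s = - f s"
  by (simp add: fire_def C_diag)

lemma fire_fire: "s \<in> S \<Longrightarrow> fire s (fire s f) = f"
  by (auto simp: fire_def C_diag algebra_simps)

lemma play_relation:
  assumes "s \<in> S" "t \<in> S"
  shows "play (concat (replicate (m s t) [s, t])) f = f"
proof (cases "s = t")
  case True
  then show ?thesis using assms m_diag[of s] by (simp add: fire_fire)
next
  case False
  show ?thesis
    using cartan[OF assms False] C_diag[OF assms(1)] C_diag[OF assms(2)]
    by (elim disjE conjE) (simp_all add: numeral_eq_Suc fire_def fun_eq_iff algebra_simps)
qed

lemma play_eqv: "u \<approx> v \<Longrightarrow> play u f = play v f"
  by (induction arbitrary: f rule: coxeter_eq.induct) (simp_all add: play_append play_relation)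

lemma m_pos: "s \<in> S \<Longrightarrow> t \<in> S \<Longrightarrow> m s t > 0"
  using cartan[of s t] m_diag[of s] by (cases "s = t") auto

text \<open>At an ascent \<open>w\<close> sends the simple root of \<open>s\<close> to a positive
  root, on which a dominant weight is nonnegative. By rank-two induction this is a computation with
  at most three firings.\<close>

lemma asc_play_nonneg:
  assumes "w \<in> lists S" "s \<in> S" "asc w s" "\<And>t. t \<in> S \<Longrightarrow> f t \<ge> 0"
  shows "play w f s \<ge> 0"
proof -
  define Q where "Q w s \<longleftrightarrow> (\<forall>f. (\<forall>t\<in>S. f t \<ge> 0) \<longrightarrow> play w f s \<ge> 0)" for w s
  have "Q w s"
  proof (rule rank_two_induct[where Q = Q])
    fix v s t and k :: nat
    assume *: "v \<in> lists S" "s \<in> S" "t \<in> S" "s \<noteq> t" "Q v s" "Q v t" "0 < k" "k < m t s"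
    show "Q (v @ rev (alt k t s)) s"
      unfolding Q_def
    proof (intro allI impI)
      fix f :: "'s \<Rightarrow> int"
      assume "\<forall>t\<in>S. f t \<ge> 0"
      then have g: "play v f s \<ge> 0" "play v f t \<ge> 0" using * by (auto simp: Q_def)
      have "k \<in> {1, 2, 3}" using cartan[OF *(3,2)] * by auto
      then show "play (v @ rev (alt k t s)) f s \<ge> 0"
        using cartan[OF *(3,2)] C_diag[OF *(2)] C_diag[OF *(3)] * g
        by (auto simp: numeral_eq_Suc play_append fire_def)
    qed
  qed (use assms play_eqv m_pos in \<open>auto simp: Q_def\<close>)
  then show ?thesis using assms by (simp add: Q_def)
qed

text \<open>Ascents can thus be established by computation. Strict positivity matters: the value 0
  decides nothing.\<close>

lemma play_pos_asc:
  assumes "w \<in> lists S" "s \<in> S" "\<And>t. t \<in> S \<Longrightarrow> f t \<ge> 0" "play w f s > 0"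
  shows "asc w s"
proof (rule ccontr)
  assume "\<not> asc w s"
  then have "asc (w @ [s]) s" using assms by (simp add: asc_snoc_self)
  then have "play (w @ [s]) f s \<ge> 0" using asc_play_nonneg[of "w @ [s]" s f] assms by simp
  then show False using assms by (simp add: play_append fire_self)
qed

lemma not_asc_play_nonpos:
  assumes "w \<in> lists S" "s \<in> S" "\<And>t. t \<in> S \<Longrightarrow> f t \<ge> 0" "\<not> asc w s"
  shows "play w f s \<le> 0"
  using play_pos_asc[OF assms(1-3)] assms(4) by force

end

section \<open>Foldings\<close>

text \<open>The last assumption is the rank-two check. The all-ones weight is strictly dominant and
  so never vanishes on a root; hence asking for positive values loses nothing.\<close>

locale coxeter_folding =
  B: coxeter_system S m + D: coxeter_cartan S' m' C'
  for S :: "'a set" and m and S' :: "'b set" and m' C' +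
  fixes p :: "'a \<Rightarrow> 'b list"
  assumes p_in: "s \<in> S \<Longrightarrow> p s \<in> lists S'"
    and fold_eqv: "coxeter_eq S m u v \<Longrightarrow> coxeter_eq S' m' (concat (map p u)) (concat (map p v))"
    and m_pos: "s \<in> S \<Longrightarrow> t \<in> S \<Longrightarrow> m s t > 0"
    and play_pos: "\<lbrakk>s \<in> S; t \<in> S; s \<noteq> t; 0 < k; k < m t s; x \<in> set (p s)\<rbrakk>
      \<Longrightarrow> D.play (concat (map p (rev (alt k t s)))) (\<lambda>_. 1) x > 0"
begin

lemma fold_in: "w \<in> lists S \<Longrightarrow> concat (map p w) \<in> lists S'"
  using p_in by (fastforce simp: in_lists_conv_set)

text \<open>Rank-two induction: once the image of \<open>v\<close> is minimal for all letters of
  \<open>p s\<close> and \<open>p t\<close>, the ascents after a dihedral part are decided inside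
  the parabolic subgroup of these letters, where \<open>play_pos\<close> applies.\<close>

lemma fold_asc:
  assumes "w \<in> lists S" "s \<in> S" "B.asc w s" "x \<in> set (p s)"
  shows "D.asc (concat (map p w)) x"
proof -
  define Q where "Q w s \<longleftrightarrow> D.jmin (set (p s)) (concat (map p w))" for w s
  have pS: "set (p s) \<subseteq> S'" if "s \<in> S" for s using p_in[OF that] by auto
  have "Q w s"
  proof (rule B.rank_two_induct[where Q = Q])
    fix v s t and k :: nat
    assume *: "v \<in> lists S" "s \<in> S" "t \<in> S" "s \<noteq> t" "Q v s" "Q v t" "0 < k" "k < m t s"
    let ?K = "set (p s) \<union> set (p t)"
    let ?u = "concat (map p (rev (alt k t s)))"
    have K: "?K \<subseteq> S'" "D.jmin ?K (concat (map p v))"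
      using * pS by (auto simp: Q_def D.jmin_def)
    have "set (alt k t s) \<subseteq> {s, t}" by (induction k arbitrary: s t) auto
    then have u: "?u \<in> lists ?K" by (auto simp: in_lists_conv_set)
    show "Q (v @ rev (alt k t s)) s"
      unfolding Q_def D.jmin_def
    proof
      fix x assume x: "x \<in> set (p s)"
      have "D.asc ?u x"
        using play_pos[OF *(2,3,4,7,8) x] K u x by (intro D.play_pos_asc[where f = "\<lambda>_. 1"]) auto
      then show "D.asc (concat (map p (v @ rev (alt k t s)))) x"
        using D.jmin_asc[OF K(2) fold_in[OF *(1)] K(1) u, of x] x by simp
    qed
  next
    fix u v s assume "coxeter_eq S m u v" "s \<in> S" "Q u s"
    then show "Q v s" using D.jmin_cong[OF fold_eqv pS] by (simp add: Q_def)
  next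
    fix s assume "s \<in> S"
    then show "Q [] s" using pS D.asc_Nil by (auto simp: Q_def D.jmin_def)
  qed (use assms m_pos in auto)
  then show ?thesis using assms by (simp add: Q_def D.jmin_def)
qed

text \<open>All letters of \<open>p s\<close> are ascents of the image, which is therefore minimal
  in its coset, so the block \<open>p s\<close> adds its full length.\<close>

lemma fold_len:
  assumes "w \<in> lists S" "s \<in> S" "B.asc w s"
  shows "D.len (concat (map p (w @ [s]))) = D.len (concat (map p w)) + D.len (p s)"
  using D.jmin_additive[of "set (p s)" "concat (map p w)" "p s"] fold_asc[OF assms] fold_in[OF assms(1)]
    p_in[OF assms(2)] by (auto simp: D.jmin_def)

end

section \<open>Weights seen from a parabolic subgroup, and commuting generators\<close>

context coxeter_cartan begin

lemma play_local:
  assumes "w \<in> lists J" "J \<subseteq> S" "\<And>t. t \<in> J \<Longrightarrow> f t = g t" "t \<in> J"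
  shows "play w f t = play w g t"
  using assms
proof (induction w arbitrary: f g)
  case (Cons s w)
  have "f s = g s" using Cons by blast
  then have "fire s f t = fire s g t" if "t \<in> J" for t
    using Cons.prems(2)[OF that] by (simp add: fire_def)
  then show ?case using Cons.IH[of "fire s f" "fire s g"] Cons.prems by simp
qed simp

lemma play_local_sign:
  assumes "w \<in> lists J" "J \<subseteq> S" "\<And>t. t \<in> J \<Longrightarrow> f t \<ge> 0" "s \<in> J"
  shows "asc w s \<Longrightarrow> play w f s \<ge> 0" and "\<not> asc w s \<Longrightarrow> play w f s \<le> 0"
proof -
  \<comment> \<open>Outside \<open>J\<close> the weight may be negative; setting it to 0 there makes
    it dominant without changing what is seen from \<open>J\<close>.\<close>
  define g where "g t = (if t \<in> J then f t else 0)" for t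
  have g: "g t \<ge> 0" for t using assms by (simp add: g_def)
  have e: "play w f s = play w g s" using assms by (intro play_local) (auto simp: g_def)
  have w: "w \<in> lists S" "s \<in> S" using assms by auto
  show "asc w s \<Longrightarrow> play w f s \<ge> 0" unfolding e by (rule asc_play_nonneg[OF w _ g])
  show "\<not> asc w s \<Longrightarrow> play w f s \<le> 0" unfolding e by (rule not_asc_play_nonpos[OF w g])
qed

lemma play_fixed:
  assumes "w \<in> lists K" "K \<subseteq> J" "\<And>s. s \<in> K \<Longrightarrow> f s = 0"
  shows "play w f = f"
  using assms(1) by (induction w) (use assms in \<open>auto simp: fire_def\<close>)

lemma commute_words:
  assumes "s \<in> S" "u \<in> lists S" "\<And>t. t \<in> set u \<Longrightarrow> s \<noteq> t \<and> m s t = 2"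
  shows "[s] @ u \<approx> u @ [s]"
  using assms
proof (induction u)
  case (Cons t u)
  have t: "t \<in> S" "m s t = 2" "u \<in> lists S" using Cons.prems by auto
  have "[s, t] \<approx> [t, s]" using alt_braid[of s t] t Cons.prems by (simp add: numeral_eq_Suc)
  then have "[s, t] @ u \<approx> [t, s] @ u" using t by (intro eqv_cong_left)
  also have "[t, s] @ u = [t] @ ([s] @ u)" by simp
  also have "\<dots> \<approx> [t] @ (u @ [s])" using Cons t by (intro eqv_cong_right) auto
  finally show ?case by simp
qed auto

end

section \<open>Weighted generating functions\<close>

text \<open>\<open>L\<close> is a function on classes of which only the growth at ascents is
  prescribed; in the application it is the length of the image under the folding. Positive weights
  keep its level sets finite.\<close>

locale weighted_coxeter = coxeter_cartan S m C
  for S :: "'s set" and m and C +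
  fixes L :: "'s list set \<Rightarrow> nat" and wt :: "'s \<Rightarrow> nat"
  assumes finite_S: "finite S"
    and L_Nil: "L (cl []) = 0"
    and L_snoc: "w \<in> lists S \<Longrightarrow> s \<in> S \<Longrightarrow> asc w s \<Longrightarrow> L (cl (w @ [s])) = L (cl w) + wt s"
    and wt_pos: "s \<in> S \<Longrightarrow> wt s > 0"
begin

abbreviation cox_mult :: "'s list set \<Rightarrow> 's list set \<Rightarrow> 's list set" (infixl "\<odot>" 70) where
  "x \<odot> y \<equiv> x \<otimes>\<^bsub>coxeter_group S m\<^esub> y"

definition W :: "'s set \<Rightarrow> 's list set set" where
  "W J = cl ` lists J"

text \<open>For \<open>K\<close> inside \<open>J\<close> these are the distinguished representatives
  of the left cosets of \<open>W K\<close> in \<open>W J\<close>.\<close>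

definition MR :: "'s set \<Rightarrow> 's set \<Rightarrow> 's list set set" where
  "MR J K = {cl u | u. u \<in> lists J \<and> jmin K u}"

definition gf :: "'s list set set \<Rightarrow> rat fps" where
  "gf A = Abs_fps (\<lambda>k. of_nat (card {c \<in> A. L c = k}))"

lemma cl_cong: "u \<approx> v \<Longrightarrow> cl u = cl v"
  using cl_eq_iff[of u v] eqv_in_lists(1)[of u v] by simp

lemma cl_mult: "u \<in> lists S \<Longrightarrow> v \<in> lists S \<Longrightarrow> cl u \<odot> cl v = cl (u @ v)"
  by (rule coxeter_mult_class)

text \<open>Spell the second factor by a reduced word: additivity of length makes each of its
  letters an ascent both within \<open>v\<close> and after \<open>u\<close>.\<close>

lemma L_append:
  assumes "u \<in> lists S" "v \<in> lists S" "len (u @ v) = len u + len v"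
  shows "L (cl (u @ v)) = L (cl u) + L (cl v)"
proof -
  have main: "L (cl (u @ v)) = L (cl u) + L (cl v)"
    if "v \<in> lists S" "len (u @ v) = len u + length v" for v
    using that
  proof (induction v rule: rev_induct)
    case Nil
    then show ?case by (simp add: L_Nil)
  next
    case (snoc s v)
    have s: "s \<in> S" "v \<in> lists S" using snoc.prems by auto
    have "len (u @ v @ [s]) \<le> Suc (len (u @ v))"
      using len_append_le[of "u @ v" "[s]"] len_single[of s] s assms(1) by simp
    moreover have "len (u @ v) \<le> len u + len v" "len v \<le> length v"
      using len_append_le[OF assms(1) s(2)] len_le_length[OF s(2)] .
    ultimately have l: "len (u @ v) = len u + length v" "len v = length v" "asc (u @ v) s"
      using snoc.prems unfolding asc_def by auto
    have "len (u @ v @ [s]) \<le> len u + len (v @ [s])"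
      using len_append_le[of u "v @ [s]"] s assms by simp
    then have "asc v s" using l snoc.prems unfolding asc_def by simp
    then show ?case using L_snoc[of v s] L_snoc[of "u @ v" s] snoc.IH[OF s(2) l(1)] l(3) s assms(1) by simp
  qed
  obtain v' where v': "v \<approx> v'" "length v' = len v" "v' \<in> lists S" using reduced_word[OF assms(2)] .
  have uv: "u @ v \<approx> u @ v'" using eqv_cong_right[OF v'(1) assms(1)] .
  show ?thesis using main[OF v'(3)] len_cong[OF uv] cl_cong[OF uv] cl_cong[OF v'(1)] v'(2) assms(3) by simp
qed

lemma L_single: "s \<in> S \<Longrightarrow> L (cl [s]) = wt s"
  using L_snoc[of "[]" s] asc_Nil[of s] by (simp add: L_Nil)

lemma L_jmin:
  assumes "jmin J x" "x \<in> lists S" "J \<subseteq> S" "u \<in> lists J"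
  shows "L (cl (x @ u)) = L (cl x) + L (cl u)"
proof -
  have "u \<in> lists S" using assms by blast
  then show ?thesis using L_append[OF assms(2)] jmin_additive[OF assms] by blast
qed

lemma len_le_L:
  assumes "u \<in> lists S"
  shows "len u \<le> L (cl u)"
proof -
  have "length v \<le> L (cl v)" if "v \<in> lists S" "len v = length v" for v
    using that
  proof (induction v rule: rev_induct)
    case (snoc s v)
    have s: "s \<in> S" "v \<in> lists S" using snoc.prems by auto
    have "len v = length v" using reduced_butlast[of v "[s]"] snoc.prems s by simp
    then have "asc v s" using snoc.prems by (simp add: asc_def)
    then show ?case using L_snoc[of v s] snoc.IH \<open>len v = length v\<close> s wt_pos[of s] by simp
  qed simp
  then show ?thesis using reduced_word[OF assms] cl_cong len_cong by metis
qed

lemma finite_level: "finite {c \<in> W S. L c = k}"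
proof (rule finite_subset)
  show "{c \<in> W S. L c = k} \<subseteq> cl ` {u. set u \<subseteq> S \<and> length u \<le> k}"
  proof
    fix c assume "c \<in> {c \<in> W S. L c = k}"
    then obtain u where u: "u \<in> lists S" "c = cl u" "L (cl u) = k" by (auto simp: W_def)
    obtain v where v: "u \<approx> v" "length v = len u" "v \<in> lists S" using reduced_word[OF u(1)] .
    show "c \<in> cl ` {u. set u \<subseteq> S \<and> length u \<le> k}"
      using u v cl_cong[OF v(1)] len_le_L[OF u(1)] by (intro image_eqI[of _ _ v]) auto
  qed
qed (simp add: finite_lists_length_le finite_S)

lemma W_mono: "J \<subseteq> S \<Longrightarrow> W J \<subseteq> W S"
  unfolding W_def by (intro image_mono lists_mono) auto

lemma MR_sub: "J \<subseteq> S \<Longrightarrow> MR J K \<subseteq> W S"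
  unfolding MR_def W_def by auto

lemma gf_mult:
  assumes "A \<subseteq> W S" "B \<subseteq> W S" "bij_betw (\<lambda>(a, b). a \<odot> b) (A \<times> B) D"
    and "\<And>a b. a \<in> A \<Longrightarrow> b \<in> B \<Longrightarrow> L (a \<odot> b) = L a + L b"
  shows "gf D = gf A * gf B"
proof (rule fps_ext)
  fix k
  let ?f = "\<lambda>(a, b). a \<odot> b"
  let ?A = "\<lambda>i. {c \<in> A. L c = i}" and ?B = "\<lambda>i. {c \<in> B. L c = i}"
  have fin: "finite (?A i)" "finite (?B i)" for i
    using finite_level[of i] assms(1,2) by (auto elim: rev_finite_subset)
  have "{c \<in> D. L c = k} = ?f ` (\<Union>i\<in>{0..k}. ?A i \<times> ?B (k - i))"
  proof (intro equalityI subsetI)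
    fix c assume c: "c \<in> {c \<in> D. L c = k}"
    then obtain a b where ab: "a \<in> A" "b \<in> B" "c = ?f (a, b)"
      using bij_betw_imp_surj_on[OF assms(3)] by (auto simp: image_iff)
    then have "L a + L b = k" using c assms(4) by auto
    then show "c \<in> ?f ` (\<Union>i\<in>{0..k}. ?A i \<times> ?B (k - i))"
      using ab by (intro image_eqI[of _ _ "(a, b)"]) auto
  next
    fix c assume "c \<in> ?f ` (\<Union>i\<in>{0..k}. ?A i \<times> ?B (k - i))"
    then show "c \<in> {c \<in> D. L c = k}"
      using bij_betw_apply[OF assms(3)] assms(4) by fastforce
  qed
  moreover have "inj_on ?f (\<Union>i\<in>{0..k}. ?A i \<times> ?B (k - i))"
    by (rule inj_on_subset[OF bij_betw_imp_inj_on[OF assms(3)]]) auto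
  ultimately have "card {c \<in> D. L c = k} = card (\<Union>i\<in>{0..k}. ?A i \<times> ?B (k - i))"
    by (simp add: card_image)
  also have "\<dots> = (\<Sum>i=0..k. card (?A i \<times> ?B (k - i)))"
    by (intro card_UN_disjoint) (use fin in auto)
  also have "\<dots> = (\<Sum>i=0..k. card (?A i) * card (?B (k - i)))"
    by (simp add: card_cartesian_product)
  finally show "fps_nth (gf D) k = fps_nth (gf A * gf B) k"
    by (simp add: gf_def fps_mult_nth)
qed

lemma gf_bij:
  assumes "bij_betw g I A" "finite I" "\<And>i. i \<in> I \<Longrightarrow> L (g i) = h i"
  shows "gf A = (\<Sum>i\<in>I. fps_X ^ h i)"
proof (rule fps_ext)
  fix k
  have "bij_betw g {i \<in> I. h i = k} {c \<in> A. L c = k}"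
    using assms unfolding bij_betw_def by (auto intro: inj_on_subset simp: image_iff)
  then have "card {c \<in> A. L c = k} = card {i \<in> I. h i = k}" using bij_betw_same_card by force
  also have "of_nat \<dots> = (\<Sum>i\<in>I. if h i = k then 1 else (0::rat))"
    using assms(2) by (simp add: sum.If_cases Int_def)
  finally show "fps_nth (gf A) k = fps_nth (\<Sum>i\<in>I. fps_X ^ h i) k"
    by (simp add: gf_def fps_sum_nth fps_X_power_nth eq_commute)
qed

lemma gf_singleton: "gf {c} = fps_X ^ L c"
  using gf_bij[of "\<lambda>_. c" "{()}" "{c}" "\<lambda>_. L c"] by (simp add: bij_betw_def)

lemma jmin_decomp_in:
  assumes "w \<in> lists J" "K \<subseteq> J" "J \<subseteq> S"
  obtains x u where "x \<in> lists J" "u \<in> lists K" "w \<approx> x @ u" "jmin K x"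
proof -
  have KS: "K \<subseteq> S" and wS: "w \<in> lists S" using assms by auto
  obtain x u where x: "x \<in> lists S" "u \<in> lists K" "w \<approx> x @ u" "jmin K x"
    using jmin_decomp[OF wS KS] .
  have u: "u \<in> lists S" "u \<in> lists J" using x assms by auto
  \<comment> \<open>The minimal representative is so far only a word over \<open>S\<close>; as
    \<open>w @ rev u\<close> it is spelled over \<open>J\<close>.\<close>
  have e: "x \<approx> w @ rev u" using move_right[OF coxeter_eq.sym[OF x(3)] x(1) u(1)] .
  show ?thesis
  proof (rule that[of "w @ rev u" u])
    show "w \<approx> (w @ rev u) @ u"
      using coxeter_eq.trans[OF x(3) eqv_cong_left[OF e u(1)]] .
    show "jmin K (w @ rev u)" using x(4) jmin_cong[OF e KS] by simp
  qed (use x u assms in auto)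
qed

text \<open>Factorisation through minimal coset representatives is unique, and \<open>L\<close> is
  additive on it.\<close>

lemma gf_parabolic:
  assumes "K \<subseteq> J" "J \<subseteq> S"
  shows "gf (W J) = gf (MR J K) * gf (W K)"
proof (rule gf_mult)
  have KS: "K \<subseteq> S" using assms by blast
  have JS: "u \<in> lists S" if "u \<in> lists J" for u using that assms by blast
  have KS': "u \<in> lists S" if "u \<in> lists K" for u using that KS by blast
  show "MR J K \<subseteq> W S" "W K \<subseteq> W S" using MR_sub W_mono assms KS by auto
  show "L (a \<odot> b) = L a + L b" if "a \<in> MR J K" "b \<in> W K" for a b
  proof -
    obtain x u where "a = cl x" "b = cl u" "x \<in> lists J" "jmin K x" "u \<in> lists K"
      using \<open>a \<in> _\<close> \<open>b \<in> _\<close> by (auto simp: MR_def W_def)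
    then show ?thesis using L_jmin[of K x u] KS JS KS' by (simp add: cl_mult)
  qed
  show "bij_betw (\<lambda>(a, b). a \<odot> b) (MR J K \<times> W K) (W J)"
    unfolding bij_betw_def
  proof (intro conjI inj_onI equalityI subsetI)
    fix p q assume p: "p \<in> MR J K \<times> W K" and q: "q \<in> MR J K \<times> W K"
      and e: "(\<lambda>(a, b). a \<odot> b) p = (\<lambda>(a, b). a \<odot> b) q"
    obtain x u where x: "p = (cl x, cl u)" "x \<in> lists J" "jmin K x" "u \<in> lists K"
      using p by (auto simp: MR_def W_def)
    obtain y v where y: "q = (cl y, cl v)" "y \<in> lists J" "jmin K y" "v \<in> lists K"
      using q by (auto simp: MR_def W_def)
    have "cl (x @ u) = cl (y @ v)" using e x y JS KS' by (simp add: cl_mult)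
    then have "x @ u \<approx> y @ v" using cl_eq_iff[of "x @ u"] x JS KS' by simp
    then have "x \<approx> y" "u \<approx> v"
      using jmin_unique[OF x(3) y(3) JS[OF x(2)] JS[OF y(2)] KS x(4) y(4)] by blast+
    then show "p = q" using x y cl_cong by simp
  next
    fix c assume "c \<in> (\<lambda>(a, b). a \<odot> b) ` (MR J K \<times> W K)"
    then obtain x u where x: "c = cl x \<odot> cl u" "x \<in> lists J" "u \<in> lists K"
      by (auto simp: MR_def W_def)
    then have "u \<in> lists J" using assms by blast
    then show "c \<in> W J" using x JS KS' by (auto simp: cl_mult W_def intro!: image_eqI[of _ _ "x @ u"])
  next
    fix c assume "c \<in> W J"
    then obtain w where w: "c = cl w" "w \<in> lists J" by (auto simp: W_def)
    obtain x u where x: "x \<in> lists J" "u \<in> lists K" "w \<approx> x @ u" "jmin K x"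
      using jmin_decomp_in[OF w(2) assms] .
    then have "c = cl x \<odot> cl u" using w cl_cong[OF x(3)] JS KS' by (simp add: cl_mult)
    moreover have "cl x \<in> MR J K" "cl u \<in> W K" using x by (auto simp: MR_def W_def)
    ultimately show "c \<in> (\<lambda>(a, b). a \<odot> b) ` (MR J K \<times> W K)" by force
  qed
qed

text \<open>The weight of the longest element of \<open>W J\<close>, described by maximality instead
  of by an explicit reduced word. As weights are positive, an element attaining it has every
  generator of \<open>J\<close> as a descent.\<close>

definition Lmax :: "'s set \<Rightarrow> nat \<Rightarrow> bool" where
  "Lmax J d \<longleftrightarrow> (\<exists>w\<in>lists J. L (cl w) = d) \<and> (\<forall>w\<in>lists J. L (cl w) \<le> d)"

lemma Lmax_full_descent:
  assumes "Lmax J d" "J \<subseteq> S"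
  obtains w where "w \<in> lists J" "L (cl w) = d" "\<forall>s\<in>J. \<not> asc w s"
proof -
  obtain w where w: "w \<in> lists J" "L (cl w) = d" using assms by (auto simp: Lmax_def)
  have "\<not> asc w s" if s: "s \<in> J" for s
  proof
    assume "asc w s"
    moreover have "w \<in> lists S" "s \<in> S" using w s assms(2) by auto
    ultimately have "L (cl (w @ [s])) > d" using L_snoc[of w s] wt_pos[of s] w by simp
    moreover have "w @ [s] \<in> lists J" using w s by simp
    ultimately show False using assms(1) by (auto simp: Lmax_def not_le[symmetric])
  qed
  with w that show ?thesis by blast
qed

lemma Lmax_mult:
  assumes "Lmax K d" "K \<subseteq> J" "J \<subseteq> S" "x \<in> MR J K" "L x = e" "\<And>y. y \<in> MR J K \<Longrightarrow> L y \<le> e"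
  shows "Lmax J (e + d)"
  unfolding Lmax_def
proof (intro conjI ballI)
  have JS: "u \<in> lists S" if "u \<in> lists J" for u using that assms by blast
  have KS: "K \<subseteq> S" using assms by blast
  obtain y where y: "x = cl y" "y \<in> lists J" "jmin K y" using assms by (auto simp: MR_def)
  obtain w where w: "w \<in> lists K" "L (cl w) = d" using assms by (auto simp: Lmax_def)
  have "w \<in> lists J" using w assms by blast
  then show "\<exists>w\<in>lists J. L (cl w) = e + d"
    using L_jmin[OF y(3) JS[OF y(2)] KS w(1)] y w assms(5) by (intro bexI[of _ "y @ w"]) auto
  fix w assume w: "w \<in> lists J"
  obtain x u where x: "x \<in> lists J" "u \<in> lists K" "w \<approx> x @ u" "jmin K x"
    using jmin_decomp_in[OF w assms(2,3)] .
  have "L (cl w) = L (cl x) + L (cl u)"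
    using L_jmin[OF x(4) JS[OF x(1)] KS x(2)] cl_cong[OF x(3)] by simp
  moreover have "L (cl x) \<le> e" using assms(6)[of "cl x"] x by (auto simp: MR_def)
  moreover have "L (cl u) \<le> d" using assms(1) x by (auto simp: Lmax_def)
  ultimately show "L (cl w) \<le> e + d" by simp
qed

definition commuting :: "'s set \<Rightarrow> 's set \<Rightarrow> bool" where
  "commuting K M \<longleftrightarrow> (\<forall>s\<in>K. \<forall>t\<in>M. s \<noteq> t \<and> m s t = 2)"

lemma commuting_sym: "commuting K M \<Longrightarrow> K \<subseteq> S \<Longrightarrow> M \<subseteq> S \<Longrightarrow> commuting M K"
  unfolding commuting_def
proof (intro ballI)
  fix s t assume a: "\<forall>s\<in>K. \<forall>t\<in>M. s \<noteq> t \<and> m s t = 2" "K \<subseteq> S" "M \<subseteq> S" "s \<in> M" "t \<in> K"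
  then show "s \<noteq> t \<and> m s t = 2" using cartan[of t s] by fastforce
qed

lemma commuting_decomp:
  assumes "commuting K M" "K \<subseteq> S" "M \<subseteq> S" "w \<in> lists (K \<union> M)"
  shows "\<exists>a\<in>lists K. \<exists>b\<in>lists M. w \<approx> a @ b"
  using assms(4)
proof (induction w)
  case Nil
  then show ?case by (intro bexI[of _ "[]"]) auto
next
  case (Cons s w)
  then obtain a b where ab: "a \<in> lists K" "b \<in> lists M" "w \<approx> a @ b" by auto
  have abS: "a \<in> lists S" "b \<in> lists S" "s \<in> S" using ab assms Cons.hyps Cons.prems by auto
  have sw: "[s] @ w \<approx> [s] @ (a @ b)" using eqv_cong_right[OF ab(3), of "[s]"] abS by simp
  show ?case
  proof (cases "s \<in> K")
    case True
    then show ?thesis using ab sw by (intro bexI[of _ "s # a"] bexI[of _ b]) auto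
  next
    case False
    then have s: "s \<in> M" using Cons by blast
    have "[s] @ a \<approx> a @ [s]"
      using commute_words[of s a] abS ab s commuting_sym[OF assms(1-3)]
      by (auto simp: commuting_def in_lists_conv_set)
    from eqv_cong_left[OF this abS(2)] have "s # w \<approx> a @ (s # b)"
      using coxeter_eq.trans[OF sw] by simp
    then show ?thesis using ab s by (intro bexI[of _ a] bexI[of _ "s # b"]) auto
  qed
qed

text \<open>Firing generators of \<open>K\<close> never changes a coordinate on \<open>M\<close>, so
  the all-ones weight stays positive there.\<close>

lemma commuting_jmin:
  assumes "commuting K M" "K \<subseteq> S" "M \<subseteq> S" "u \<in> lists K"
  shows "jmin M u"
  unfolding jmin_def
proof
  fix s assume s: "s \<in> M"
  have C: "C t s = 0" if "t \<in> K" for t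
    using assms(1-3) s that cartan[of t s] by (force simp: commuting_def)
  have "play u f s = f s" for f using assms(4)
    by (induction u arbitrary: f) (auto simp: fire_def C)
  then show "asc u s"
    using assms s by (intro play_pos_asc[where f = "\<lambda>_. 1"]) auto
qed

text \<open>For commuting sets the minimal representatives modulo \<open>W M\<close> are just the
  elements of \<open>W K\<close>.\<close>

lemma gf_commuting:
  assumes "commuting K M" "K \<subseteq> S" "M \<subseteq> S"
  shows "gf (W (K \<union> M)) = gf (W K) * gf (W M)"
proof -
  have "MR (K \<union> M) M = W K"
  proof (intro equalityI subsetI)
    fix c assume "c \<in> MR (K \<union> M) M"
    then obtain w where w: "c = cl w" "w \<in> lists (K \<union> M)" "jmin M w" by (auto simp: MR_def)
    obtain a b where ab: "a \<in> lists K" "b \<in> lists M" "w \<approx> a @ b"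
      using commuting_decomp[OF assms w(2)] by blast
    have abS: "a \<in> lists S" "b \<in> lists S" using ab assms by auto
    have "jmin M (a @ b)" using w(3) jmin_cong[OF ab(3) assms(3)] by simp
    then have "jmin M b"
      using jmin_asc[OF commuting_jmin[OF assms ab(1)] abS(1) assms(3) ab(2)] by (simp add: jmin_def)
    then have "b \<approx> []" using jmin_trivial ab assms by blast
    then have "w \<approx> a" using coxeter_eq.trans[OF ab(3)] eqv_cong_right[of b "[]" a] abS by simp
    then show "c \<in> W K" using w ab cl_cong by (auto simp: W_def)
  next
    fix c assume "c \<in> W K"
    then obtain u where u: "c = cl u" "u \<in> lists K" by (auto simp: W_def)
    moreover have "u \<in> lists (K \<union> M)" using u by auto
    ultimately show "c \<in> MR (K \<union> M) M" using commuting_jmin[OF assms u(2)] by (auto simp: MR_def)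
  qed
  then show ?thesis using gf_parabolic[of M "K \<union> M"] assms by simp
qed

text \<open>Generators outside \<open>K\<close> and \<open>M\<close> are left free. Leaving one free
  between them separates \<open>K\<close> from \<open>M\<close> in the diagram, so that the two sets
  commute.\<close>

definition E :: "'s set \<Rightarrow> 's set \<Rightarrow> 's list set set" where
  "E K M = {cl w | w. w \<in> lists S \<and> (\<forall>s\<in>K. \<not> asc w s) \<and> jmin M w}"

text \<open>Such an element is uniquely \<open>x\<close> times the longest element of
  \<open>W K\<close>, with \<open>x\<close> minimal for \<open>K \<union> M\<close>. The series of
  these \<open>x\<close> is a quotient of the full series, here multiplied out.\<close>

lemma gf_E:
  assumes "commuting K M" "K \<subseteq> S" "M \<subseteq> S" "Lmax K d"
  shows "gf (E K M) * (gf (W K) * gf (W M)) = fps_X ^ d * gf (W S)"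
proof -
  obtain w0 where w0: "w0 \<in> lists K" "L (cl w0) = d" "\<forall>s\<in>K. \<not> asc w0 s"
    using Lmax_full_descent[OF assms(4,2)] .
  have w0J: "w0 \<in> lists (K \<union> M)" "w0 \<in> lists S" using w0(1) assms by auto
  have J: "K \<union> M \<subseteq> S" using assms by simp
  have "gf (E K M) = gf (MR S (K \<union> M)) * gf {cl w0}"
  proof (rule gf_mult)
    show "MR S (K \<union> M) \<subseteq> W S" "{cl w0} \<subseteq> W S" using MR_sub[of S] w0J by (auto simp: W_def)
    show "L (a \<odot> b) = L a + L b" if ab: "a \<in> MR S (K \<union> M)" "b \<in> {cl w0}" for a b
    proof -
      obtain x where "a = cl x" "x \<in> lists S" "jmin (K \<union> M) x" using ab by (auto simp: MR_def)
      then show ?thesis using L_jmin[OF _ _ J w0J(1)] ab w0J by (simp add: cl_mult)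
    qed
    have char: "x @ w0 \<in> lists S \<and> (\<forall>s\<in>K. \<not> asc (x @ w0) s) \<and> jmin M (x @ w0)"
      if x: "x \<in> lists S" "jmin (K \<union> M) x" for x
      using jmin_asc[OF x(2,1) J w0J(1)] w0(3) commuting_jmin[OF assms(1-3) w0(1)] x w0J
      by (simp add: jmin_def)
    show "bij_betw (\<lambda>(a, b). a \<odot> b) (MR S (K \<union> M) \<times> {cl w0}) (E K M)"
      unfolding bij_betw_def
    proof (intro conjI inj_onI equalityI subsetI)
      fix p q assume p: "p \<in> MR S (K \<union> M) \<times> {cl w0}" and q: "q \<in> MR S (K \<union> M) \<times> {cl w0}"
        and e: "(\<lambda>(a, b). a \<odot> b) p = (\<lambda>(a, b). a \<odot> b) q"
      obtain x where x: "p = (cl x, cl w0)" "x \<in> lists S" using p by (auto simp: MR_def)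
      obtain y where y: "q = (cl y, cl w0)" "y \<in> lists S" using q by (auto simp: MR_def)
      have "cl (x @ w0) = cl (y @ w0)" using e x y w0J by (simp add: cl_mult)
      then have "x @ w0 \<approx> y @ w0" using cl_eq_iff[of "x @ w0"] x w0J by simp
      then have "x \<approx> y" using cancel_right x y w0J by blast
      then show "p = q" using x y cl_cong by simp
    next
      fix c assume "c \<in> (\<lambda>(a, b). a \<odot> b) ` (MR S (K \<union> M) \<times> {cl w0})"
      then obtain x where x: "c = cl x \<odot> cl w0" "x \<in> lists S" "jmin (K \<union> M) x"
        by (auto simp: MR_def)
      then have "c = cl (x @ w0)" using w0J by (simp add: cl_mult)
      then show "c \<in> E K M" unfolding E_def using char[OF x(2,3)] by blast
    next
      fix c assume "c \<in> E K M"
      then obtain w where w: "c = cl w" "w \<in> lists S" "\<And>s. s \<in> K \<Longrightarrow> \<not> asc w s" "jmin M w"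
        by (auto simp: E_def)
      obtain x u where x: "x \<in> lists S" "u \<in> lists (K \<union> M)" "w \<approx> x @ u" "jmin (K \<union> M) x"
        using jmin_decomp[OF w(2) J] .
      obtain a b where ab: "a \<in> lists K" "b \<in> lists M" "u \<approx> a @ b"
        using commuting_decomp[OF assms(1-3) x(2)] by blast
      have S: "a \<in> lists S" "b \<in> lists S" "u \<in> lists S" "a \<in> lists (K \<union> M)" using ab x J by auto
      have asc_w: "asc w s = asc u s" if "s \<in> K \<union> M" for s
        using asc_cong[OF x(3)] jmin_asc[OF x(4,1) J x(2) that] that J by blast
      have asc_u: "asc u s = asc (a @ b) s" if "s \<in> K \<union> M" for s
        using asc_cong[OF ab(3)] that J by blast
      \<comment> \<open>The ascents in \<open>M\<close> make the \<open>M\<close>-part of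
        \<open>u\<close> trivial; afterwards the descents in \<open>K\<close> make the
        \<open>K\<close>-part the longest element.\<close>
      have "jmin M b"
        using w(4) asc_w asc_u jmin_asc[OF commuting_jmin[OF assms(1-3) ab(1)] S(1) assms(3) ab(2)]
        by (simp add: jmin_def)
      then have "b \<approx> []" using jmin_trivial ab assms by blast
      then have ua: "u \<approx> a" using coxeter_eq.trans[OF ab(3)] eqv_cong_right[of b "[]" a] S by simp
      have "\<forall>s\<in>K. \<not> asc a s" using w(3) asc_w asc_cong[OF ua] assms(2) by blast
      then have "a \<approx> w0" using full_descent_unique[of a K w0] ab(1) w0 assms(2) by blast
      then have "w \<approx> x @ w0"
        using coxeter_eq.trans[OF x(3)] eqv_cong_right[OF coxeter_eq.trans[OF ua]] x(1) by blast
      then have "c = cl x \<odot> cl w0" using w x w0J cl_cong by (simp add: cl_mult)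
      then show "c \<in> (\<lambda>(a, b). a \<odot> b) ` (MR S (K \<union> M) \<times> {cl w0})"
        using x by (intro image_eqI[of _ _ "(cl x, cl w0)"]) (auto simp: MR_def)
    qed
  qed
  moreover have "gf (W S) = gf (MR S (K \<union> M)) * (gf (W K) * gf (W M))"
    using gf_parabolic[OF J] gf_commuting[OF assms(1-3)] by simp
  ultimately show ?thesis using w0(2) by (simp add: gf_singleton mult_ac)
qed

text \<open>The orbit of a dominant weight \<open>c i\<^sub>0\<close> under \<open>W J\<close> is \<open>c ` I\<close>; its stabiliser is the standard
  parabolic subgroup \<open>W K\<close>, so the orbit is in bijection with the minimal coset representatives.\<close>

lemma orbit_bij:
  fixes c :: "'i \<Rightarrow> 's \<Rightarrow> int" and h :: "'i \<Rightarrow> nat"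
  assumes KJ: "K \<subseteq> J" and J: "J \<subseteq> S" and i0: "i0 \<in> I" and h0: "h i0 = 0"
    and zero: "\<And>s. s \<in> K \<Longrightarrow> c i0 s = 0" and pos: "\<And>s. s \<in> J - K \<Longrightarrow> c i0 s > 0"
    and step: "\<And>i s. i \<in> I \<Longrightarrow> s \<in> J \<Longrightarrow>
      \<exists>j\<in>I. (\<forall>t\<in>J. c j t = c i t - C s t * c i s) \<and> (c i s > 0 \<longrightarrow> h j = h i + wt s)"
    and inj: "\<And>i j. i \<in> I \<Longrightarrow> j \<in> I \<Longrightarrow> (\<And>t. t \<in> J \<Longrightarrow> c i t = c j t) \<Longrightarrow> i = j"
    and down: "\<And>i. i \<in> I \<Longrightarrow> i \<noteq> i0 \<Longrightarrow> \<exists>s\<in>J. c i s < 0"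
  shows "\<exists>g. bij_betw g I (MR J K) \<and> (\<forall>i\<in>I. L (g i) = h i)"
proof -
  \<comment> \<open>\<open>play\<close> fires from left to right; with the reversed word this
    becomes a left action, and prepending \<open>s\<close> fires \<open>s\<close> last.\<close>
  define conf where "conf w = play (rev w) (c i0)" for w
  have JS: "u \<in> lists S" if "u \<in> lists J" for u using that J by blast
  have KS: "K \<subseteq> S" using KJ J by blast
  have nonneg: "c i0 s \<ge> 0" if "s \<in> J" for s
    using zero[of s] pos[of s] that by (cases "s \<in> K") auto
  have conf_Cons: "conf (s # w) = fire s (conf w)" for s w by (simp add: conf_def play_append)
  have conf_cong: "conf u = conf v" if "u \<approx> v" for u v
    unfolding conf_def using play_eqv[OF eqv_rev[OF that]] .
  have conf_ex: "\<exists>i\<in>I. \<forall>t\<in>J. conf w t = c i t" if "w \<in> lists J" for w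
    using that
  proof (induction w)
    case Nil
    then show ?case using i0 by (auto simp: conf_def)
  next
    case (Cons s w)
    then obtain i where i: "i \<in> I" "\<forall>t\<in>J. conf w t = c i t" by auto
    have s: "s \<in> J" using Cons.hyps Cons.prems by simp
    obtain j where "j \<in> I" "\<forall>t\<in>J. c j t = c i t - C s t * c i s" using step[OF i(1) s] by blast
    then show ?case using i s by (intro bexI[of _ j]) (auto simp: conf_Cons fire_def)
  qed
  \<comment> \<open>The last letter of a reduced word is a descent, so the weight is at most 0
    there; by dominance it is 0, the letter lies in \<open>K\<close>, and it can be split
    off.\<close>
  have stab: "\<exists>u\<in>lists K. w \<approx> u" if "w \<in> lists J" "\<And>t. t \<in> J \<Longrightarrow> play w (c i0) t = c i0 t" for w
    using that
  proof (induction "len w" arbitrary: w rule: less_induct)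
    case less
    obtain w' where w': "w \<approx> w'" "length w' = len w" "w' \<in> lists J"
      using reduced_subword[OF less.prems(1) J] .
    show ?case
    proof (cases w' rule: rev_cases)
      case Nil
      then show ?thesis using w' by (intro bexI[of _ "[]"]) auto
    next
      case (snoc w2 s)
      have s: "s \<in> J" "w2 \<in> lists J" "s \<in> S" "w2 \<in> lists S" using w' snoc J by auto
      have l: "len w2 < len w" using w' len_le_length[OF s(4)] snoc by simp
      have "\<not> asc w' s" using reduced_last_not_asc[of w2 s] s w' snoc len_cong[OF w'(1)] by simp
      then have "play w' (c i0) s \<le> 0" using play_local_sign(2)[OF w'(3) J] nonneg s by blast
      then have "c i0 s \<le> 0" using less.prems(2)[OF s(1)] play_eqv[OF w'(1)] by simp
      then have cs: "c i0 s = 0" "s \<in> K" using nonneg[OF s(1)] pos[of s] s(1) by force+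
      have "play w2 (c i0) = fire s (play w' (c i0))"
        using snoc s by (simp add: play_append fire_fire)
      then have "play w2 (c i0) t = c i0 t" if "t \<in> J" for t
        using that less.prems(2) play_eqv[OF w'(1)] s cs by (simp add: fire_def)
      then obtain u where u: "u \<in> lists K" "w2 \<approx> u" using less.hyps[OF l s(2)] by blast
      have "w' \<approx> u @ [s]" using snoc eqv_cong_left[OF u(2), of "[s]"] s by simp
      then show ?thesis using coxeter_eq.trans[OF w'(1)] u cs by (intro bexI[of _ "u @ [s]"]) auto
    qed
  qed
  have conf_inj: "x \<approx> y" if x: "x \<in> lists J" "jmin K x" and y: "y \<in> lists J" "jmin K y"
    and e: "\<And>t. t \<in> J \<Longrightarrow> conf x t = conf y t" for x y
  proof -
    have "play (rev x @ y) (c i0) t = c i0 t" if "t \<in> J" for t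
    proof -
      have "play (rev x @ y) (c i0) t = play y (conf x) t" by (simp add: play_append conf_def)
      also have "\<dots> = play y (conf y) t" using play_local[OF y(1) J e that] .
      also have "\<dots> = play (rev y @ y) (c i0) t" by (simp add: play_append conf_def)
      also have "\<dots> = c i0 t" using play_eqv[OF rev_append_self[OF JS[OF y(1)]]] by simp
      finally show ?thesis .
    qed
    then obtain u where u: "u \<in> lists K" "rev x @ y \<approx> u" using stab[of "rev x @ y"] x y by auto
    have "y \<approx> x @ u" using move_left[OF u(2)] JS x y by simp
    then have "x @ u \<approx> y @ []" using coxeter_eq.sym by simp
    then show ?thesis using jmin_unique(1)[OF x(2) y(2) JS[OF x(1)] JS[OF y(1)] KS u(1) lists.Nil] by simp
  qed
  \<comment> \<open>Peel off the first letter \<open>s\<close>: the weight of the rest is positive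
    at \<open>s\<close>, so \<open>step\<close> raises \<open>h\<close> by \<open>wt s\<close>,
    which is also the gain in \<open>L\<close>.\<close>
  have conf_L: "L (cl x) = h i" if "x \<in> lists J" "jmin K x" "i \<in> I" "\<And>t. t \<in> J \<Longrightarrow> conf x t = c i t" for x i
    using that
  proof (induction "len x" arbitrary: x i rule: less_induct)
    case less
    obtain x' where x': "x \<approx> x'" "length x' = len x" "x' \<in> lists J"
      using reduced_subword[OF less.prems(1) J] .
    show ?case
    proof (cases x')
      case Nil
      then have "i = i0" using inj[OF less.prems(3) i0] less.prems(4) conf_cong[OF x'(1)]
        by (simp add: conf_def)
      then show ?thesis using h0 L_Nil cl_cong[OF x'(1)] Nil by simp
    next
      case (Cons s w)
      have s: "s \<in> J" "w \<in> lists J" "s \<in> S" "w \<in> lists S" using x' Cons J by auto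
      have lx: "len (s # w) = Suc (length w)" using x' len_cong[OF x'(1)] Cons by simp
      have lw: "len w = length w"
        using lx len_append_le[of "[s]" w] len_le_length[OF s(4)] len_single[OF s(3)] s by simp
      have jw: "jmin K w"
        unfolding jmin_def
      proof
        fix r assume r: "r \<in> K"
        then have rS: "r \<in> S" using KS by blast
        have "asc (s # w) r" using less.prems(2) jmin_cong[OF x'(1) KS] r Cons by (simp add: jmin_def)
        then have "len (s # w) < len ([s] @ (w @ [r]))" by (simp add: asc_def)
        also have "\<dots> \<le> Suc (len (w @ [r]))"
          using len_append_le[of "[s]" "w @ [r]"] len_single[OF s(3)] s rS by simp
        finally show "asc w r" using lx lw by (simp add: asc_def)
      qed
      obtain k where k: "k \<in> I" "\<And>t. t \<in> J \<Longrightarrow> conf w t = c k t" using conf_ex[OF s(2)] by blast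
      have IH: "L (cl w) = h k" using less.hyps[OF _ s(2) jw k] lw x' Cons by simp
      have "asc (rev w) s"
        using len_rev[of w] len_rev[of "s # w"] lx lw s by (simp add: asc_def)
      then have "conf w s \<ge> 0"
        unfolding conf_def using s nonneg by (intro play_local_sign(1)[OF _ J]) auto
      \<comment> \<open>With a zero coordinate \<open>x'\<close> and its tail \<open>w\<close> would
        reach the same weight, although both are minimal and their lengths differ.\<close>
      moreover have "c k s \<noteq> 0"
      proof
        assume "c k s = 0"
        then have "conf x' t = conf w t" if "t \<in> J" for t
          using that Cons k s by (simp add: conf_Cons fire_def)
        then have "x' \<approx> w"
          using conf_inj[OF x'(3) _ s(2) jw] less.prems(2) jmin_cong[OF x'(1) KS] by blast
        then show False using len_cong lx lw Cons by fastforce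
      qed
      ultimately have "c k s > 0" using k s by fastforce
      then obtain j where j: "j \<in> I" "\<forall>t\<in>J. c j t = c k t - C s t * c k s" "h j = h k + wt s"
        using step[OF k(1) s(1)] by blast
      have "i = j"
      proof (rule inj[OF less.prems(3) j(1)])
        fix t assume t: "t \<in> J"
        have "c i t = conf (s # w) t" using less.prems(4)[OF t] conf_cong[OF x'(1)] Cons by simp
        also have "\<dots> = c j t" using t k s j by (simp add: conf_Cons fire_def)
        finally show "c i t = c j t" .
      qed
      moreover have "L (cl ([s] @ w)) = wt s + L (cl w)"
        using L_append[of "[s]" w] lx lw s len_single L_single by simp
      ultimately show ?thesis using IH j cl_cong[OF x'(1)] Cons by simp
    qed
  qed
  \<comment> \<open>Firing a negative coordinate lowers \<open>h\<close>, so every index is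
    connected to \<open>i0\<close>.\<close>
  have reach: "\<exists>w\<in>lists J. \<forall>t\<in>J. conf w t = c i t" if "i \<in> I" for i
    using that
  proof (induction "h i" arbitrary: i rule: less_induct)
    case less
    show ?case
    proof (cases "i = i0")
      case True
      then show ?thesis by (intro bexI[of _ "[]"]) (auto simp: conf_def)
    next
      case False
      then obtain s where s: "s \<in> J" "c i s < 0" using down less.prems by blast
      then have sS: "s \<in> S" using J by blast
      obtain j where j: "j \<in> I" "\<forall>t\<in>J. c j t = c i t - C s t * c i s"
        using step[OF less.prems s(1)] by blast
      have js: "c j s = - c i s" using j s sS by (simp add: C_diag)
      then obtain k where k: "k \<in> I" "\<forall>t\<in>J. c k t = c j t - C s t * c j s" "h k = h j + wt s"
        using step[OF j(1) s(1)] s by auto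
      have "k = i" using inj[OF k(1) less.prems] k j js by simp
      then have "h j < h i" using k wt_pos[OF sS] by simp
      then obtain w where w: "w \<in> lists J" "\<forall>t\<in>J. conf w t = c j t" using less.hyps j by blast
      then show ?thesis using s k \<open>k = i\<close> by (intro bexI[of _ "s # w"]) (auto simp: conf_Cons fire_def)
    qed
  qed
  have "\<forall>i\<in>I. \<exists>x. x \<in> lists J \<and> jmin K x \<and> (\<forall>t\<in>J. conf x t = c i t)"
  proof
    fix i assume "i \<in> I"
    then obtain w where w: "w \<in> lists J" "\<forall>t\<in>J. conf w t = c i t" using reach by blast
    obtain x u where x: "x \<in> lists J" "u \<in> lists K" "w \<approx> x @ u" "jmin K x"
      using jmin_decomp_in[OF w(1) KJ J] .
    have "conf w = play (rev x) (play (rev u) (c i0))"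
      using conf_cong[OF x(3)] by (simp add: conf_def play_append)
    also have "\<dots> = conf x" using play_fixed[of "rev u" K K "c i0"] x zero by (simp add: conf_def)
    finally show "\<exists>x. x \<in> lists J \<and> jmin K x \<and> (\<forall>t\<in>J. conf x t = c i t)" using x w by auto
  qed
  then obtain x where x: "\<And>i. i \<in> I \<Longrightarrow> x i \<in> lists J \<and> jmin K (x i) \<and> (\<forall>t\<in>J. conf (x i) t = c i t)"
    by metis
  have "bij_betw (\<lambda>i. cl (x i)) I (MR J K)"
    unfolding bij_betw_def
  proof (intro conjI inj_onI equalityI subsetI)
    fix i j assume ij: "i \<in> I" "j \<in> I" "cl (x i) = cl (x j)"
    then have "x i \<approx> x j" using cl_eq_iff[of "x i" "x j"] x JS by blast
    then have "conf (x i) = conf (x j)" by (rule conf_cong)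
    then show "i = j" using inj[OF ij(1,2)] x[OF ij(1)] x[OF ij(2)] by metis
  next
    fix d assume "d \<in> MR J K"
    then obtain y where y: "d = cl y" "y \<in> lists J" "jmin K y" by (auto simp: MR_def)
    obtain i where i: "i \<in> I" "\<And>t. t \<in> J \<Longrightarrow> conf y t = c i t" using conf_ex[OF y(2)] by blast
    have "y \<approx> x i" using conf_inj[OF y(2,3)] x[OF i(1)] i(2) by simp
    then show "d \<in> (\<lambda>i. cl (x i)) ` I" using i y cl_cong by blast
  qed (use x in \<open>auto simp: MR_def\<close>)
  moreover have "\<forall>i\<in>I. L (cl (x i)) = h i" using conf_L x by blast
  ultimately show ?thesis by blast
qed

lemma orbit_gf:
  assumes "bij_betw g I (MR J K)" "\<forall>i\<in>I. L (g i) = h i" "finite I" "K \<subseteq> J" "J \<subseteq> S"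
  shows "gf (W J) = (\<Sum>i\<in>I. fps_X ^ h i) * gf (W K)"
  using gf_parabolic[OF assms(4,5)] gf_bij[OF assms(1,3)] assms(2) by simp

lemma orbit_Lmax:
  assumes "bij_betw g I (MR J K)" "\<forall>i\<in>I. L (g i) = h i" "K \<subseteq> J" "J \<subseteq> S"
    and "Lmax K d" "i \<in> I" "\<And>j. j \<in> I \<Longrightarrow> h j \<le> h i"
  shows "Lmax J (h i + d)"
proof (rule Lmax_mult[OF assms(5,3,4)])
  show "g i \<in> MR J K" using bij_betw_apply[OF assms(1,6)] .
  show "L (g i) = h i" using assms by blast
  fix y assume "y \<in> MR J K"
  then obtain j where "j \<in> I" "y = g j" using bij_betw_imp_surj_on[OF assms(1)] by blast
  then show "L y \<le> h i" using assms by simp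
qed

end

section \<open>Finite Coxeter groups of types B and D\<close>

text \<open>The pairing of the weight \<open>\<plusminus> e\<^sub>p\<^sub>+\<^sub>1\<close> with the simple root \<open>e\<^sub>j\<^sub>+\<^sub>1 - e\<^sub>j\<close>, where \<open>e\<^sub>0 = 0\<close>.\<close>

definition unit_weight :: "nat \<times> bool \<Rightarrow> nat \<Rightarrow> int" where
  "unit_weight = (\<lambda>(p, b) j. (if b then 1 else -1) * ((if j = p then 1 else 0) - (if j = Suc p then 1 else 0)))"

text \<open>The weighted distance from the vector (k, True): \<open>T\<close> for each step down to
  the first coordinate, \<open>A\<close> for the change of sign, \<open>T\<close> for each step back
  up. Type D uses it with \<open>A = 0\<close>, since there the sign changes as part of a
  step.\<close>

definition unit_height :: "nat \<Rightarrow> nat \<Rightarrow> nat \<Rightarrow> nat \<times> bool \<Rightarrow> nat" where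
  "unit_height A T k = (\<lambda>(p, b). if b then T * (k - p) else A + T * (k + p))"

lemma unit_weight_inj:
  assumes "fst i \<le> k" "fst i' \<le> k" "\<And>j. j \<le> k \<Longrightarrow> unit_weight i j = unit_weight i' j"
  shows "i = i'"
proof -
  obtain p b p' b' where i: "i = (p, b)" "i' = (p', b')" by (metis surj_pair)
  \<comment> \<open>The simple roots with index below \<open>l\<close> add up to
    \<open>e\<^sub>l\<close>, so the partial sum is the entry of the signed unit vector in position
    \<open>l\<close>.\<close>
  have tel: "(\<Sum>j<l. unit_weight (p, b) j) = (if l = Suc p then if b then 1 else -1 else 0)" for l p b
    by (induction l) (auto simp: unit_weight_def)
  have "(\<Sum>j<Suc p. unit_weight i j) = (\<Sum>j<Suc p. unit_weight i' j)"
    using assms i by (intro sum.cong) auto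
  then show ?thesis unfolding i tel by (auto split: if_splits)
qed

lemma unit_height_sum:
  fixes x :: "'a::comm_semiring_1"
  shows "(\<Sum>i\<in>{..k} \<times> UNIV. x ^ unit_height A T k i) = (1 + x ^ (A + T * k)) * q_number (Suc k) (x ^ T)"
proof -
  have "(\<Sum>i\<in>{..k} \<times> UNIV. x ^ unit_height A T k i)
      = (\<Sum>p\<le>k. x ^ (T * (k - p)) + x ^ (A + T * (k + p)))"
    by (simp add: sum.cartesian_product' UNIV_bool unit_height_def add.commute)
  also have "\<dots> = (\<Sum>p<Suc k. (x ^ T) ^ (Suc k - Suc p)) + x ^ (A + T * k) * (\<Sum>p<Suc k. (x ^ T) ^ p)"
  proof -
    have "x ^ (T * (k - p)) = (x ^ T) ^ (Suc k - Suc p)" for p by (simp add: power_mult)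
    moreover have "x ^ (A + T * (k + p)) = x ^ (A + T * k) * (x ^ T) ^ p" for p
      by (simp add: add_mult_distrib2 power_add power_mult mult.assoc)
    ultimately show ?thesis by (simp only: sum.distrib lessThan_Suc_atMost sum_distrib_left)
  qed
  also have "(\<Sum>p<Suc k. (x ^ T) ^ (Suc k - Suc p)) = (\<Sum>p<Suc k. (x ^ T) ^ p)"
    by (rule sum.nat_diff_reindex)
  finally show ?thesis by (simp add: q_number_def algebra_simps)
qed

context weighted_coxeter begin

lemma gf_empty: "gf (W {}) = 1"
  using gf_singleton[of "cl []"] by (simp add: W_def L_Nil)

lemma Lmax_empty: "Lmax {} 0"
  by (simp add: Lmax_def L_Nil)

text \<open>Induction along the chain: the orbit of a unit vector under B_(k+1) consists of 2(k+1)
  signed unit vectors, with stabiliser B_k. In the maximal weight the \<open>k\<close> reflections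
  in coordinate vectors contribute \<open>A\<close> each, the other \<open>k * (k - 1)\<close>
  contribute \<open>T\<close> each.\<close>

lemma B_chain:
  fixes a :: "nat \<Rightarrow> 's"
  assumes inj: "inj_on a {..<n}" and sub: "a ` {..<n} \<subseteq> S"
    and C: "\<And>i j. i < n \<Longrightarrow> j < n \<Longrightarrow> C (a i) (a j) =
      (if i = j then 2 else if i = 0 \<and> j = 1 then -2 else if j = Suc i \<or> i = Suc j then -1 else 0)"
    and wt0: "n > 0 \<Longrightarrow> wt (a 0) = A" and wt: "\<And>i. 0 < i \<Longrightarrow> i < n \<Longrightarrow> wt (a i) = T"
    and "k \<le> n"
  shows "gf (W (a ` {..<k})) = (\<Prod>i<k. (1 + fps_X ^ (A + T * i)) * q_number (Suc i) (fps_X ^ T))"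
    and "Lmax (a ` {..<k}) (k * A + T * (k * (k - 1)))"
proof -
  have "gf (W (a ` {..<k})) = (\<Prod>i<k. (1 + fps_X ^ (A + T * i)) * q_number (Suc i) (fps_X ^ T)) \<and>
    Lmax (a ` {..<k}) (k * A + T * (k * (k - 1)))"
    using \<open>k \<le> n\<close>
  proof (induction k)
    case 0
    then show ?case using Lmax_empty by (simp add: gf_empty)
  next
    case (Suc k)
    let ?J = "a ` {..<Suc k}" and ?K = "a ` {..<k}" and ?I = "{..k} \<times> (UNIV :: bool set)"
    define pos where "pos = the_inv_into {..<n} a"
    have pos: "pos (a j) = j" if "j \<le> k" for j
      unfolding pos_def using that Suc.prems by (intro the_inv_into_f_f[OF inj]) simp
    define c where "c i s = unit_weight i (pos s)" for i s
    have c: "c i (a j) = unit_weight i j" if "j \<le> k" for i j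
      using that by (simp add: c_def pos)
    have Ck: "C (a i) (a j) =
      (if i = j then 2 else if i = 0 \<and> j = 1 then -2 else if j = Suc i \<or> i = Suc j then -1 else 0)"
      if "i \<le> k" "j \<le> k" for i j
      using C[of i j] that Suc.prems by simp
    have J: "?J \<subseteq> S" using sub Suc.prems by auto
    have "\<exists>g. bij_betw g ?I (MR ?J ?K) \<and> (\<forall>i\<in>?I. L (g i) = unit_height A T k i)"
    proof (rule orbit_bij[where c = c and ?i0.0 = "(k, True)"])
      show "?K \<subseteq> ?J" by auto
      show "?J \<subseteq> S" by (rule J)
      show "c (k, True) s = 0" if "s \<in> ?K" for s
        using that c by (auto simp: unit_weight_def)
      show "c (k, True) s > 0" if "s \<in> ?J - ?K" for s
        using that c by (auto simp: unit_weight_def less_Suc_eq)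
      show "i = i'" if i: "i \<in> ?I" "i' \<in> ?I" and eq: "\<And>t. t \<in> ?J \<Longrightarrow> c i t = c i' t" for i i'
      proof (rule unit_weight_inj[of i k i'])
        show "unit_weight i j = unit_weight i' j" if "j \<le> k" for j
          using eq[of "a j"] c[OF that] that by simp
      qed (use i in auto)
      show "\<exists>s\<in>?J. c i s < 0" if "i \<in> ?I" "i \<noteq> (k, True)" for i
      proof -
        obtain p b where i: "i = (p, b)" "p \<le> k" using \<open>i \<in> ?I\<close> by auto
        \<comment> \<open>The place of a coordinate -1: just after \<open>p\<close> for a positive
          vector, at \<open>p\<close> for a negative one.\<close>
        define j where "j = (if b then Suc p else p)"
        have "j \<le> k" using i that by (auto simp: j_def)
        then have "c i (a j) < 0" unfolding c[OF \<open>j \<le> k\<close>] by (simp add: i j_def unit_weight_def)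
        then show ?thesis using \<open>j \<le> k\<close> by (intro bexI[of _ "a j"]) auto
      qed
      show "\<exists>i'\<in>?I. (\<forall>t\<in>?J. c i' t = c i t - C s t * c i s) \<and>
          (c i s > 0 \<longrightarrow> unit_height A T k i' = unit_height A T k i + wt s)"
        if "i \<in> ?I" "s \<in> ?J" for i s
      proof -
        obtain p b where i: "i = (p, b)" "p \<le> k" using \<open>i \<in> ?I\<close> by auto
        obtain j where s: "s = a j" "j \<le> k" using \<open>s \<in> ?J\<close> by (auto simp: less_Suc_eq_le)
        \<comment> \<open>The image of the signed unit vector under the reflection
          \<open>a j\<close>: a sign change of the first coordinate for \<open>j = 0\<close>,
          otherwise an exchange of two neighbouring coordinates.\<close>
        define i' where "i' = (if j = 0 then if p = 0 then (0, \<not> b) else (p, b)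
          else if p = j then (j - 1, b) else if p = j - 1 then (j, b) else (p, b))"
        have wts: "wt s = (if j = 0 then A else T)" using wt0 wt s Suc.prems by simp
        have i'I: "i' \<in> ?I" using i s by (auto simp: i'_def)
        have "c i' (a l) = c i (a l) - C (a j) (a l) * c i (a j)" if "l \<le> k" for l
          unfolding c[OF that] c[OF s(2)] Ck[OF s(2) that] i(1) i'_def
          by (cases j; cases b) (auto simp: unit_weight_def)
        moreover have "unit_height A T k i' = unit_height A T k i + wt s" if "c i s > 0"
          using that i s unfolding s(1) c[OF s(2)] wts[unfolded s(1)] i(1) i'_def
          by (cases j; cases b) (auto simp: unit_weight_def unit_height_def Suc_diff_le algebra_simps split: if_splits)
        ultimately show ?thesis using i'I s by (intro bexI[of _ i']) (auto simp: less_Suc_eq_le)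
      qed
    qed (auto simp: unit_height_def)
    then obtain g where g: "bij_betw g ?I (MR ?J ?K)" "\<forall>i\<in>?I. L (g i) = unit_height A T k i"
      by blast
    have KJ: "?K \<subseteq> ?J" by auto
    have IH: "gf (W ?K) = (\<Prod>i<k. (1 + fps_X ^ (A + T * i)) * q_number (Suc i) (fps_X ^ T))"
      "Lmax ?K (k * A + T * (k * (k - 1)))" using Suc by simp_all
    have gfJ: "gf (W ?J) = (1 + fps_X ^ (A + T * k)) * q_number (Suc k) (fps_X ^ T) * gf (W ?K)"
      using orbit_gf[OF g _ KJ J] unit_height_sum[of "fps_X :: rat fps" A T k] by simp
    have "Lmax ?J (unit_height A T k (k, False) + (k * A + T * (k * (k - 1))))"
    proof (rule orbit_Lmax[OF g KJ J IH(2)])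
      show "unit_height A T k i \<le> unit_height A T k (k, False)" if "i \<in> ?I" for i
      proof -
        obtain p b where i: "i = (p, b)" "p \<le> k" using \<open>i \<in> ?I\<close> by auto
        have "T * (k - p) \<le> T * (k + k)" "T * (k + p) \<le> T * (k + k)" using i by (auto intro: mult_le_mono2)
        then show ?thesis by (cases b) (simp_all add: i unit_height_def trans_le_add2)
      qed
    qed simp
    moreover have "unit_height A T k (k, False) + (k * A + T * (k * (k - 1))) = Suc k * A + T * (Suc k * (Suc k - 1))"
      by (cases k) (simp_all add: unit_height_def algebra_simps)
    ultimately have "Lmax ?J (Suc k * A + T * (Suc k * (Suc k - 1)))" by (simp only:)
    then show ?case unfolding gfJ IH(1) by (simp add: mult.commute)
  qed
  then show "gf (W (a ` {..<k})) = (\<Prod>i<k. (1 + fps_X ^ (A + T * i)) * q_number (Suc i) (fps_X ^ T))"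
    "Lmax (a ` {..<k}) (k * A + T * (k * (k - 1)))" by blast+
qed

lemma gf_rank_one:
  assumes "s \<in> S"
  shows "gf (W {s}) = 1 + fps_X ^ wt s"
proof -
  have "{..<Suc 0} = {0::nat}" by auto
  \<comment> \<open>A chain with one node; the value 0 chosen for \<open>T\<close> enters only
    trivial factors.\<close>
  then show ?thesis
    using B_chain(1)[of "\<lambda>_. s" 1 "wt s" 0 1] assms by (simp add: C_diag q_number_def)
qed

text \<open>Nodes 0 and 1 are the tips of the fork; the case \<open>i + j = 2\<close> is the edge
  from 0 to 2. The orbit of a unit vector has stabiliser D_k, and the induction starts with two
  commuting nodes.\<close>

lemma D_chain:
  fixes a :: "nat \<Rightarrow> 's"
  assumes inj: "inj_on a {..<n}" and sub: "a ` {..<n} \<subseteq> S"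
    and C: "\<And>i j. i < n \<Longrightarrow> j < n \<Longrightarrow> C (a i) (a j) =
      (if i = j then 2 else if i + j = 1 then 0
       else if j = Suc i \<or> i = Suc j \<or> i + j = 2 then -1 else 0)"
    and wt: "\<And>i. i < n \<Longrightarrow> wt (a i) = T"
    and "2 \<le> k" "k \<le> n"
  shows "gf (W (a ` {..<k})) =
    (\<Prod>i<k. q_number (Suc i) (fps_X ^ T)) * (\<Prod>i=1..<k. 1 + fps_X ^ (T * i))"
  using \<open>2 \<le> k\<close> \<open>k \<le> n\<close>
proof (induction k rule: dec_induct)
  case base
  have S: "a 0 \<in> S" "a 1 \<in> S" using sub base by auto
  have "a 0 \<noteq> a 1" using inj base unfolding inj_on_def by (metis One_nat_def lessThan_iff less_2_cases_iff order_less_le_trans zero_neq_one)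
  moreover have "C (a 0) (a 1) = 0" using C[of 0 1] base by simp
  ultimately have "commuting {a 0} {a 1}"
    using cartan[OF S] by (auto simp: commuting_def)
  then have "gf (W ({a 0} \<union> {a 1})) = gf (W {a 0}) * gf (W {a 1})"
    using S by (intro gf_commuting) auto
  moreover have "a ` {..<2} = {a 0} \<union> {a 1}" by (auto simp: numeral_2_eq_2 less_Suc_eq)
  ultimately show ?case
    using gf_rank_one[OF S(1)] gf_rank_one[OF S(2)] wt[of 0] wt[of 1] base
    by (simp add: numeral_2_eq_2 q_number_def algebra_simps)
next
  case (step k)
  let ?J = "a ` {..<Suc k}" and ?K = "a ` {..<k}" and ?I = "{..k} \<times> (UNIV :: bool set)"
  have k2: "k \<ge> 2" using step by simp
  define pos where "pos = the_inv_into {..<n} a"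
  have pos: "pos (a j) = j" if "j \<le> k" for j
    unfolding pos_def using that step.prems by (intro the_inv_into_f_f[OF inj]) simp
  \<comment> \<open>Node 0 is the root \<open>e\<^sub>1 + e\<^sub>2\<close>, that is
    \<open>e\<^sub>2 - e\<^sub>1\<close> plus twice \<open>e\<^sub>1\<close>; hence this combination
    of type B coordinates.\<close>
  define uw where "uw i j = (if j = 0 then unit_weight i 1 + 2 * unit_weight i 0 else unit_weight i j)"
    for i and j :: nat
  define c where "c i s = uw i (pos s)" for i s
  have c: "c i (a j) = uw i j" if "j \<le> k" for i j
    using that by (simp add: c_def pos)
  have Ck: "C (a i) (a j) =
      (if i = j then 2 else if i + j = 1 then 0
       else if j = Suc i \<or> i = Suc j \<or> i + j = 2 then -1 else 0)"
    if "i \<le> k" "j \<le> k" for i j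
    using C[of i j] that step.prems by simp
  have J: "?J \<subseteq> S" using sub step.prems by auto
  have "\<exists>g. bij_betw g ?I (MR ?J ?K) \<and> (\<forall>i\<in>?I. L (g i) = unit_height 0 T k i)"
  proof (rule orbit_bij[where c = c and ?i0.0 = "(k, True)"])
    show "?K \<subseteq> ?J" by auto
    show "?J \<subseteq> S" by (rule J)
    show "c (k, True) s = 0" if "s \<in> ?K" for s
      using that c k2 by (auto simp: unit_weight_def uw_def)
    show "c (k, True) s > 0" if "s \<in> ?J - ?K" for s
      using that c k2 by (auto simp: unit_weight_def uw_def less_Suc_eq)
    show "i = i'" if i: "i \<in> ?I" "i' \<in> ?I" and eq: "\<And>t. t \<in> ?J \<Longrightarrow> c i t = c i' t" for i i'
    proof (rule unit_weight_inj[of i k i'])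
      have uw: "uw i j = uw i' j" if "j \<le> k" for j
        using eq[of "a j"] c[OF that] that by simp
      \<comment> \<open>Coordinate 1 is known, so the combination at node 0 determines the type B
        coordinate 0.\<close>
      show "unit_weight i j = unit_weight i' j" if "j \<le> k" for j
        using uw[OF that] uw[of 1] k2 by (auto simp: uw_def split: if_splits)
    qed (use i in auto)
    show "\<exists>s\<in>?J. c i s < 0" if "i \<in> ?I" "i \<noteq> (k, True)" for i
    proof -
      obtain p b where i: "i = (p, b)" "p \<le> k" using \<open>i \<in> ?I\<close> by auto
      define j where "j = (if b then Suc p else p)"
      have "j \<le> k" using i that by (auto simp: j_def)
      then have "c i (a j) < 0" unfolding c[OF \<open>j \<le> k\<close>] by (simp add: i j_def unit_weight_def uw_def)
      then show ?thesis using \<open>j \<le> k\<close> by (intro bexI[of _ "a j"]) auto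
    qed
    show "\<exists>i'\<in>?I. (\<forall>t\<in>?J. c i' t = c i t - C s t * c i s) \<and>
        (c i s > 0 \<longrightarrow> unit_height 0 T k i' = unit_height 0 T k i + wt s)"
      if "i \<in> ?I" "s \<in> ?J" for i s
    proof -
      obtain p b where i: "i = (p, b)" "p \<le> k" using \<open>i \<in> ?I\<close> by auto
      obtain j where s: "s = a j" "j \<le> k" using \<open>s \<in> ?J\<close> by (auto simp: less_Suc_eq_le)
      \<comment> \<open>The reflection in \<open>e\<^sub>1 + e\<^sub>2\<close> exchanges the first
        two coordinates and changes both signs; the others are as in type B.\<close>
      define i' where "i' = (if j = 0 then if p = 0 then (1, \<not> b) else if p = 1 then (0, \<not> b) else (p, b)
        else if p = j then (j - 1, b) else if p = j - 1 then (j, b) else (p, b))"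
      have wts: "wt s = T" using wt s step.prems by simp
      have i'I: "i' \<in> ?I" using i s k2 by (auto simp: i'_def)
      have uw_i': "uw i' l = uw i l - (if j = l then 2 else if j + l = 1 then 0
          else if l = Suc j \<or> j = Suc l \<or> j + l = 2 then -1 else 0) * uw i j" for l
      proof (cases "j = 0")
        case True
        consider "p = 0" | "p = 1" | "p \<ge> 2" by linarith
        then show ?thesis
        proof cases
          case 3
          then have "uw i j = 0" "i' = i" using True i by (simp_all add: unit_weight_def uw_def i'_def)
          then show ?thesis by simp
        qed (unfold i'_def i(1), use True in \<open>simp_all add: unit_weight_def uw_def\<close>)
      next
        case False
        then obtain j' where j: "j = Suc j'" by (cases j) auto
        consider "p = j" | "p = j'" | "p \<noteq> j \<and> p \<noteq> j'" by linarith
        then show ?thesis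
        proof cases
          case 3
          then have "uw i j = 0" "i' = i" using j i by (simp_all add: unit_weight_def uw_def i'_def)
          then show ?thesis by simp
        next
          case 1
          consider "l = j" | "l = j'" | "l \<noteq> j \<and> l \<noteq> j'" by linarith
          then show ?thesis unfolding i'_def i(1) 1 j by cases (simp_all add: unit_weight_def uw_def)
        next
          case 2
          consider "l = j" | "l = j'" | "l \<noteq> j \<and> l \<noteq> j'" by linarith
          then show ?thesis unfolding i'_def i(1) 2 j by cases (simp_all add: unit_weight_def uw_def)
        qed
      qed
      have "c i' (a l) = c i (a l) - C (a j) (a l) * c i (a j)" if "l \<le> k" for l
        unfolding c[OF that] c[OF s(2)] Ck[OF s(2) that] by (rule uw_i')
      moreover have "unit_height 0 T k i' = unit_height 0 T k i + wt s" if "c i s > 0"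
        using that i s k2 unfolding s(1) c[OF s(2)] wts[unfolded s(1)] i(1) i'_def
        by (cases j; cases b) (auto simp: unit_weight_def uw_def unit_height_def Suc_diff_le diff_mult_distrib2 algebra_simps split: if_splits)
      ultimately show ?thesis using i'I s by (intro bexI[of _ i']) (auto simp: less_Suc_eq_le)
    qed
  qed (auto simp: unit_height_def)
  then obtain g where g: "bij_betw g ?I (MR ?J ?K)" "\<forall>i\<in>?I. L (g i) = unit_height 0 T k i"
    by blast
  have KJ: "?K \<subseteq> ?J" by auto
  have "gf (W ?J) = (1 + fps_X ^ (T * k)) * q_number (Suc k) (fps_X ^ T) * gf (W ?K)"
    using orbit_gf[OF g _ KJ J] unit_height_sum[of "fps_X :: rat fps" 0 T k] by simp
  also have "gf (W ?K) = (\<Prod>i<k. q_number (Suc i) (fps_X ^ T)) * (\<Prod>i=1..<k. 1 + fps_X ^ (T * i))"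
    using step by simp
  finally show ?case using k2 by (simp add: mult_ac)
qed

end

section \<open>A \<open>q\<close>-Vandermonde identity\<close>

text \<open>The Gaussian binomial coefficient, given by a Pascal rule so that it makes sense without
  division in any commutative ring.\<close>

fun q_binomial :: "nat \<Rightarrow> nat \<Rightarrow> 'a::comm_ring_1 \<Rightarrow> 'a" where
  "q_binomial n 0 t = 1"
| "q_binomial 0 (Suc k) t = 0"
| "q_binomial (Suc n) (Suc k) t = q_binomial n (Suc k) t + t ^ (n - k) * q_binomial n k t"

definition q_fact :: "nat \<Rightarrow> 'a::comm_ring_1 \<Rightarrow> 'a" where
  "q_fact n t = (\<Prod>i<n. q_number (Suc i) t)"

lemma q_fact_Suc: "q_fact (Suc n) t = q_fact n t * q_number (Suc n) t"
  by (simp add: q_fact_def)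

lemma q_number_add: "q_number (k + l) t = q_number k t + t ^ k * q_number l t"
  by (induction l) (simp_all add: q_number_def algebra_simps power_add)

lemma q_binomial_eq_0: "n < k \<Longrightarrow> q_binomial n k t = 0"
  by (induction n k t rule: q_binomial.induct) auto

lemma q_binomial_fact: "k \<le> n \<Longrightarrow> q_binomial n k t * (q_fact k t * q_fact (n - k) t) = q_fact n t"
proof (induction n k t rule: q_binomial.induct)
  case (3 n k t)
  show ?case
  proof (cases "k = n")
    case True
    then show ?thesis using 3 by (simp add: q_binomial_eq_0 q_fact_Suc q_fact_def mult_ac)
  next
    case False
    then have k: "k < n" using 3 by simp
    then have nk: "q_fact (n - k) t = q_fact (n - Suc k) t * q_number (n - k) t"
      using q_fact_Suc[of "n - Suc k" t] by (simp add: Suc_diff_Suc)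
    have "q_binomial (Suc n) (Suc k) t * (q_fact (Suc k) t * q_fact (Suc n - Suc k) t)
      = q_binomial n (Suc k) t * (q_fact (Suc k) t * q_fact (n - Suc k) t) * q_number (n - k) t
        + t ^ (n - k) * (q_binomial n k t * (q_fact k t * q_fact (n - k) t)) * q_number (Suc k) t"
      by (simp add: nk q_fact_Suc algebra_simps)
    also have "\<dots> = q_fact n t * (q_number (n - k) t + t ^ (n - k) * q_number (Suc k) t)"
      using 3 k by (simp add: algebra_simps)
    also have "\<dots> = q_fact (Suc n) t"
      using q_number_add[of "n - k" "Suc k" t] k by (simp add: q_fact_Suc)
    finally show ?thesis .
  qed
qed (auto simp: q_fact_def)

text \<open>With q-Pochhammer symbols to the base t the two products are (-a t^m; t)_(n-m) and (-c
  t^(n-m); t)_m: a q-Vandermonde term with denominators cleared.\<close>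

definition vandermonde_term :: "nat \<Rightarrow> 'a \<Rightarrow> 'a \<Rightarrow> 'a \<Rightarrow> nat \<Rightarrow> 'a::comm_ring_1" where
  "vandermonde_term n t a c m = (- a) ^ m * t ^ (m * (m - 1)) *
     (\<Prod>i=m..<n. 1 + a * t ^ i) * (\<Prod>i=n - m..<n. 1 + c * t ^ i)"

lemma vandermonde_term_Suc:
  assumes "m \<le> n"
  shows "vandermonde_term (Suc n) t a c m = (1 + a * t ^ n) * vandermonde_term n t a (c * t) m"
proof -
  have "(\<Prod>i=m..<Suc n. 1 + a * t ^ i) = (\<Prod>i=m..<n. 1 + a * t ^ i) * (1 + a * t ^ n)"
    using assms by (simp add: prod.atLeastLessThan_Suc)
  moreover have "(\<Prod>i=Suc n - m..<Suc n. 1 + c * t ^ i) = (\<Prod>i=n - m..<n. 1 + c * t * t ^ i)"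
    using assms by (simp only: Suc_diff_le prod.shift_bounds_Suc_ivl power_Suc mult.assoc)
  ultimately show ?thesis by (simp add: vandermonde_term_def mult_ac)
qed

lemma vandermonde_term_Suc_Suc:
  assumes "m \<le> n"
  shows "t ^ (n - m) * vandermonde_term (Suc n) t a c (Suc m)
    = - a * t ^ n * (1 + c * t ^ n) * vandermonde_term n t (a * t) c m"
proof -
  have 1: "(\<Prod>i=Suc m..<Suc n. 1 + a * t ^ i) = (\<Prod>i=m..<n. 1 + a * t * t ^ i)"
    by (simp only: prod.shift_bounds_Suc_ivl power_Suc mult.assoc)
  have 2: "(\<Prod>i=Suc n - Suc m..<Suc n. 1 + c * t ^ i) = (\<Prod>i=n - m..<n. 1 + c * t ^ i) * (1 + c * t ^ n)"
    by (simp add: prod.atLeastLessThan_Suc)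
  have 3: "t ^ (n - m) * ((- a) ^ Suc m * t ^ (Suc m * (Suc m - 1)))
      = - a * t ^ n * ((- (a * t)) ^ m * t ^ (m * (m - 1)))"
  proof -
    have e: "n - m + Suc m * (Suc m - 1) = n + (m + m * (m - 1))"
      using assms by (cases m) (simp_all add: algebra_simps)
    have "t ^ (n - m) * ((- a) ^ Suc m * t ^ (Suc m * (Suc m - 1)))
        = (- a) * (- a) ^ m * t ^ (n - m + Suc m * (Suc m - 1))" by (simp add: power_add algebra_simps)
    also have "\<dots> = - a * t ^ n * ((- (a * t)) ^ m * t ^ (m * (m - 1)))"
      unfolding e by (simp add: power_add power_mult_distrib mult_minus_left[symmetric] del: mult_minus_left)
    finally show ?thesis .
  qed
  have "t ^ (n - m) * vandermonde_term (Suc n) t a c (Suc m)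
    = t ^ (n - m) * ((- a) ^ Suc m * t ^ (Suc m * (Suc m - 1))) *
      (\<Prod>i=Suc m..<Suc n. 1 + a * t ^ i) * (\<Prod>i=Suc n - Suc m..<Suc n. 1 + c * t ^ i)"
    by (simp only: vandermonde_term_def mult.assoc)
  also have "\<dots> = - a * t ^ n * (1 + c * t ^ n) * vandermonde_term n t (a * t) c m"
    unfolding 1 2 3 vandermonde_term_def by (simp add: mult_ac)
  finally show ?thesis .
qed

text \<open>Induction by the Pascal rule. One half replaces \<open>c\<close> by
  \<open>c * t\<close>, the other \<open>a\<close> by \<open>a * t\<close>. Both have the same
  product of parameters, so the induction hypothesis gives the same value, and the factors in front
  combine to \<open>1 - a * c * t ^ (n + n)\<close>.\<close>

lemma q_vandermonde:
  "(\<Sum>m\<le>n. q_binomial n m t * vandermonde_term n t a c m) = (\<Prod>i<n. 1 - a * c * t ^ (n - 1 + i))"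
proof (induction n arbitrary: a c)
  case 0
  then show ?case by (simp add: vandermonde_term_def)
next
  case (Suc n)
  let ?P = "\<Prod>i<n. 1 - a * c * t ^ (n + i)"
  have shift: "(\<Prod>i<n. 1 - a * c * t * t ^ (n - 1 + i)) = ?P"
    by (intro prod.cong) (auto simp: mult.assoc power_Suc[symmetric] simp del: power_Suc)
  have 1: "(\<Sum>m\<le>n. q_binomial n m t * vandermonde_term n t a (c * t) m) = ?P"
    and 2: "(\<Sum>m\<le>n. q_binomial n m t * vandermonde_term n t (a * t) c m) = ?P"
    using Suc.IH[of a "c * t"] Suc.IH[of "a * t" c] shift by (simp_all add: mult_ac)
  have "(\<Sum>m\<le>Suc n. q_binomial (Suc n) m t * vandermonde_term (Suc n) t a c m)
      = (\<Sum>m\<le>Suc n. q_binomial n m t * vandermonde_term (Suc n) t a c m)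
        + (\<Sum>m\<le>n. t ^ (n - m) * q_binomial n m t * vandermonde_term (Suc n) t a c (Suc m))"
    unfolding sum.atMost_Suc_shift by (simp add: algebra_simps sum.distrib)
  also have "(\<Sum>m\<le>Suc n. q_binomial n m t * vandermonde_term (Suc n) t a c m)
      = (\<Sum>m\<le>n. q_binomial n m t * vandermonde_term (Suc n) t a c m)"
    by (simp add: q_binomial_eq_0)
  also have "\<dots> = (\<Sum>m\<le>n. (1 + a * t ^ n) * (q_binomial n m t * vandermonde_term n t a (c * t) m))"
    by (intro sum.cong) (auto simp: vandermonde_term_Suc)
  also have "\<dots> = (1 + a * t ^ n) * ?P" by (simp only: sum_distrib_left[symmetric] 1)
  also have "(\<Sum>m\<le>n. t ^ (n - m) * q_binomial n m t * vandermonde_term (Suc n) t a c (Suc m))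
      = (\<Sum>m\<le>n. - a * t ^ n * (1 + c * t ^ n) * (q_binomial n m t * vandermonde_term n t (a * t) c m))"
  proof (rule sum.cong[OF HOL.refl])
    fix m assume "m \<in> {..n}"
    have "t ^ (n - m) * q_binomial n m t * vandermonde_term (Suc n) t a c (Suc m)
      = q_binomial n m t * (t ^ (n - m) * vandermonde_term (Suc n) t a c (Suc m))" by (simp add: mult_ac)
    also have "\<dots> = - a * t ^ n * (1 + c * t ^ n) * (q_binomial n m t * vandermonde_term n t (a * t) c m)"
      using \<open>m \<in> {..n}\<close> by (subst vandermonde_term_Suc_Suc) (auto simp: mult_ac)
    finally show "t ^ (n - m) * q_binomial n m t * vandermonde_term (Suc n) t a c (Suc m)
      = - a * t ^ n * (1 + c * t ^ n) * (q_binomial n m t * vandermonde_term n t (a * t) c m)" .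
  qed
  also have "\<dots> = - a * t ^ n * (1 + c * t ^ n) * ?P" by (simp only: sum_distrib_left[symmetric] 2)
  also have "(1 + a * t ^ n) * ?P + - a * t ^ n * (1 + c * t ^ n) * ?P
      = ?P * (1 - a * c * t ^ (n + n))" by (simp add: algebra_simps power_add)
  also have "\<dots> = (\<Prod>i<Suc n. 1 - a * c * t ^ (Suc n - 1 + i))" by simp
  finally show ?case .
qed

section \<open>The weighted Poincare series of affine B\<close>

text \<open>The entry -2 at (0, 1) makes node 0 the short root \<open>e\<^sub>1\<close>, as in
  \<open>B_chain\<close>.\<close>

definition B_cartan :: "nat \<Rightarrow> nat \<Rightarrow> nat \<Rightarrow> int" where
  "B_cartan n i j =
    (if i = j then 2 else if i = 0 \<and> j = 1 then -2 else if affine_B_matrix n i j = 2 then 0 else -1)"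

lemma affine_B_matrix_sym: "affine_B_matrix n i j = affine_B_matrix n j i"
  by (simp add: affine_B_matrix_def insert_commute eq_commute)

text \<open>Ordering the indices turns unordered edges into pairs, and the edge from
  \<open>n - 2\<close> to \<open>n - 1\<close> becomes the last one of the chain.\<close>

lemma affine_B_matrix_less:
  assumes "n \<ge> 3" "i < j" "j \<le> n"
  shows "affine_B_matrix n i j = (if i = 0 \<and> j = 1 then 4
    else if 1 \<le> i \<and> j = Suc i \<and> j < n \<or> i = n - 2 \<and> j = n then 3 else 2)"
proof -
  have d: "{i, j} = {x, y} \<longleftrightarrow> i = x \<and> j = y" if "x < y" for x y
    using assms(2) that by (auto simp: doubleton_eq_iff)
  have ex: "(\<exists>k. 1 \<le> k \<and> k \<le> n - 3 \<and> {i, j} = {k, k + 1}) \<longleftrightarrow> 1 \<le> i \<and> i \<le> n - 3 \<and> j = Suc i"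
    by (simp add: d)
  have lt: "0 < (1::nat)" "n - 2 < n - 1" "n - 2 < n" using assms(1) by auto
  have "(1 \<le> i \<and> i \<le> n - 3 \<and> j = Suc i) \<or> (i = n - 2 \<and> j = n - 1) \<or> (i = n - 2 \<and> j = n)
    \<longleftrightarrow> 1 \<le> i \<and> j = Suc i \<and> j < n \<or> i = n - 2 \<and> j = n"
    using assms by presburger
  moreover have "i \<noteq> j" using assms(2) by simp
  ultimately show ?thesis
    unfolding affine_B_matrix_def ex d[OF lt(1)] d[OF lt(2)] d[OF lt(3)] by (simp only: if_False)
qed

lemma B_cartan_less:
  assumes "n \<ge> 3" "i < j" "j \<le> n"
  shows "B_cartan n i j = (if i = 0 \<and> j = 1 then -2
      else if j = Suc i \<and> j < n \<or> i = n - 2 \<and> j = n then -1 else 0)"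
    and "B_cartan n j i = (if j = Suc i \<and> j < n \<or> i = n - 2 \<and> j = n then -1 else 0)"
proof -
  have ij: "i \<noteq> j" using assms(2) by simp
  show "B_cartan n i j = (if i = 0 \<and> j = 1 then -2
      else if j = Suc i \<and> j < n \<or> i = n - 2 \<and> j = n then -1 else 0)"
  proof (cases "i = 0 \<and> j = 1")
    case False
    then have e: "1 \<le> i \<and> j = Suc i \<and> j < n \<or> i = n - 2 \<and> j = n \<longleftrightarrow> j = Suc i \<and> j < n \<or> i = n - 2 \<and> j = n"
      using assms by auto
    show ?thesis unfolding B_cartan_def affine_B_matrix_less[OF assms] e using False ij by auto
  qed (simp add: B_cartan_def)
  show "B_cartan n j i = (if j = Suc i \<and> j < n \<or> i = n - 2 \<and> j = n then -1 else 0)"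
  proof (cases "i = 0 \<and> j = 1")
    case True
    then show ?thesis using assms
      unfolding B_cartan_def affine_B_matrix_sym[of n j i] affine_B_matrix_less[OF assms] by simp
  next
    case False
    then have e: "1 \<le> i \<and> j = Suc i \<and> j < n \<or> i = n - 2 \<and> j = n \<longleftrightarrow> j = Suc i \<and> j < n \<or> i = n - 2 \<and> j = n"
      using assms by auto
    have "j \<noteq> 0" using assms by simp
    then show ?thesis using False ij
      unfolding B_cartan_def affine_B_matrix_sym[of n j i] affine_B_matrix_less[OF assms] e by auto
  qed
qed

lemma B_cartan_eq:
  assumes "n \<ge> 3" "s \<le> n" "t \<le> n"
  shows "B_cartan n s t = (if s = t then 2 else if s = 0 \<and> t = 1 then -2
      else if t = Suc s \<and> t < n \<or> s = n - 2 \<and> t = n \<or> s = Suc t \<and> s < n \<or> t = n - 2 \<and> s = n then -1 else 0)"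
proof (cases s t rule: linorder_cases)
  case less
  show ?thesis unfolding B_cartan_less(1)[OF assms(1) less assms(3)] using less assms by simp
next
  case greater
  show ?thesis unfolding B_cartan_less(2)[OF assms(1) greater assms(2)] using greater assms by simp
qed (simp add: B_cartan_def)

lemma coxeter_cartan_affine_B:
  assumes "n \<ge> 3"
  shows "coxeter_cartan {0..n} (affine_B_matrix n) (B_cartan n)"
proof (unfold_locales, goal_cases)
  case (3 s t)
  have *: "affine_B_matrix n i j = 2 \<and> affine_B_matrix n j i = 2 \<and> B_cartan n i j = 0 \<and> B_cartan n j i = 0 \<or>
      affine_B_matrix n i j = 3 \<and> affine_B_matrix n j i = 3 \<and> B_cartan n i j = -1 \<and> B_cartan n j i = -1 \<or>
      affine_B_matrix n i j = 4 \<and> affine_B_matrix n j i = 4 \<and> B_cartan n i j = -2 \<and> B_cartan n j i = -1"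
    if "i < j" "j \<le> n" for i j
    using affine_B_matrix_less[OF assms that] B_cartan_less[OF assms that] affine_B_matrix_sym[of n j i] assms
    by auto
  show ?case using *[of s t] *[of t s] 3 by (cases "s < t") auto
qed (simp_all add: affine_B_matrix_def B_cartan_def)

text \<open>The coefficients of the null root in the simple roots.\<close>

definition affine_B_mark :: "nat \<Rightarrow> nat \<Rightarrow> int" where
  "affine_B_mark n s = (if s \<le> n - 2 then 2 else 1)"

lemma affine_B_mark_null:
  assumes n: "n \<ge> 3" and s: "s \<le> n"
  shows "(\<Sum>t\<in>{0..n}. affine_B_mark n t * B_cartan n s t) = 0"
proof -
  note C = B_cartan_eq[OF n s]
  \<comment> \<open>Only \<open>s\<close> and its neighbours contribute; the cases below are the
    positions of \<open>s\<close> with different neighbourhoods.\<close>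
  have red: "(\<Sum>t\<in>{0..n}. affine_B_mark n t * B_cartan n s t) = (\<Sum>t\<in>X. affine_B_mark n t * B_cartan n s t)"
    if "X \<subseteq> {0..n}" "\<And>t. t \<le> n \<Longrightarrow> t \<notin> X \<Longrightarrow> B_cartan n s t = 0" for X
    using that by (intro sum.mono_neutral_right) auto
  consider "s = 0" | "1 \<le> s" "s < n - 2" | "s = n - 2" | "s = n - 1" | "s = n" using s by linarith
  then show ?thesis
  proof cases
    case 1
    have "(\<Sum>t\<in>{0..n}. affine_B_mark n t * B_cartan n s t) = (\<Sum>t\<in>{0, 1}. affine_B_mark n t * B_cartan n s t)"
      using n C 1 by (intro red) auto
    then show ?thesis using n C 1 by (simp add: affine_B_mark_def)
  next
    case 2
    then obtain r where r: "s = Suc r" by (cases s) auto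
    have "(\<Sum>t\<in>{0..n}. affine_B_mark n t * B_cartan n s t) = (\<Sum>t\<in>{r, s, Suc s}. affine_B_mark n t * B_cartan n s t)"
      using n C 2 r by (intro red) auto
    then show ?thesis using n C 2 r by (simp add: affine_B_mark_def)
  next
    case 3
    define k where "k = n - 3"
    have k: "n = Suc (Suc (Suc k))" using n by (simp add: k_def)
    have "(\<Sum>t\<in>{0..n}. affine_B_mark n t * B_cartan n s t)
      = (\<Sum>t\<in>{k, Suc k, Suc (Suc k), Suc (Suc (Suc k))}. affine_B_mark n t * B_cartan n s t)"
      by (rule red) (use C 3 k in \<open>auto split: if_splits\<close>)
    then show ?thesis using C 3 k by (simp add: affine_B_mark_def)
  next
    case 4
    define k where "k = n - 3"
    have k: "n = Suc (Suc (Suc k))" using n by (simp add: k_def)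
    have "(\<Sum>t\<in>{0..n}. affine_B_mark n t * B_cartan n s t)
      = (\<Sum>t\<in>{Suc k, Suc (Suc k)}. affine_B_mark n t * B_cartan n s t)"
      by (rule red) (use C 4 k in \<open>auto split: if_splits\<close>)
    then show ?thesis using C 4 k by (simp add: affine_B_mark_def)
  next
    case 5
    define k where "k = n - 3"
    have k: "n = Suc (Suc (Suc k))" using n by (simp add: k_def)
    have "(\<Sum>t\<in>{0..n}. affine_B_mark n t * B_cartan n s t)
      = (\<Sum>t\<in>{Suc k, Suc (Suc (Suc k))}. affine_B_mark n t * B_cartan n s t)"
      by (rule red) (use C 5 k in \<open>auto split: if_splits\<close>)
    then show ?thesis using C 5 k by (simp add: affine_B_mark_def)
  qed
qed

section \<open>The alternating sum over descent sets\<close>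

context weighted_coxeter begin

lemma E_iff:
  assumes "w \<in> lists S" "K \<subseteq> S" "M \<subseteq> S"
  shows "cl w \<in> E K M \<longleftrightarrow> (\<forall>s\<in>K. \<not> asc w s) \<and> (\<forall>s\<in>M. asc w s)"
proof
  assume "cl w \<in> E K M"
  then obtain v where v: "cl w = cl v" "v \<in> lists S" "\<forall>s\<in>K. \<not> asc v s" "jmin M v"
    by (auto simp: E_def)
  have "w \<approx> v" using v(1) cl_eq_iff[OF assms(1)] by simp
  then have "asc w s = asc v s" if "s \<in> S" for s using asc_cong that by blast
  then show "(\<forall>s\<in>K. \<not> asc w s) \<and> (\<forall>s\<in>M. asc w s)" using v assms unfolding jmin_def by blast
qed (use assms in \<open>auto simp: E_def jmin_def\<close>)

lemma E_sub: "E K M \<subseteq> W S"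
  by (auto simp: E_def W_def)

lemma gf_nth:
  assumes "A \<subseteq> W S"
  shows "fps_nth (gf A) k = (\<Sum>c\<in>{c \<in> W S. L c = k}. of_bool (c \<in> A))"
proof -
  have "{c \<in> A. L c = k} = {c \<in> {c \<in> W S. L c = k}. c \<in> A}" using assms by auto
  then show ?thesis using finite_level[of k] by (simp add: gf_def sum.If_cases of_bool_def Int_def)
qed

lemma cl_eq_Nil_iff:
  assumes "w \<in> lists S"
  shows "cl w = cl [] \<longleftrightarrow> (\<forall>s\<in>S. asc w s)"
proof
  assume "cl w = cl []"
  then have "w \<approx> []" using cl_eq_iff assms by blast
  then show "\<forall>s\<in>S. asc w s" using asc_cong[of w "[]"] asc_Nil by blast
next
  assume "\<forall>s\<in>S. asc w s"
  then have "w \<approx> []" using jmin_trivial[of S w] assms by (simp add: jmin_def)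
  then show "cl w = cl []" by (rule cl_cong)
qed

end

locale affine_B_weighted =
  weighted_coxeter "{0..n}" "affine_B_matrix n" "B_cartan n" L wt for n :: nat and L wt +
  fixes A T :: nat
  assumes n3: "n \<ge> 3" and wt0: "wt 0 = A" and wtT: "1 \<le> i \<Longrightarrow> i \<le> n \<Longrightarrow> wt i = T"
begin

text \<open>The pairing of a weight with the null root is invariant under firing. It is positive for
  the all-ones weight, but would be at most 0 after \<open>w\<close> if every generator were a
  descent.\<close>

lemma exists_asc:
  assumes "w \<in> lists {0..n}"
  shows "\<exists>s\<le>n. asc w s"
proof (rule ccontr)
  assume a: "\<not> (\<exists>s\<le>n. asc w s)"
  define lev where "lev f = (\<Sum>t\<in>{0..n}. affine_B_mark n t * f t)" for f
  have "lev (fire s f) = lev f" if "s \<le> n" for s f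
  proof -
    have "lev (fire s f) = lev f - f s * (\<Sum>t\<in>{0..n}. affine_B_mark n t * B_cartan n s t)"
      by (simp add: lev_def fire_def algebra_simps sum_subtractf sum_distrib_left)
    then show ?thesis using affine_B_mark_null[OF n3 that] by simp
  qed
  then have "lev (play w f) = lev f" for f
    using assms by (induction w arbitrary: f) auto
  then have "lev (play w (\<lambda>_. 1)) = lev (\<lambda>_. 1)" .
  moreover have "lev (\<lambda>_. 1) > 0"
    unfolding lev_def by (intro sum_pos) (auto simp: affine_B_mark_def)
  moreover have "lev (play w (\<lambda>_. 1)) \<le> 0"
    unfolding lev_def
  proof (intro sum_nonpos)
    fix t assume t: "t \<in> {0..n}"
    then have "play w (\<lambda>_. 1) t \<le> 0" using a assms by (intro not_asc_play_nonpos) auto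
    then show "affine_B_mark n t * play w (\<lambda>_. 1) t \<le> 0"
      by (simp add: affine_B_mark_def mult_le_0_iff)
  qed
  ultimately show False by simp
qed

text \<open>Let \<open>q\<close> be the least ascent. A term of the first sum asks for
  \<open>m \<le> q\<close> and for ascents at all generators beyond m; so only m = q - 1 and m = q
  can survive, and away from the fork they cancel. For q = 0 only m = 0 is left, and it recognises
  the identity.\<close>

lemma descent_signs:
  assumes w: "w \<in> lists {0..n}"
  shows "(\<Sum>m<n - 1. (-1) ^ m * of_bool (cl w \<in> E {..<m} {Suc m..n}))
    + (-1) ^ (n - 1) * of_bool (cl w \<in> E {..<n - 1} {})
    + (-1) ^ n * (of_bool (cl w \<in> E {..<n} {}) + of_bool (cl w \<in> E (insert n {..<n - 1}) {}))
    = (of_bool (cl w = cl []) :: rat)"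
proof -
  define q where "q = (LEAST s. asc w s)"
  have "asc w q" and desc: "\<And>s. s < q \<Longrightarrow> \<not> asc w s"
    using exists_asc[OF w] unfolding q_def by (auto intro: LeastI dest: not_less_Least)
  have qn: "q \<le> n" using exists_asc[OF w] unfolding q_def by (meson Least_le le_trans)
  have below: "(\<forall>s<m. \<not> asc w s) \<longleftrightarrow> m \<le> q" for m
    using \<open>asc w q\<close> desc by (metis leD leI less_le_trans)
  define R where "R x \<longleftrightarrow> (\<forall>s\<in>{x..n}. asc w s)" for x
  have mid: "cl w \<in> E {..<m} {Suc m..n} \<longleftrightarrow> m \<le> q \<and> R (Suc m)" if "m < n - 1" for m
  proof -
    have "{..<m} \<subseteq> {0..n}" "{Suc m..n} \<subseteq> {0..n}" using that by auto
    from E_iff[OF w this] show ?thesis using below[of m] by (simp add: R_def Ball_def)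
  qed
  have n1: "cl w \<in> E {..<n - 1} {} \<longleftrightarrow> n - 1 \<le> q"
  proof -
    have "{..<n - 1} \<subseteq> {0..n}" by auto
    from E_iff[OF w this, of "{}"] show ?thesis using below[of "n - 1"] by (simp add: Ball_def)
  qed
  have n2: "cl w \<in> E {..<n} {} \<longleftrightarrow> n \<le> q"
  proof -
    have "{..<n} \<subseteq> {0..n}" by auto
    from E_iff[OF w this, of "{}"] show ?thesis using below[of n] by (simp add: Ball_def)
  qed
  have n3': "cl w \<in> E (insert n {..<n - 1}) {} \<longleftrightarrow> n - 1 \<le> q \<and> \<not> asc w n"
  proof -
    have "insert n {..<n - 1} \<subseteq> {0..n}" by auto
    from E_iff[OF w this, of "{}"] show ?thesis using below[of "n - 1"] by (auto simp: Ball_def)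
  qed
  have R_desc: "\<not> R x" if "x < q" for x using desc[OF that] that qn by (auto simp: R_def)
  have Rq: "R q \<longleftrightarrow> R (Suc q)"
  proof -
    have "{q..n} = insert q {Suc q..n}" using qn by auto
    then show ?thesis using \<open>asc w q\<close> by (simp add: R_def)
  qed
  have e: "cl w = cl [] \<longleftrightarrow> R 0" using cl_eq_Nil_iff[OF w] by (simp add: R_def)
  have even: "(-1) ^ n = - ((-1) ^ (n - 1) :: rat)" using n3 by (cases n) auto
  consider "q = 0" | "1 \<le> q" "q < n - 1" | "q = n - 1" | "q = n" using qn by linarith
  then show ?thesis
  proof cases
    case 1
    have "(\<Sum>m<n - 1. (-1) ^ m * of_bool (cl w \<in> E {..<m} {Suc m..n}))
        = (\<Sum>m\<in>{0}. (-1) ^ m * (of_bool (cl w \<in> E {..<m} {Suc m..n}) :: rat))"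
      using n3 1 mid by (intro sum.mono_neutral_right) auto
    then show ?thesis using n1 n2 n3' mid[of 0] e Rq 1 n3 by simp
  next
    case 2
    then obtain r where r: "q = Suc r" by (cases q) auto
    have "(\<Sum>m<n - 1. (-1) ^ m * of_bool (cl w \<in> E {..<m} {Suc m..n}))
        = (\<Sum>m\<in>{r, q}. (-1) ^ m * (of_bool (cl w \<in> E {..<m} {Suc m..n}) :: rat))"
    proof (intro sum.mono_neutral_right ballI)
      fix m assume m: "m \<in> {..<n - 1} - {r, q}"
      show "(-1) ^ m * (of_bool (cl w \<in> E {..<m} {Suc m..n}) :: rat) = 0"
        using mid[of m] R_desc[of "Suc m"] m r by auto
    qed (use 2 r in auto)
    also have "\<dots> = (-1) ^ r * of_bool (cl w \<in> E {..<r} {Suc r..n}) + (-1) ^ q * of_bool (cl w \<in> E {..<q} {Suc q..n})"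
      by (subst sum.insert) (simp_all add: r)
    also have "\<dots> = 0" using mid[of r] mid[of q] Rq 2 r by simp
    finally show ?thesis using n1 n2 n3' e R_desc[of 0] 2 by simp
  next
    \<comment> \<open>The term m = n - 2 records whether \<open>n\<close> is an ascent and the fork
      set containing \<open>n\<close> whether it is a descent; together they cancel the term m = n -
      1.\<close>
    case 3
    define k where "k = n - 2"
    have k: "n - 1 = Suc k" "n = Suc (Suc k)" using n3 by (auto simp: k_def)
    have "(\<Sum>m<n - 1. (-1) ^ m * of_bool (cl w \<in> E {..<m} {Suc m..n}))
        = (\<Sum>m\<in>{k}. (-1) ^ m * (of_bool (cl w \<in> E {..<m} {Suc m..n}) :: rat))"
    proof (intro sum.mono_neutral_right ballI)
      fix m assume m: "m \<in> {..<n - 1} - {k}"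
      show "(-1) ^ m * (of_bool (cl w \<in> E {..<m} {Suc m..n}) :: rat) = 0"
        using mid[of m] R_desc[of "Suc m"] m k 3 by auto
    qed (use k in auto)
    also have "\<dots> = (-1) ^ k * of_bool (asc w n)"
    proof -
      have "R (Suc k) \<longleftrightarrow> asc w n"
        using Rq 3 k \<open>asc w q\<close> by (auto simp: R_def less_Suc_eq_le le_Suc_eq)
      then show ?thesis using mid[of k] 3 k by simp
    qed
    finally show ?thesis using n1 n2 n3' e R_desc[of 0] 3 k by simp
  next
    \<comment> \<open>Only the sets with descents \<open>{..<n - 1}\<close> and
      \<open>{..<n}\<close> are met, with opposite signs.\<close>
    case 4
    have "(\<Sum>m<n - 1. (-1) ^ m * (of_bool (cl w \<in> E {..<m} {Suc m..n}) :: rat)) = 0"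
      using mid R_desc 4 by (intro sum.neutral) auto
    then show ?thesis using n1 n2 n3' e R_desc[of 0] 4 n3 \<open>asc w q\<close> even by simp
  qed
qed

lemma gf_alternating:
  "(\<Sum>m<n - 1. (-1) ^ m * gf (E {..<m} {Suc m..n})) + (-1) ^ (n - 1) * gf (E {..<n - 1} {})
    + (-1) ^ n * (gf (E {..<n} {}) + gf (E (insert n {..<n - 1}) {})) = 1" (is "?S = 1")
proof (rule fps_ext)
  fix k
  let ?g = "\<lambda>c. (\<Sum>m<n - 1. (-1) ^ m * of_bool (c \<in> E {..<m} {Suc m..n}))
      + (-1) ^ (n - 1) * of_bool (c \<in> E {..<n - 1} {})
      + (-1) ^ n * (of_bool (c \<in> E {..<n} {}) + of_bool (c \<in> E (insert n {..<n - 1}) {}))"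
  let ?X = "{c \<in> W {0..n}. L c = k}"
  have sg: "fps_nth ((-1) ^ j * f) k = (-1) ^ j * fps_nth f k" for j and f :: "rat fps"
    by (cases "even j") simp_all
  have Nil: "{cl []} \<subseteq> W {0..n}" by (auto simp: W_def)
  have "fps_nth ?S k
    = (\<Sum>m<n - 1. \<Sum>c\<in>?X. (-1) ^ m * of_bool (c \<in> E {..<m} {Suc m..n}))
      + (\<Sum>c\<in>?X. (-1) ^ (n - 1) * of_bool (c \<in> E {..<n - 1} {}))
      + (\<Sum>c\<in>?X. (-1) ^ n * (of_bool (c \<in> E {..<n} {}) + of_bool (c \<in> E (insert n {..<n - 1}) {})))"
    by (simp add: fps_sum_nth sg gf_nth[OF E_sub] sum_distrib_left[symmetric] sum.distrib)
  also have "\<dots> = sum ?g ?X"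
    by (subst sum.swap) (simp only: sum.distrib)
  also have "\<dots> = (\<Sum>c\<in>?X. of_bool (c \<in> {cl []}))"
  proof (rule sum.cong[OF HOL.refl])
    fix c assume "c \<in> ?X"
    then obtain w where "w \<in> lists {0..n}" "c = cl w" by (auto simp: W_def)
    then show "?g c
      = (of_bool (c \<in> {cl []}) :: rat)"
      using descent_signs by simp
  qed
  also have "\<dots> = fps_nth (gf {cl []}) k" using gf_nth[OF Nil] by simp
  finally show "fps_nth ?S k = fps_nth 1 k"
    by (simp add: gf_singleton L_Nil)
qed

section \<open>Parabolic factors and the closed form of the series\<close>

abbreviation a where "a \<equiv> (fps_X :: rat fps) ^ A"
abbreviation t where "t \<equiv> (fps_X :: rat fps) ^ T"

lemma chain_cartan:
  assumes "i < n" "j < n"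
  shows "B_cartan n i j = (if i = j then 2 else if i = 0 \<and> j = 1 then -2
      else if j = Suc i \<or> i = Suc j then -1 else 0)"
  using B_cartan_eq[OF n3, of i j] assms by simp

lemma left_parabolic:
  assumes "m \<le> n"
  shows "gf (W {..<m}) = (\<Prod>i<m. 1 + a * t ^ i) * q_fact m t" and "Lmax {..<m} (m * A + T * (m * (m - 1)))"
proof -
  have C: "B_cartan n (id i) (id j) = (if i = j then 2 else if i = 0 \<and> j = 1 then -2
      else if j = Suc i \<or> i = Suc j then -1 else 0)" if "i < n" "j < n" for i j
    using chain_cartan that by simp
  note B = B_chain[of id n A T m, OF _ _ C _ _ assms]
  have "gf (W (id ` {..<m})) = (\<Prod>i<m. (1 + fps_X ^ (A + T * i)) * q_number (Suc i) t)"
    by (rule B(1)) (use wt0 wtT in auto)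
  then show "gf (W {..<m}) = (\<Prod>i<m. 1 + a * t ^ i) * q_fact m t"
    by (simp add: prod.distrib q_fact_def power_add power_mult)
  have "Lmax (id ` {..<m}) (m * A + T * (m * (m - 1)))"
    by (rule B(2)) (use wt0 wtT in auto)
  then show "Lmax {..<m} (m * A + T * (m * (m - 1)))" by simp
qed

text \<open>The other branch of the fork: ending the chain in \<open>n\<close> instead of
  \<open>n - 1\<close> gives a second parabolic subgroup of type B_n.\<close>

lemma left_parabolic_fork:
  shows "gf (W (insert n {..<n - 1})) = (\<Prod>i<n. 1 + a * t ^ i) * q_fact n t"
    and "Lmax (insert n {..<n - 1}) (n * A + T * (n * (n - 1)))"
proof -
  define b where "b i = (if i = n - 1 then n else i)" for i
  have img: "b ` {..<n} = insert n {..<n - 1}"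
  proof -
    have "{..<n} = insert (n - 1) {..<n - 1}" using n3 by auto
    then show ?thesis by (auto simp: b_def image_iff)
  qed
  have C: "B_cartan n (b i) (b j) = (if i = j then 2 else if i = 0 \<and> j = 1 then -2
      else if j = Suc i \<or> i = Suc j then -1 else 0)" if ij: "i < n" "j < n" for i j
  proof -
    have last: "B_cartan n n k = (if Suc k = n - 1 then -1 else 0)"
      "B_cartan n k n = (if Suc k = n - 1 then -1 else 0)" if "k < n - 1" for k
      using B_cartan_less[OF n3, of k n] that n3 by auto
    consider "i = n - 1" "j = n - 1" | "i = n - 1" "j < n - 1" | "i < n - 1" "j = n - 1" | "i < n - 1" "j < n - 1"
      using ij by linarith
    then show ?thesis
    proof cases
      case 1
      then show ?thesis by (simp add: B_cartan_def)
    next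
      case 2
      then show ?thesis using last(1)[of j] n3 by (auto simp: b_def)
    next
      case 3
      then show ?thesis using last(2)[of i] n3 by (auto simp: b_def)
    next
      case 4
      then show ?thesis using chain_cartan[of i j] by (simp add: b_def)
    qed
  qed
  have inj: "inj_on b {..<n}" by (auto simp: inj_on_def b_def)
  note B = B_chain[of b n A T n, OF inj _ C]
  have "gf (W (b ` {..<n})) = (\<Prod>i<n. (1 + fps_X ^ (A + T * i)) * q_number (Suc i) t)"
    by (rule B(1)) (use wt0 wtT n3 in \<open>auto simp: b_def\<close>)
  then show "gf (W (insert n {..<n - 1})) = (\<Prod>i<n. 1 + a * t ^ i) * q_fact n t"
    by (simp add: img prod.distrib q_fact_def power_add power_mult)
  have "Lmax (b ` {..<n}) (n * A + T * (n * (n - 1)))"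
    by (rule B(2)) (use wt0 wtT n3 in \<open>auto simp: b_def\<close>)
  then show "Lmax (insert n {..<n - 1}) (n * A + T * (n * (n - 1)))" by (simp only: img)
qed

lemma right_parabolic:
  assumes "m < n - 1"
  shows "gf (W {Suc m..n}) = q_fact (n - m) t * (\<Prod>i=1..<n - m. 1 + t ^ i)"
proof -
  \<comment> \<open>The diagram read from the fork: the tips \<open>n\<close> and
    \<open>n - 1\<close> become nodes 0 and 1 of the D chain.\<close>
  define b where "b i = (if i = 0 then n else n - i)" for i
  have img: "b ` {..<n - m} = {Suc m..n}"
  proof (intro equalityI subsetI)
    fix x assume "x \<in> {Suc m..n}"
    then show "x \<in> b ` {..<n - m}"
      using assms by (intro image_eqI[of _ _ "n - x"]) (auto simp: b_def)
  qed (use assms in \<open>auto simp: b_def\<close>)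
  have C: "B_cartan n (b i) (b j) = (if i = j then 2 else if i + j = 1 then 0
      else if j = Suc i \<or> i = Suc j \<or> i + j = 2 then -1 else 0)" if ij: "i < n" "j < n" for i j
  proof -
    have b: "b i \<le> n" "b j \<le> n" by (simp_all add: b_def)
    consider "i = 0" "j = 0" | "i = 0" "j > 0" | "i > 0" "j = 0" | "i > 0" "j > 0" by linarith
    moreover have "n - l = n - 2 \<longleftrightarrow> l = 2" if "l < n" for l using that n3 by linarith
    note e = this[OF ij(1)] this[OF ij(2)]
    ultimately show ?thesis
    proof cases
      case 4
      then have "b i = b j \<longleftrightarrow> i = j" "b j = Suc (b i) \<longleftrightarrow> i = Suc j" "b i = Suc (b j) \<longleftrightarrow> j = Suc i"
        "b i \<noteq> 0" "b i < n" "b j < n" "i + j \<noteq> 1" "i + j = 2 \<longleftrightarrow> i = 1 \<and> j = 1"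
        using ij by (auto simp: b_def)
      then show ?thesis unfolding B_cartan_eq[OF n3 b] by auto
    qed (use ij n3 B_cartan_eq[OF n3 b] e in \<open>auto simp: b_def\<close>)
  qed
  have inj: "inj_on b {..<n}" by (auto simp: inj_on_def b_def)
  have "gf (W (b ` {..<n - m})) = (\<Prod>i<n - m. q_number (Suc i) t) * (\<Prod>i=1..<n - m. 1 + fps_X ^ (T * i))"
    by (rule D_chain[OF inj _ C]) (use wtT assms in \<open>auto simp: b_def\<close>)
  then show ?thesis by (simp add: img q_fact_def power_mult)
qed

text \<open>The alternating identity is multiplied by \<open>?N\<close>. The product of the series
  of B_m and D_(n-m) divides \<open>?N\<close>, and the cofactor, with sign and monomial, is the
  m-th q-Vandermonde term for \<open>c = 1\<close>.\<close>

lemma poincare_series: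
  "gf (W {0..n}) * (\<Prod>i<n. 1 - a * t ^ (n - 1 + i))
    = (\<Prod>i<n. 1 + a * t ^ i) * q_fact n t * (\<Prod>i=1..<n. 1 + t ^ i)" (is "?U * _ = ?N")
proof -
  let ?v = "\<lambda>m. q_binomial n m t * vandermonde_term n t a 1 m"
  have dpow: "fps_X ^ (m * A + T * (m * (m - 1))) = a ^ m * t ^ (m * (m - 1))" for m
    by (simp add: power_add power_mult[symmetric] mult.commute)
  have split: "?N = q_binomial n m t * (\<Prod>i=m..<n. 1 + a * t ^ i) * (\<Prod>i=n - m..<n. 1 + 1 * t ^ i)
      * ((\<Prod>i<m. 1 + a * t ^ i) * q_fact m t * (q_fact (n - m) t * (\<Prod>i=1..<n - m. 1 + t ^ i)))"
    if "m < n" for m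
  proof -
    have "(\<Prod>i<n. 1 + a * t ^ i) = (\<Prod>i<m. 1 + a * t ^ i) * (\<Prod>i=m..<n. 1 + a * t ^ i)"
      using that prod.atLeastLessThan_concat[of 0 m n "\<lambda>i. 1 + a * t ^ i"] by (simp add: lessThan_atLeast0)
    moreover have "(\<Prod>i=1..<n. 1 + t ^ i) = (\<Prod>i=1..<n - m. 1 + t ^ i) * (\<Prod>i=n - m..<n. 1 + 1 * t ^ i)"
      using that prod.atLeastLessThan_concat[of 1 "n - m" n "\<lambda>i. 1 + t ^ i"] by simp
    moreover have "q_fact n t = q_binomial n m t * (q_fact m t * q_fact (n - m) t)"
      using q_binomial_fact[of m n t] that by simp
    ultimately show ?thesis by (simp only: mult_ac)
  qed
  have term_eq: "?N * ((-1) ^ m * gf (E {..<m} M)) = ?v m * ?U"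
    if m: "m < n" and M: "M \<subseteq> {0..n}" "commuting {..<m} M"
      "gf (W M) = q_fact (n - m) t * (\<Prod>i=1..<n - m. 1 + t ^ i)" for m M
  proof -
    have "gf (E {..<m} M) * (gf (W {..<m}) * gf (W M)) = fps_X ^ (m * A + T * (m * (m - 1))) * ?U"
      by (rule gf_E) (use m M left_parabolic(2)[of m] in auto)
    then have e: "gf (E {..<m} M) * ((\<Prod>i<m. 1 + a * t ^ i) * q_fact m t * (q_fact (n - m) t * (\<Prod>i=1..<n - m. 1 + t ^ i)))
        = a ^ m * t ^ (m * (m - 1)) * ?U"
      using left_parabolic(1)[of m] m M(3) dpow by simp
    have minus: "(- a) ^ m = (-1) ^ m * a ^ m" by (metis mult_minus1 power_mult_distrib)
    let ?P = "q_binomial n m t * (\<Prod>i=m..<n. 1 + a * t ^ i) * (\<Prod>i=n - m..<n. 1 + 1 * t ^ i) * (-1) ^ m"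
    have "?N * ((-1) ^ m * gf (E {..<m} M)) = ?P * (gf (E {..<m} M) *
        ((\<Prod>i<m. 1 + a * t ^ i) * q_fact m t * (q_fact (n - m) t * (\<Prod>i=1..<n - m. 1 + t ^ i))))"
      unfolding split[OF m] by (simp only: mult_ac)
    also have "\<dots> = ?P * (a ^ m * t ^ (m * (m - 1)) * ?U)" by (simp only: e)
    also have "\<dots> = ?v m * ?U" unfolding vandermonde_term_def minus by (simp only: mult_ac)
    finally show ?thesis .
  qed
  have last_eq: "?N * ((-1) ^ n * (gf (E {..<n} {}) + gf (E (insert n {..<n - 1}) {}))) = ?v n * ?U"
  proof -
    let ?B = "(\<Prod>i<n. 1 + a * t ^ i) * q_fact n t"
    have "gf (E {..<n} {}) * (gf (W {..<n}) * gf (W {})) = fps_X ^ (n * A + T * (n * (n - 1))) * ?U"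
      by (rule gf_E) (use left_parabolic(2)[of n] in \<open>auto simp: commuting_def\<close>)
    moreover have "gf (E (insert n {..<n - 1}) {}) * (gf (W (insert n {..<n - 1})) * gf (W {}))
        = fps_X ^ (n * A + T * (n * (n - 1))) * ?U"
      by (rule gf_E) (use left_parabolic_fork(2) in \<open>auto simp: commuting_def\<close>)
    ultimately have e: "(gf (E {..<n} {}) + gf (E (insert n {..<n - 1}) {})) * ?B = 2 * (a ^ n * t ^ (n * (n - 1)) * ?U)"
      using left_parabolic(1)[of n] left_parabolic_fork(1) dpow gf_empty by (simp add: distrib_right)
    \<comment> \<open>The factor for i = 0 is 2 and accounts for the two subgroups of type B_n at
      the fork.\<close>
    have "(\<Prod>i=n - n..<n. 1 + 1 * t ^ i) = 2 * (\<Prod>i=1..<n. 1 + t ^ i)"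
      using n3 by (simp add: prod.atLeast_Suc_lessThan)
    moreover have "q_binomial n n t = 1"
      by (induction n) (simp_all add: q_binomial_eq_0)
    moreover have "(- a) ^ n = (-1) ^ n * a ^ n" by (metis mult_minus1 power_mult_distrib)
    ultimately have "?v n * ?U = (-1) ^ n * (\<Prod>i=1..<n. 1 + t ^ i) * (2 * (a ^ n * t ^ (n * (n - 1)) * ?U))"
      by (simp add: vandermonde_term_def mult_ac)
    then show ?thesis unfolding e[symmetric] by (simp only: mult_ac)
  qed
  have "?N = ?N * ((\<Sum>m<n - 1. (-1) ^ m * gf (E {..<m} {Suc m..n})) + (-1) ^ (n - 1) * gf (E {..<n - 1} {})
    + (-1) ^ n * (gf (E {..<n} {}) + gf (E (insert n {..<n - 1}) {})))"
    unfolding gf_alternating by simp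
  also have "\<dots> = (\<Sum>m<n - 1. ?N * ((-1) ^ m * gf (E {..<m} {Suc m..n})))
      + ?N * ((-1) ^ (n - 1) * gf (E {..<n - 1} {}))
      + ?N * ((-1) ^ n * (gf (E {..<n} {}) + gf (E (insert n {..<n - 1}) {})))"
    by (simp only: distrib_left[of ?N] sum_distrib_left)
  also have "(\<Sum>m<n - 1. ?N * ((-1) ^ m * gf (E {..<m} {Suc m..n}))) = (\<Sum>m<n - 1. ?v m * ?U)"
  proof (rule sum.cong[OF HOL.refl])
    fix m assume "m \<in> {..<n - 1}"
    then have m: "m < n - 1" by simp
    have "commuting {..<m} {Suc m..n}"
      using m affine_B_matrix_less[OF n3] by (auto simp: commuting_def)
    then show "?N * ((-1) ^ m * gf (E {..<m} {Suc m..n})) = ?v m * ?U"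
      using m right_parabolic[OF m] by (intro term_eq) auto
  qed
  \<comment> \<open>Here the second set is empty, and the series 1 of the trivial group agrees with
    the general D factor for \<open>n - m = 1\<close>.\<close>
  also have "?N * ((-1) ^ (n - 1) * gf (E {..<n - 1} {})) = ?v (n - 1) * ?U"
    using n3 gf_empty by (intro term_eq) (auto simp: commuting_def q_fact_def q_number_def)
  also note last_eq
  also have "(\<Sum>m<n - 1. ?v m * ?U) + ?v (n - 1) * ?U + ?v n * ?U = (\<Sum>m\<le>n. ?v m) * ?U"
  proof -
    obtain k where "n = Suc k" using n3 by (cases n) auto
    then show ?thesis by (simp add: lessThan_Suc_atMost[symmetric] distrib_right sum_distrib_right)
  qed
  finally show ?thesis by (simp add: q_vandermonde mult.commute)
qed

end

section \<open>Foldings of affine D\<close>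

definition D_cartan :: "nat \<Rightarrow> nat \<Rightarrow> nat \<Rightarrow> int" where
  "D_cartan N i j =
    (if i = j then 2 else if affine_D_matrix N i j = 2 then 0 else -1)"

lemma affine_D_matrix_sym: "affine_D_matrix N i j = affine_D_matrix N j i"
  by (simp add: affine_D_matrix_def insert_commute eq_commute)

lemma D_cartan_sym: "D_cartan N i j = D_cartan N j i"
  by (cases "i = j") (simp_all add: D_cartan_def affine_D_matrix_sym[of N i j])

lemma affine_D_matrix_cases: "i \<noteq> j \<Longrightarrow> affine_D_matrix N i j = 2 \<or> affine_D_matrix N i j = 3"
  by (simp add: affine_D_matrix_def)

lemma coxeter_cartan_affine_D: "coxeter_cartan {0..N} (affine_D_matrix N) (D_cartan N)"
proof (unfold_locales, goal_cases)
  case (3 s t)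
  then show ?case
    using affine_D_matrix_cases[of s t N] affine_D_matrix_sym[of N t s] by (auto simp: D_cartan_def)
qed (simp_all add: affine_D_matrix_def D_cartan_def)

lemma D_cartan_less:
  assumes "N \<ge> 4" "i < j" "j \<le> N"
  shows "D_cartan N i j =
    (if i \<le> 1 \<and> j = 2 \<or> 2 \<le> i \<and> j = Suc i \<and> j < N \<or> i = N - 2 \<and> j = N then -1 else 0)"
proof -
  have d: "{i, j} = {x, y} \<longleftrightarrow> i = x \<and> j = y" if "x < y" for x y
    using assms(2) that by (auto simp: doubleton_eq_iff)
  have ex: "(\<exists>k. 2 \<le> k \<and> k \<le> N - 3 \<and> {i, j} = {k, k + 1}) \<longleftrightarrow> 2 \<le> i \<and> i \<le> N - 3 \<and> j = Suc i"
    by (simp add: d)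
  have lt: "0 < (2::nat)" "1 < (2::nat)" "N - 2 < N - 1" "N - 2 < N" using assms(1) by auto
  have e: "i = 0 \<and> j = 2 \<or> i = 1 \<and> j = 2 \<or> (2 \<le> i \<and> i \<le> N - 3 \<and> j = Suc i) \<or> (i = N - 2 \<and> j = N - 1) \<or> (i = N - 2 \<and> j = N)
    \<longleftrightarrow> i \<le> 1 \<and> j = 2 \<or> 2 \<le> i \<and> j = Suc i \<and> j < N \<or> i = N - 2 \<and> j = N"
    using assms by presburger
  have ij: "i \<noteq> j" using assms(2) by simp
  have "affine_D_matrix N i j =
    (if i \<le> 1 \<and> j = 2 \<or> 2 \<le> i \<and> j = Suc i \<and> j < N \<or> i = N - 2 \<and> j = N then 3 else 2)"
    unfolding affine_D_matrix_def ex d[OF lt(1)] d[OF lt(2)] d[OF lt(3)] d[OF lt(4)] e using ij by (simp only: if_False)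
  then show ?thesis using ij by (simp add: D_cartan_def)
qed

context coxeter_cartan begin

text \<open>The condition on the images \<open>P\<close>, \<open>Q\<close> of two generators with \<open>m = M\<close> under which a folding is
  length-additive on the dihedral subgroup that they generate.\<close>

definition foldable :: "nat \<Rightarrow> 's list \<Rightarrow> 's list \<Rightarrow> bool" where
  "foldable M P Q \<longleftrightarrow> (\<forall>x\<in>set P. play Q (\<lambda>_. 1) x > 0 \<and>
     (M \<ge> 3 \<longrightarrow> play (P @ Q) (\<lambda>_. 1) x > 0) \<and> (M \<ge> 4 \<longrightarrow> play (Q @ P @ Q) (\<lambda>_. 1) x > 0))"

lemma foldable_commuting:
  assumes "\<And>x y. x \<in> set P \<Longrightarrow> y \<in> set Q \<Longrightarrow> C y x = 0"
  shows "foldable 2 P Q"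
proof -
  have "play Q f x = f x" if "x \<in> set P" for f x
    using assms[OF that] by (induction Q arbitrary: f) (auto simp: fire_def)
  then show ?thesis by (simp add: foldable_def)
qed

lemma foldable_A2:
  assumes "{a, c} \<subseteq> S" "C a c = -1" "C c a = -1"
  shows "foldable 3 [a] [c]"
  using assms C_diag[of a] C_diag[of c] by (simp add: foldable_def fire_def)

lemma foldable_A2_A2:
  assumes "{a, b, c, d} \<subseteq> S" "C a c = -1" "C c a = -1" "C b d = -1" "C d b = -1"
    "C a b = 0" "C b a = 0" "C c d = 0" "C d c = 0" "C a d = 0" "C d a = 0" "C b c = 0" "C c b = 0"
  shows "foldable 3 [a, b] [c, d]"
  using assms C_diag[of a] C_diag[of b] C_diag[of c] C_diag[of d] by (simp add: foldable_def fire_def)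

text \<open>The path a - x - b: both ends form one block, the middle the other.\<close>

lemma foldable_A3:
  assumes "{a, b, x} \<subseteq> S" "C a x = -1" "C x a = -1" "C b x = -1" "C x b = -1" "C a b = 0" "C b a = 0"
  shows "foldable 4 [x] [a, b]" "foldable 4 [a, b] [x]"
  using assms C_diag[of a] C_diag[of b] C_diag[of x] by (simp_all add: foldable_def fire_def)

text \<open>The path a - x - y - b: both ends form one block, the longest element of the middle A2
  the other.\<close>

lemma foldable_A4:
  assumes "{a, b, x, y} \<subseteq> S" "C a x = -1" "C x a = -1" "C b y = -1" "C y b = -1" "C x y = -1" "C y x = -1"
    "C a b = 0" "C b a = 0" "C a y = 0" "C y a = 0" "C b x = 0" "C x b = 0"
  shows "foldable 4 [x, y, x] [a, b]" "foldable 4 [a, b] [x, y, x]"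
  using assms C_diag[of a] C_diag[of b] C_diag[of x] C_diag[of y] by (simp_all add: foldable_def fire_def)

lemma foldable_play_pos:
  assumes "foldable M (p s) (p t)" "M \<le> 4" "0 < k" "k < M" "x \<in> set (p s)"
  shows "play (concat (map p (rev (alt k t s)))) (\<lambda>_. 1) x > 0"
proof -
  have "k = 1 \<or> k = 2 \<or> k = 3" using assms by linarith
  then show ?thesis using assms by (auto simp: foldable_def numeral_eq_Suc)
qed

lemma len_two:
  assumes "{a, b} \<subseteq> S" "C a b = 0"
  shows "len [a, b] = 2"
proof -
  have "asc [a] b" using assms by (intro play_pos_asc[where f = "\<lambda>_. 1"]) (auto simp: fire_def)
  then show ?thesis using asc_iff[of b "[a]"] len_single[of a] assms by simp
qed

lemma len_three:
  assumes "{a, b} \<subseteq> S" "C a b = -1" "C b a = -1"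
  shows "len [a, b, a] = 3"
proof -
  have "asc [a] b" "asc [a, b] a"
    using assms C_diag[of a] by (auto intro!: play_pos_asc[where f = "\<lambda>_. 1"] simp: fire_def)
  then show ?thesis using asc_iff[of b "[a]"] asc_iff[of a "[a, b]"] len_single[of a] assms by simp
qed

end

text \<open>For each k, every finite set of classes that contains the finite level set of k already
  has the right k-th coefficient.\<close>

lemma (in weighted_coxeter) has_sum_gf: "((\<lambda>c. fps_X ^ L c) has_sum gf (W S)) (W S)"
  unfolding has_sum_def
proof (rule tendsto_fpsI)
  fix k
  let ?F = "{c \<in> W S. L c = k}"
  show "\<forall>\<^sub>F F in finite_subsets_at_top (W S). fps_nth (\<Sum>c\<in>F. fps_X ^ L c) k = fps_nth (gf (W S)) k"
    unfolding eventually_finite_subsets_at_top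
  proof (intro exI[of _ ?F] conjI allI impI)
    show "finite ?F" by (rule finite_level)
    fix F assume F: "finite F \<and> ?F \<subseteq> F \<and> F \<subseteq> W S"
    then have "{c \<in> F. L c = k} = ?F" by auto
    then have "(\<Sum>c\<in>F. if L c = k then 1 else 0) = (of_nat (card ?F) :: rat)"
      using F by (simp add: sum.If_cases Int_def)
    then show "fps_nth (\<Sum>c\<in>F. fps_X ^ L c) k = fps_nth (gf (W S)) k"
      by (simp add: gf_def fps_sum_nth fps_X_power_nth eq_commute)
  qed auto
qed

section \<open>From homomorphisms to weighted series\<close>

lemma carrier_affine_B: "carrier (affine_B n) = coxeter_class {0..n} (affine_B_matrix n) ` lists {0..n}"
  by (simp add: affine_B_def coxeter_group_def)

lemma D_gen_mult:
  assumes "u \<in> lists {0..N}" "v \<in> lists {0..N}"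
  shows "coxeter_class {0..N} (affine_D_matrix N) u \<otimes>\<^bsub>affine_D N\<^esub> coxeter_class {0..N} (affine_D_matrix N) v
    = coxeter_class {0..N} (affine_D_matrix N) (u @ v)"
  using coxeter_mult_class[OF assms] by (simp add: affine_D_def)

abbreviation D_class :: "nat \<Rightarrow> nat list \<Rightarrow> nat list set" where
  "D_class N \<equiv> coxeter_class {0..N} (affine_D_matrix N)"

lemma folding_hom:
  assumes hom: "\<phi> \<in> hom (affine_B n) (affine_D N)"
    and gen: "\<And>i. i \<le> n \<Longrightarrow> p i \<in> lists {0..N} \<and> \<phi> (B_gen n i) = D_class N (p i)"
    and w: "w \<in> lists {0..n}"
  shows "\<phi> (coxeter_class {0..n} (affine_B_matrix n) w)
    = D_class N (concat (map p w))"
  using w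
proof (induction w)
  case Nil
  show ?case using hom_one[OF hom group_affine_B group_affine_D]
    by (simp add: affine_B_def affine_D_def coxeter_group_def)
next
  case (Cons s w)
  have s: "s \<le> n" "w \<in> lists {0..n}" using Cons by auto
  have pw: "concat (map p w) \<in> lists {0..N}" using s(2)
    by (induction w) (use gen in auto)
  have "coxeter_class {0..n} (affine_B_matrix n) (s # w)
      = B_gen n s \<otimes>\<^bsub>affine_B n\<^esub> coxeter_class {0..n} (affine_B_matrix n) w"
    using coxeter_mult_class[of "[s]" "{0..n}" w "affine_B_matrix n"] s by (simp add: B_gen_def affine_B_def)
  moreover have "B_gen n s \<in> carrier (affine_B n)" "coxeter_class {0..n} (affine_B_matrix n) w \<in> carrier (affine_B n)"
    using s by (auto simp: carrier_affine_B B_gen_def)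
  ultimately have "\<phi> (coxeter_class {0..n} (affine_B_matrix n) (s # w))
      = \<phi> (B_gen n s) \<otimes>\<^bsub>affine_D N\<^esub> \<phi> (coxeter_class {0..n} (affine_B_matrix n) w)"
    using hom_mult[OF hom] by simp
  then show ?case using gen[OF s(1)] Cons.IH D_gen_mult pw by simp
qed

text \<open>The cross-multiplied form of \<open>poincare_series\<close>; it separates the group
  theory from the rewriting of the products.\<close>

definition is_B_series :: "nat \<Rightarrow> nat \<Rightarrow> nat \<Rightarrow> rat fps \<Rightarrow> bool" where
  "is_B_series n A T U \<longleftrightarrow> U * (\<Prod>i<n. 1 - fps_X ^ A * (fps_X ^ T) ^ (n - 1 + i))
    = (\<Prod>i<n. 1 + fps_X ^ A * (fps_X ^ T) ^ i) * q_fact n (fps_X ^ T) * (\<Prod>i=1..<n. 1 + (fps_X ^ T) ^ i)"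

theorem folding_length_series:
  fixes \<phi> :: "nat list set \<Rightarrow> nat list set" and A T N n :: nat
  assumes n: "n \<ge> 3"
    and hom: "\<phi> \<in> hom (affine_B n) (affine_D N)"
    and gen: "\<And>i. i \<le> n \<Longrightarrow> p i \<in> lists {0..N} \<and> \<phi> (B_gen n i) = D_class N (p i)"
    and fold: "\<And>s t. s < t \<Longrightarrow> t \<le> n \<Longrightarrow>
      coxeter_cartan.foldable (D_cartan N) (affine_B_matrix n s t) (p s) (p t) \<and>
      coxeter_cartan.foldable (D_cartan N) (affine_B_matrix n s t) (p t) (p s)"
    and len0: "coxeter_system.len {0..N} (affine_D_matrix N) (p 0) = A" and A: "A > 0"
    and lenT: "\<And>i. 1 \<le> i \<Longrightarrow> i \<le> n \<Longrightarrow> coxeter_system.len {0..N} (affine_D_matrix N) (p i) = T" and T: "T > 0"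
  shows "is_B_series n A T (length_series (affine_B n) \<phi>)"
proof -
  interpret B: coxeter_cartan "{0..n}" "affine_B_matrix n" "B_cartan n"
    by (rule coxeter_cartan_affine_B[OF n])
  interpret D: coxeter_cartan "{0..N}" "affine_D_matrix N" "D_cartan N"
    by (rule coxeter_cartan_affine_D)
  have le4: "affine_B_matrix n s t \<le> 4" for s t by (simp add: affine_B_matrix_def)
  interpret F: coxeter_folding "{0..n}" "affine_B_matrix n" "{0..N}" "affine_D_matrix N" "D_cartan N" p
  proof
    show "p s \<in> lists {0..N}" if "s \<in> {0..n}" for s using gen that by simp
    show "coxeter_eq {0..N} (affine_D_matrix N) (concat (map p u)) (concat (map p v))"
      if "coxeter_eq {0..n} (affine_B_matrix n) u v" for u v
    proof -
      have uv: "u \<in> lists {0..n}" "v \<in> lists {0..n}" using B.eqv_in_lists[OF that] .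
      \<comment> \<open>Equivalent words have the same class and \<open>\<phi>\<close> is a function
        of the class, so the images satisfy the relations of affine B.\<close>
      have "coxeter_class {0..n} (affine_B_matrix n) u = coxeter_class {0..n} (affine_B_matrix n) v"
        using that B.cl_eq_iff[OF uv(1)] by simp
      then have "D.cl (concat (map p u)) = D.cl (concat (map p v))"
        using folding_hom[OF hom gen] uv by metis
      moreover have "concat (map p u) \<in> lists {0..N}" using uv(1) by (induction u) (use gen in auto)
      ultimately show ?thesis using D.cl_eq_iff by blast
    qed
    show "0 < affine_B_matrix n s t" for s t by (simp add: affine_B_matrix_def)
    show "0 < D.play (concat (map p (rev (alt k t s)))) (\<lambda>_. 1) x"
      if "s \<in> {0..n}" "t \<in> {0..n}" "s \<noteq> t" "0 < k" "k < affine_B_matrix n t s" "x \<in> set (p s)" for s t k x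
    proof -
      have "D.foldable (affine_B_matrix n t s) (p s) (p t)"
        using fold[of s t] fold[of t s] that affine_B_matrix_sym[of n s t] by (cases "s < t") auto
      from D.foldable_play_pos[where p = p and s = s and t = t, OF this le4 that(4-6)] show ?thesis .
    qed
  qed
  define L where "L c = coxeter_length (\<phi> c)" for c
  have L: "L (B.cl w) = D.len (concat (map p w))" if "w \<in> lists {0..n}" for w
    using folding_hom[OF hom gen that] by (simp add: L_def D.len_def)
  interpret W: affine_B_weighted n L "\<lambda>i. if i = 0 then A else T" A T
  proof
    show "L (B.cl []) = 0" using L[of "[]"] by simp
    show "L (B.cl (w @ [s])) = L (B.cl w) + (if s = 0 then A else T)"
      if "w \<in> lists {0..n}" "s \<in> {0..n}" "B.asc w s" for w s
      using F.fold_len[OF that] L[OF that(1)] L[of "w @ [s]"] that len0 lenT[of s] by simp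
  qed (use A T n in auto)
  have "length_series (affine_B n) \<phi> = W.gf (W.W {0..n})"
    unfolding length_series_def carrier_affine_B using infsumI[OF W.has_sum_gf]
    by (simp add: W.W_def L_def)
  then show ?thesis using W.poincare_series by (simp add: is_B_series_def)
qed

section \<open>Adjacency and mirror symmetry of the affine D diagram\<close>

definition D_adjacent :: "nat \<Rightarrow> nat \<Rightarrow> nat \<Rightarrow> bool" where
  "D_adjacent N x y \<longleftrightarrow> x \<le> 1 \<and> y = 2 \<or> 2 \<le> x \<and> y = Suc x \<and> y < N \<or> x = N - 2 \<and> y = N"

lemma D_cartan_eq:
  assumes "N \<ge> 4" "x \<le> N" "y \<le> N"
  shows "D_cartan N x y = (if x = y then 2 else if D_adjacent N x y \<or> D_adjacent N y x then -1 else 0)"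
proof (cases x y rule: linorder_cases)
  case less
  then have "\<not> D_adjacent N y x" using assms by (auto simp: D_adjacent_def)
  then show ?thesis using D_cartan_less[OF assms(1) less assms(3)] less by (simp add: D_adjacent_def)
next
  case greater
  then have "\<not> D_adjacent N x y" using assms by (auto simp: D_adjacent_def)
  then show ?thesis using D_cartan_less[OF assms(1) greater assms(2)] greater D_cartan_sym[of N x y]
    by (simp add: D_adjacent_def)
qed (simp add: D_cartan_def)

text \<open>The mirror exchanges the two forks and reverses every edge, and
  \<open>D_adjacent\<close> is directed from the smaller to the larger index.\<close>

lemma D_adjacent_flip:
  assumes "N \<ge> 4" "x \<le> N" "y \<le> N"
  shows "D_adjacent N (N - x) (N - y) \<longleftrightarrow> D_adjacent N y x"
  using assms unfolding D_adjacent_def by presburger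

lemma D_cartan_flip:
  assumes "N \<ge> 4" "x \<le> N" "y \<le> N"
  shows "D_cartan N (N - x) (N - y) = D_cartan N x y"
proof -
  have "N - x = N - y \<longleftrightarrow> x = y" using assms by auto
  then show ?thesis
    using D_cartan_eq[of N "N - x" "N - y"] D_cartan_eq[OF assms]
      D_adjacent_flip[OF assms] D_adjacent_flip[OF assms(1,3,2)] assms by auto
qed

text \<open>In the second and third folding \<open>r\<^sub>i\<close> with \<open>i \<ge> 1\<close> is sent to the product of \<open>s\<^sub>x\<close> and its mirror image
  \<open>s\<^sub>N\<^sub>-\<^sub>x\<close>, where \<open>x = fold_node n i\<close>.\<close>

definition fold_node :: "nat \<Rightarrow> nat \<Rightarrow> nat" where
  "fold_node n i = (if i = n - 1 then 0 else if i = n then 1 else n - i)"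

lemma fold_node_less: "n \<ge> 3 \<Longrightarrow> 1 \<le> i \<Longrightarrow> i \<le> n \<Longrightarrow> fold_node n i < n"
  by (auto simp: fold_node_def)

context
  fixes n N :: nat
  assumes n: "n \<ge> 3" and N: "N \<ge> 2 * n"
begin

text \<open>The nodes below \<open>n\<close> form a half of the affine D diagram with one fork, and
  \<open>fold_node\<close> identifies the generators \<open>r\<^sub>1, ..., r\<^sub>n\<close> with
  it.\<close>

lemma cartan_fold_node:
  assumes "1 \<le> i" "i < j" "j \<le> n"
  shows "D_cartan N (fold_node n i) (fold_node n j) = (if affine_B_matrix n i j = 3 then -1 else 0)"
proof -
  have less: "fold_node n i < n" "fold_node n j < n" using fold_node_less n assms by auto
  have "affine_B_matrix n i j = 3 \<longleftrightarrow> j = Suc i \<and> j < n \<or> i = n - 2 \<and> j = n"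
    unfolding affine_B_matrix_less[OF n assms(2,3)] using assms(1) by auto
  moreover have "fold_node n i \<noteq> fold_node n j"
    using assms n unfolding fold_node_def by presburger
  moreover have "D_adjacent N (fold_node n i) (fold_node n j) \<or> D_adjacent N (fold_node n j) (fold_node n i)
      \<longleftrightarrow> j = Suc i \<and> j < n \<or> i = n - 2 \<and> j = n"
  proof -
    have adj: "D_adjacent N x y \<longleftrightarrow> x \<le> 1 \<and> y = 2 \<or> 2 \<le> x \<and> y = Suc x" if "x < n" "y < n" for x y
      using that N n by (auto simp: D_adjacent_def)
    consider "j \<le> n - 2" | "j = n - 1" | "j = n" "i = n - 1" | "j = n" "i \<le> n - 2" using assms by linarith
    then show ?thesis
    proof cases
      case 1
      then have "fold_node n i = n - i" "fold_node n j = n - j" using assms by (auto simp: fold_node_def)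
      then show ?thesis unfolding adj[OF less] adj[OF less(2,1)] using 1 assms n by presburger
    next
      case 2
      then have "fold_node n i = n - i" "fold_node n j = 0" using assms by (auto simp: fold_node_def)
      then show ?thesis unfolding adj[OF less] adj[OF less(2,1)] using 2 assms n by auto
    next
      case 3
      then have "fold_node n i = 0" "fold_node n j = 1" using n by (auto simp: fold_node_def)
      then show ?thesis unfolding adj[OF less] adj[OF less(2,1)] using 3 assms n by auto
    next
      case 4
      then have "fold_node n i = n - i" "fold_node n j = 1" using n by (auto simp: fold_node_def)
      then show ?thesis unfolding adj[OF less] adj[OF less(2,1)] using 4 assms n by auto
    qed
  qed
  ultimately show ?thesis
    using D_cartan_eq[of N "fold_node n i" "fold_node n j"] less N n by simp
qed

text \<open>As \<open>N\<close> is at least \<open>2 * n\<close>, the two halves are disjoint and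
  node \<open>n\<close> lies between them.\<close>

lemma cartan_fold_node_flip:
  assumes "x < n" "y < n"
  shows "D_cartan N x (N - y) = 0" "D_cartan N (N - y) x = 0"
proof -
  have "\<not> D_adjacent N x (N - y)" "\<not> D_adjacent N (N - y) x" "x \<noteq> N - y"
    using assms N n by (auto simp: D_adjacent_def)
  then show "D_cartan N x (N - y) = 0"
    using D_cartan_eq[of N x "N - y"] assms N n by simp
  then show "D_cartan N (N - y) x = 0" by (simp add: D_cartan_sym[of N "N - y" x])
qed

definition mirrored_word :: "nat list \<Rightarrow> nat \<Rightarrow> nat list" where
  "mirrored_word c i = (if i = 0 then c else [fold_node n i, N - fold_node n i])"

lemma mirrored_word_in:
  assumes "c \<in> lists {0..N}" "i \<le> n"
  shows "mirrored_word c i \<in> lists {0..N}"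
  using assms fold_node_less[of n i] n N by (auto simp: mirrored_word_def)

lemma len_mirrored_word:
  assumes "1 \<le> i" "i \<le> n"
  shows "coxeter_system.len {0..N} (affine_D_matrix N) (mirrored_word c i) = 2"
proof -
  interpret coxeter_cartan "{0..N}" "affine_D_matrix N" "D_cartan N"
    by (rule coxeter_cartan_affine_D)
  have "fold_node n i < n" using fold_node_less n assms by auto
  then show ?thesis
    using cartan_fold_node_flip[of "fold_node n i" "fold_node n i"] N assms
    by (simp add: mirrored_word_def len_two)
qed

text \<open>Away from the centre word \<open>c\<close>, an edge appears together with its mirror
  image and gives A2 x A2, while a nonedge gives commuting words. Only \<open>r\<^sub>1\<close>
  meets the centre, through node \<open>n - 1\<close> and its mirror image.\<close>

lemma foldable_mirrored_word:
  assumes "s < t" "t \<le> n"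
    and c: "\<And>y. y < n \<Longrightarrow> y \<noteq> n - 1 \<Longrightarrow>
      \<forall>x\<in>set c. D_cartan N x y = 0 \<and> D_cartan N x (N - y) = 0"
    and c1: "coxeter_cartan.foldable (D_cartan N) 4 c [n - 1, N - (n - 1)]"
      "coxeter_cartan.foldable (D_cartan N) 4 [n - 1, N - (n - 1)] c"
  shows "coxeter_cartan.foldable (D_cartan N) (affine_B_matrix n s t) (mirrored_word c s) (mirrored_word c t)
    \<and> coxeter_cartan.foldable (D_cartan N) (affine_B_matrix n s t) (mirrored_word c t) (mirrored_word c s)"
proof -
  interpret coxeter_cartan "{0..N}" "affine_D_matrix N" "D_cartan N"
    by (rule coxeter_cartan_affine_D)
  let ?C = "D_cartan N"
  note sym = D_cartan_sym[of N]
  define y where "y = fold_node n t"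
  have t: "1 \<le> t" "y < n" using assms(1,2) fold_node_less[OF n, of t] by (auto simp: y_def)
  have pt: "mirrored_word c t = [y, N - y]" using t by (simp add: mirrored_word_def y_def)
  show ?thesis
  proof (cases "s = 0")
    case True
    show ?thesis
    proof (cases "t = 1")
      case True
      have "y = n - 1" "affine_B_matrix n s t = 4"
        using True \<open>s = 0\<close> n affine_B_matrix_less[OF n, of 0 1] by (auto simp: y_def fold_node_def)
      then show ?thesis using c1 \<open>s = 0\<close> pt by (simp add: mirrored_word_def)
    next
      case False
      have "y \<noteq> n - 1" using False t(1) assms(2) n unfolding y_def fold_node_def by presburger
      have "affine_B_matrix n s t = 2"
        using affine_B_matrix_less[OF n assms(1,2)] \<open>s = 0\<close> False n by simp
      moreover have "foldable 2 c [y, N - y]" "foldable 2 [y, N - y] c"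
        using c[OF t(2) \<open>y \<noteq> n - 1\<close>] sym[of y] sym[of "N - y"] by (auto intro!: foldable_commuting)
      ultimately show ?thesis using \<open>s = 0\<close> pt by (simp add: mirrored_word_def)
    qed
  next
    case False
    define x where "x = fold_node n s"
    have s: "1 \<le> s" "x < n" using False assms(1,2) fold_node_less[OF n, of s] by (auto simp: x_def)
    have ps: "mirrored_word c s = [x, N - x]" using s by (simp add: mirrored_word_def x_def)
    have xy: "?C x y = (if affine_B_matrix n s t = 3 then -1 else 0)"
      using cartan_fold_node[OF s(1) assms(1,2)] by (simp add: x_def y_def)
    have fl: "?C (N - x) (N - y) = ?C x y" using D_cartan_flip[of N x y] s t N n by simp
    note cross = cartan_fold_node_flip[OF s(2) s(2)] cartan_fold_node_flip[OF t(2) t(2)]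
      cartan_fold_node_flip[OF s(2) t(2)] cartan_fold_node_flip[OF t(2) s(2)]
    have S: "{x, N - x, y, N - y} \<subseteq> {0..N}" "{y, N - y, x, N - x} \<subseteq> {0..N}" using s t N by auto
    have "affine_B_matrix n s t = 2 \<or> affine_B_matrix n s t = 3"
      using affine_B_matrix_less[OF n assms(1,2)] s by auto
    then show ?thesis
    proof
      assume m: "affine_B_matrix n s t = 2"
      have "foldable 2 [x, N - x] [y, N - y]" "foldable 2 [y, N - y] [x, N - x]"
        using xy fl cross sym[of y x] sym[of "N - y" "N - x"] m by (auto intro!: foldable_commuting)
      then show ?thesis using ps pt m by simp
    next
      assume m: "affine_B_matrix n s t = 3"
      have "foldable 3 [x, N - x] [y, N - y]" "foldable 3 [y, N - y] [x, N - x]"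
        using xy fl cross sym[of y x] sym[of "N - y" "N - x"] m
        by (auto intro!: foldable_A2_A2[OF S(1)] foldable_A2_A2[OF S(2)])
      then show ?thesis using ps pt m by simp
    qed
  qed
qed

end

section \<open>Rewriting the products in terms of q-numbers\<close>

lemma fps_eq_mult_divideI:
  fixes U P R b :: "'a::field fps"
  assumes "fps_nth b 0 \<noteq> 0" "U * b = P * R"
  shows "U = P * (R / b)"
proof -
  have "b \<noteq> 0" using assms(1) by auto
  have "P * (R / b) = U * b / b" using assms by (simp add: unit_div_mult_swap)
  then show ?thesis using \<open>b \<noteq> 0\<close> by simp
qed

lemma q_number_geometric: "(1 - x) * q_number k x = 1 - x ^ k" for x :: "'a::comm_ring_1"
  using one_diff_power_eq[of x k] by (simp add: q_number_def)

lemma q_number_double: "q_number (2 * k) x = (1 + x) * q_number k (x ^ 2)" for x :: "'a::comm_ring_1"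
  by (induction k) (simp_all add: q_number_def algebra_simps power_mult[symmetric] power_add)

lemma q_number_odd_neg: "(1 + x) * q_number (Suc (2 * k)) (- x) = 1 + x ^ Suc (2 * k)" for x :: "'a::comm_ring_1"
  using q_number_geometric[of "- x" "Suc (2 * k)"] power_minus_odd[of "Suc (2 * k)" x] by simp

text \<open>Pair each odd factor with the next even one: [2n+2]_q contains 1 + q, which turns
  [2n+1]_(-q) into 1 + q^(2n+1) and leaves [n+1] at q^2.\<close>

lemma prod_q_number_even:
  fixes q :: "'a::comm_ring_1"
  shows "(\<Prod>k = 1..2 * n. q_number k ((- 1) ^ k * q)) = (\<Prod>i<n. 1 + q * (q ^ 2) ^ i) * q_fact n (q ^ 2)"
proof (induction n)
  case (Suc n)
  have "q_number (Suc (2 * n)) (- q) * q_number (2 * Suc n) q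
      = (1 + q) * q_number (Suc (2 * n)) (- q) * q_number (Suc n) (q ^ 2)"
    unfolding q_number_double[of "Suc n" q] by (simp only: mult_ac)
  also have "\<dots> = (1 + q * (q ^ 2) ^ n) * q_number (Suc n) (q ^ 2)"
    unfolding q_number_odd_neg by (simp add: power_mult)
  finally have "q_number (Suc (2 * n)) (- q) * q_number (2 * Suc n) q = (1 + q * (q ^ 2) ^ n) * q_number (Suc n) (q ^ 2)" .
  moreover have "(\<Prod>k = 1..2 * Suc n. q_number k ((- 1) ^ k * q))
      = (\<Prod>k = 1..2 * n. q_number k ((- 1) ^ k * q)) * (q_number (Suc (2 * n)) (- q) * q_number (2 * Suc n) q)"
    by (simp add: mult.assoc)
  ultimately show ?case unfolding Suc.IH q_fact_Suc prod.lessThan_Suc by (simp only: mult_ac)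
qed (simp add: q_fact_def)

text \<open>The factor for k = 1 is 1, and each even factor is now paired with the odd one after it;
  so the exponents start at 3.\<close>

lemma prod_q_number_odd:
  fixes q :: "'a::comm_ring_1"
  shows "(\<Prod>k = 1..2 * n + 1. q_number k ((- 1) ^ k * q)) = (\<Prod>i<n. 1 + q ^ 3 * (q ^ 2) ^ i) * q_fact n (q ^ 2)"
proof (induction n)
  case (Suc n)
  have "q_number (Suc (2 * Suc n)) (- q) * q_number (2 * Suc n) q
      = (1 + q) * q_number (Suc (2 * Suc n)) (- q) * q_number (Suc n) (q ^ 2)"
    unfolding q_number_double[of "Suc n" q] by (simp only: mult_ac)
  also have "\<dots> = (1 + q ^ 3 * (q ^ 2) ^ n) * q_number (Suc n) (q ^ 2)"
  proof -
    have e: "Suc (2 * Suc n) = 3 + 2 * n" by simp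
    show ?thesis unfolding q_number_odd_neg unfolding e power_add power_mult ..
  qed
  finally have "q_number (Suc (2 * Suc n)) (- q) * q_number (2 * Suc n) q
      = (1 + q ^ 3 * (q ^ 2) ^ n) * q_number (Suc n) (q ^ 2)" .
  moreover have "(\<Prod>k = 1..2 * Suc n + 1. q_number k ((- 1) ^ k * q))
      = (\<Prod>k = 1..2 * n + 1. q_number k ((- 1) ^ k * q)) * (q_number (Suc (2 * Suc n)) (- q) * q_number (2 * Suc n) q)"
    by (simp add: mult_ac)
  ultimately show ?case unfolding Suc.IH q_fact_Suc prod.lessThan_Suc by (simp only: mult_ac)
qed (simp add: q_fact_def q_number_def)

text \<open>Both sides are the product of 1 - q^k for k up to 2n divided by that for k up to n; the
  right side separates odd and even k.\<close>

lemma prod_descending: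
  fixes q :: "'a::idom"
  assumes "\<And>k. k > 0 \<Longrightarrow> 1 - q ^ k \<noteq> 0"
  shows "(\<Prod>i<n. 1 - q ^ (n + 1 + i)) = (\<Prod>k = 1..n. (1 - q ^ (2 * k - 1)) * (1 + q ^ k))"
proof (induction n)
  case (Suc n)
  have nz: "1 - q ^ (n + 1) \<noteq> 0" using assms[of "n + 1"] by simp
  have "(1 - q ^ (n + 1)) * (\<Prod>i<Suc n. 1 - q ^ (Suc n + 1 + i)) = (\<Prod>i<Suc (Suc n). 1 - q ^ (n + 1 + i))"
    using prod.lessThan_Suc_shift[of "\<lambda>i. 1 - q ^ (n + 1 + i)" "Suc n"] by (simp del: prod.lessThan_Suc)
  also have "\<dots> = (\<Prod>i<n. 1 - q ^ (n + 1 + i)) * (1 - q ^ (2 * n + 1)) * (1 - q ^ (2 * n + 2))"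
    by (simp add: mult_2)
  also have "1 - q ^ (2 * n + 2) = (1 - q ^ (n + 1)) * (1 + q ^ (n + 1))"
    by (simp add: algebra_simps power_add[symmetric] mult_2 mult_2_right)
  finally have "(1 - q ^ (n + 1)) * (\<Prod>i<Suc n. 1 - q ^ (Suc n + 1 + i))
    = (1 - q ^ (n + 1)) * ((\<Prod>i<n. 1 - q ^ (n + 1 + i)) * ((1 - q ^ (2 * n + 1)) * (1 + q ^ (n + 1))))"
    by (simp only: mult_ac)
  then have "(\<Prod>i<Suc n. 1 - q ^ (Suc n + 1 + i)) = (\<Prod>i<n. 1 - q ^ (n + 1 + i)) * ((1 - q ^ (2 * n + 1)) * (1 + q ^ (n + 1)))"
    by (rule mult_left_cancel[OF nz, THEN iffD1])
  then show ?case using Suc.IH by simp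
qed simp

text \<open>Splitting off the first \<open>k\<close> terms and then the term \<open>q ^ k\<close>
  leaves a multiple of \<open>q_number k q\<close>. This factors the numerators of the first
  formula.\<close>

lemma q_number_gap: "q_number (2 * k + 1) q - q ^ k = q_number k q * (1 + q ^ (k + 1))" for q :: "'a::comm_ring_1"
proof -
  have "q_number 1 q = 1" by (simp add: q_number_def)
  then have "q_number (Suc k) q = 1 + q * q_number k q" using q_number_add[of 1 k q] by simp
  moreover have "q_number (2 * k + 1) q = q_number k q + q ^ k * q_number (Suc k) q"
    using q_number_add[of k "Suc k" q] by (simp add: mult_2)
  ultimately show ?thesis by (simp add: algebra_simps)
qed

lemma prod_divide_units:
  fixes f g :: "'b \<Rightarrow> 'a::field fps"
  assumes "\<And>k. k \<in> A \<Longrightarrow> fps_nth (g k) 0 \<noteq> 0"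
  shows "(\<Prod>k\<in>A. f k / g k) * (\<Prod>k\<in>A. g k) = (\<Prod>k\<in>A. f k)"
  unfolding prod.distrib[symmetric] by (intro prod.cong HOL.refl) (simp add: assms)

lemma one_minus_fps_X_power:
  assumes "k > 0"
  shows "fps_nth (1 - fps_X ^ k :: 'a::field fps) 0 \<noteq> 0" "(1 - fps_X ^ k :: 'a fps) \<noteq> 0"
proof -
  show "fps_nth (1 - fps_X ^ k :: 'a fps) 0 \<noteq> 0" using assms by (simp add: fps_X_power_nth)
  then show "(1 - fps_X ^ k :: 'a fps) \<noteq> 0" by (metis fps_zero_nth)
qed

lemma prod_from_1: "(\<Prod>k = 1..n. f k) = (\<Prod>i<n. f (Suc i))" for f :: "nat \<Rightarrow> 'a::comm_monoid_mult"
  using prod.atLeast1_atMost_eq[of f n] by simp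

lemma fps_nth_prod_0: "fps_nth (prod f A) 0 = (\<Prod>k\<in>A. fps_nth (f k) 0)" for f :: "'b \<Rightarrow> 'a::comm_ring_1 fps"
  by (induction A rule: infinite_finite_induct) simp_all

lemma series_D_Suc:
  fixes U q :: "rat fps"
  assumes n: "n \<ge> 3" and q: "q = fps_X"
    and B: "is_B_series n 2 1 U"
  shows "U = q_number 2 q * q_number 3 (- q) * q_number 4 q / ((1 - q) * (1 - q ^ 3) * (1 + q ^ n)) *
          (\<Prod>k = 3..n. (q_number (2 * k + 1) q - q ^ k) / (1 - q ^ (2 * k - 1)))"
proof -
  note U = B[unfolded is_B_series_def, folded q]
  let ?d = "(1 - q) * (1 - q ^ 3) * (1 + q ^ n)"
  let ?g = "\<Prod>k = 3..n. 1 - q ^ (2 * k - 1)"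
  let ?M = "q_number 2 q * q_number 3 (- q) * q_number 4 q"
  let ?H = "\<Prod>k = 3..n. q_number (2 * k + 1) q - q ^ k"
  let ?E = "\<Prod>i=1..<n. 1 + q ^ i"
  have nz: "1 - q ^ k \<noteq> 0" if "k > 0" for k
    unfolding q using one_minus_fps_X_power[OF that] by blast
  \<comment> \<open>The factors for k = 1, 2 become the constants in front of the product.\<close>
  have split3: "(\<Prod>k = 1..n. f k) = f 1 * f 2 * (\<Prod>k = 3..n. f k)" for f :: "nat \<Rightarrow> rat fps"
  proof -
    have "{1..n} = insert 1 (insert 2 {3..n})" using n by auto
    then show ?thesis by (simp add: mult.assoc)
  qed
  \<comment> \<open>Only \<open>1 + q ^ n\<close> survives the cancellation of \<open>?E\<close>
    against the numerator.\<close>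
  have split_last: "(\<Prod>k = 1..n. 1 + q ^ k) = ?E * (1 + q ^ n)"
  proof -
    have "{1..n} = insert n {1..<n}" using n by auto
    then show ?thesis by (simp add: mult.commute)
  qed
  have E: "?E \<noteq> 0"
  proof -
    have "fps_nth ?E 0 = 1" unfolding q by (simp add: fps_nth_prod_0 fps_X_power_nth)
    then show ?thesis by (metis fps_zero_nth zero_neq_one)
  qed
  have "(\<Prod>i<n. 1 - q ^ 2 * (q ^ 1) ^ (n - 1 + i)) = (\<Prod>i<n. 1 - q ^ (n + 1 + i))"
  proof (rule prod.cong[OF HOL.refl])
    fix i
    have "2 + (n - 1 + i) = n + 1 + i" using n by simp
    then show "1 - q ^ 2 * (q ^ 1) ^ (n - 1 + i) = 1 - q ^ (n + 1 + i)"
      by (simp only: power_one_right power_add[symmetric])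
  qed
  also have "\<dots> = (\<Prod>k = 1..n. 1 - q ^ (2 * k - 1)) * (\<Prod>k = 1..n. 1 + q ^ k)"
    using prod_descending[of q n] nz by (simp add: prod.distrib)
  also have "\<dots> = ?d * ?g * ?E"
    unfolding split3[of "\<lambda>k. 1 - q ^ (2 * k - 1)"] split_last by (simp add: mult_ac)
  finally have D: "(\<Prod>i<n. 1 - q ^ 2 * (q ^ 1) ^ (n - 1 + i)) = ?d * ?g * ?E" .
  have "(\<Prod>i<n. 1 + q ^ 2 * (q ^ 1) ^ i) * q_fact n (q ^ 1) = (\<Prod>i<n. q_number (Suc i) q * (1 + q ^ (Suc i + 1)))"
    by (simp add: q_fact_def prod.distrib[symmetric] power2_eq_square mult_ac)
  also have "\<dots> = (\<Prod>k = 1..n. q_number k q * (1 + q ^ (k + 1)))"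
    by (simp only: prod_from_1)
  also have "\<dots> = ?M * ?H"
  proof -
    have q1: "q_number 1 q = 1" "q_number 2 q = 1 + q" "q_number 4 q = (1 + q) * (1 + q ^ 2)"
      "(1 + q) * q_number 3 (- q) = 1 + q ^ 3"
      using q_number_double[of 2 q] q_number_odd_neg[of q 1]
      by (simp_all add: q_number_def numeral_eq_Suc)
    have "q_number 1 q * (1 + q ^ (1 + 1)) * (q_number 2 q * (1 + q ^ (2 + 1))) = (1 + q ^ 2) * ((1 + q) * (1 + q ^ 3))"
      using q1 by (simp add: power2_eq_square)
    also have "\<dots> = ?M" unfolding q1(4)[symmetric] q1(2,3) by (simp only: mult_ac)
    finally show ?thesis unfolding split3 q_number_gap by (simp only:)
  qed
  finally have N: "(\<Prod>i<n. 1 + q ^ 2 * (q ^ 1) ^ i) * q_fact n (q ^ 1) = ?M * ?H" .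
  have "U * (?d * ?g) * ?E = ?M * ?H * ?E"
    using U unfolding D N by (simp add: mult.assoc)
  then have Udg: "U * (?d * ?g) = ?M * ?H" using E by simp
  have d0: "fps_nth ?d 0 \<noteq> 0" "fps_nth ?g 0 \<noteq> 0"
    using n unfolding q by (simp_all add: fps_nth_prod_0 fps_X_power_nth)
  let ?G = "\<Prod>k = 3..n. (q_number (2 * k + 1) q - q ^ k) / (1 - q ^ (2 * k - 1))"
  have G: "?G * ?g = ?H"
    unfolding q by (intro prod_divide_units one_minus_fps_X_power) auto
  have M: "?M / ?d * ?d = ?M" using d0 by simp
  have "?M / ?d * ?G * (?d * ?g) = (?M / ?d * ?d) * (?G * ?g)" by (simp only: mult_ac)
  also have "\<dots> = U * (?d * ?g)" unfolding G M Udg ..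
  finally have eq: "?M / ?d * ?G * (?d * ?g) = U * (?d * ?g)" .
  have "?d * ?g \<noteq> 0" by (intro no_zero_divisors fps_nonzeroI[OF d0(1)] fps_nonzeroI[OF d0(2)])
  from mult_right_cancel[OF this, THEN iffD1, OF eq] show ?thesis by simp
qed

lemma series_D_even:
  fixes U q :: "rat fps"
  assumes n: "n \<ge> 3" and q: "q = fps_X"
    and B: "is_B_series n 1 2 U"
  shows "U = (\<Prod>k = 1..2 * n. q_number k ((- 1) ^ k * q)) *
    ((\<Prod>k = 1..n - 1. 1 + q ^ (2 * k)) / (\<Prod>k = 1..n. 1 - q ^ (2 * (n + k) - 3)))"
proof (rule fps_eq_mult_divideI)
  note U = B[unfolded is_B_series_def, folded q]
  have D: "(\<Prod>k = 1..n. 1 - q ^ (2 * (n + k) - 3)) = (\<Prod>i<n. 1 - q ^ 1 * (q ^ 2) ^ (n - 1 + i))"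
    unfolding prod_from_1
  proof (rule prod.cong[OF HOL.refl])
    fix i
    have "2 * (n + Suc i) - 3 = 1 + 2 * (n - 1 + i)" using n by simp
    then show "1 - q ^ (2 * (n + Suc i) - 3) = 1 - q ^ 1 * (q ^ 2) ^ (n - 1 + i)"
      by (simp only: power_add power_mult)
  qed
  have "{1..n - 1} = {1..<n}" using n by auto
  then show "U * (\<Prod>k = 1..n. 1 - q ^ (2 * (n + k) - 3))
      = (\<Prod>k = 1..2 * n. q_number k ((- 1) ^ k * q)) * (\<Prod>k = 1..n - 1. 1 + q ^ (2 * k))"
    unfolding D U prod_q_number_even by (simp add: power_mult)
  show "fps_nth (\<Prod>k = 1..n. 1 - q ^ (2 * (n + k) - 3)) 0 \<noteq> 0"
    using n unfolding q by (simp add: fps_nth_prod_0 fps_X_power_nth)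
qed

lemma series_D_odd:
  fixes U q :: "rat fps"
  assumes n: "n \<ge> 3" and q: "q = fps_X"
    and B: "is_B_series n 3 2 U"
  shows "U = (\<Prod>k = 1..2 * n + 1. q_number k ((- 1) ^ k * q)) *
    ((\<Prod>k = 1..n - 1. 1 + q ^ (2 * k)) / (\<Prod>k = 1..n. 1 - q ^ (2 * (n + k) - 1)))"
proof (rule fps_eq_mult_divideI)
  note U = B[unfolded is_B_series_def, folded q]
  have D: "(\<Prod>k = 1..n. 1 - q ^ (2 * (n + k) - 1)) = (\<Prod>i<n. 1 - q ^ 3 * (q ^ 2) ^ (n - 1 + i))"
    unfolding prod_from_1
  proof (rule prod.cong[OF HOL.refl])
    fix i
    have "2 * (n + Suc i) - 1 = 3 + 2 * (n - 1 + i)" using n by simp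
    then show "1 - q ^ (2 * (n + Suc i) - 1) = 1 - q ^ 3 * (q ^ 2) ^ (n - 1 + i)"
      by (simp only: power_add power_mult)
  qed
  have "{1..n - 1} = {1..<n}" using n by auto
  then show "U * (\<Prod>k = 1..n. 1 - q ^ (2 * (n + k) - 1))
      = (\<Prod>k = 1..2 * n + 1. q_number k ((- 1) ^ k * q)) * (\<Prod>k = 1..n - 1. 1 + q ^ (2 * k))"
    unfolding D U prod_q_number_odd by (simp add: power_mult)
  show "fps_nth (\<Prod>k = 1..n. 1 - q ^ (2 * (n + k) - 1)) 0 \<noteq> 0"
    using n unfolding q by (simp add: fps_nth_prod_0 fps_X_power_nth)
qed

section \<open>The three foldings\<close>

lemma D_gen_eq: "D_gen N i = D_class N [i]"
  by (simp add: D_gen_def)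

lemma length_series_D_Suc:
  assumes n: "n \<ge> 3" and hom: "\<phi> \<in> hom (affine_B n) (affine_D (n + 1))"
    and \<phi>0: "\<phi> (B_gen n 0) = D_gen (n + 1) 0 \<otimes>\<^bsub>affine_D (n + 1)\<^esub> D_gen (n + 1) 1"
    and \<phi>: "\<forall>i\<in>{1..n}. \<phi> (B_gen n i) = D_gen (n + 1) (i + 1)"
  shows "is_B_series n 2 1 (length_series (affine_B n) \<phi>)"
proof -
  let ?N = "n + 1"
  define p :: "nat \<Rightarrow> nat list" where "p i = (if i = 0 then [0, 1] else [Suc i])" for i
  interpret coxeter_cartan "{0..?N}" "affine_D_matrix ?N" "D_cartan ?N"
    by (rule coxeter_cartan_affine_D)
  have N: "?N \<ge> 4" using n by simp
  note C = D_cartan_eq[OF N]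
  have C01: "D_cartan ?N 0 1 = 0" "D_cartan ?N 1 0 = 0"
    using C[of 0 1] C[of 1 0] n by (simp_all add: D_adjacent_def)
  have C0: "D_cartan ?N x (Suc t) = (if t = 1 then -1 else 0)" "D_cartan ?N (Suc t) x = (if t = 1 then -1 else 0)"
    if "x \<le> 1" "1 \<le> t" "t \<le> n" for x t
  proof -
    have "D_adjacent ?N x (Suc t) \<or> D_adjacent ?N (Suc t) x \<longleftrightarrow> t = 1" "x \<noteq> Suc t"
      using that n by (auto simp: D_adjacent_def)
    then show "D_cartan ?N x (Suc t) = (if t = 1 then -1 else 0)" using C[of x "Suc t"] that n by simp
    then show "D_cartan ?N (Suc t) x = (if t = 1 then -1 else 0)" using D_cartan_sym[of ?N "Suc t" x] by simp
  qed
  show ?thesis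
  proof (rule folding_length_series[OF n hom, where p = p])
    fix i assume i: "i \<le> n"
    show "p i \<in> lists {0..?N} \<and> \<phi> (B_gen n i) = cl (p i)"
      using \<phi>0 \<phi> D_gen_mult[of "[0]" ?N "[1]"] i by (auto simp: p_def D_gen_eq)
  next
    fix s t assume st: "s < t" "t \<le> n"
    show "foldable (affine_B_matrix n s t) (p s) (p t) \<and> foldable (affine_B_matrix n s t) (p t) (p s)"
    proof (cases "s = 0")
      case True
      show ?thesis
      proof (cases "t = 1")
        case t: True
        \<comment> \<open>The tips 0 and 1 with node 2 between them form an A3.\<close>
        have "foldable 4 [Suc 1] [0, 1]" "foldable 4 [0, 1] [Suc 1]"
          by (rule foldable_A3; use C0[of 0 1] C0[of 1 1] C01 n in simp)+
        moreover have "affine_B_matrix n s t = 4" using affine_B_matrix_less[OF n st] True t by simp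
        ultimately show ?thesis using True t by (simp add: p_def)
      next
        case False
        have "affine_B_matrix n s t = 2" using affine_B_matrix_less[OF n st] True False n by auto
        moreover have "foldable 2 [0, 1] [Suc t]" "foldable 2 [Suc t] [0, 1]"
          by (rule foldable_commuting; use C0[of 0 t] C0[of 1 t] False True st in auto)+
        ultimately show ?thesis using True False st by (simp add: p_def)
      qed
    next
      case False
      define P where "P \<longleftrightarrow> t = Suc s \<and> t < n \<or> s = n - 2 \<and> t = n"
      have "D_adjacent ?N (Suc s) (Suc t) \<or> D_adjacent ?N (Suc t) (Suc s) \<longleftrightarrow> P"
        using False st n by (auto simp: D_adjacent_def P_def)
      moreover have "affine_B_matrix n s t = (if P then 3 else 2)"
        unfolding affine_B_matrix_less[OF n st] P_def using False st by simp
      moreover have "D_cartan ?N (Suc s) (Suc t)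
          = (if D_adjacent ?N (Suc s) (Suc t) \<or> D_adjacent ?N (Suc t) (Suc s) then -1 else 0)"
        using C[of "Suc s" "Suc t"] st by simp
      ultimately have m: "affine_B_matrix n s t = 3 \<and> D_cartan ?N (Suc s) (Suc t) = -1
          \<or> affine_B_matrix n s t = 2 \<and> D_cartan ?N (Suc s) (Suc t) = 0"
        by (cases P) simp_all
      have p: "p s = [Suc s]" "p t = [Suc t]" using False st by (simp_all add: p_def)
      note sym = D_cartan_sym[of ?N "Suc t" "Suc s"]
      from m show ?thesis unfolding p
      proof (elim disjE conjE, goal_cases)
        case 1
        have "foldable 3 [Suc s] [Suc t]" by (rule foldable_A2) (use 1 sym st in auto)
        moreover have "foldable 3 [Suc t] [Suc s]" by (rule foldable_A2) (use 1 sym st in auto)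
        ultimately show ?case using 1 by simp
      next
        case 2
        have "foldable 2 [Suc s] [Suc t]" by (rule foldable_commuting) (use 2 sym in auto)
        moreover have "foldable 2 [Suc t] [Suc s]" by (rule foldable_commuting) (use 2 sym in auto)
        ultimately show ?case using 2 by simp
      qed
    qed
  next
    have "len [0, 1] = 2" by (rule len_two) (use C01 n in auto)
    then show "len (p 0) = 2" by (simp add: p_def)
    show "len (p i) = 1" if "1 \<le> i" "i \<le> n" for i
      using len_single[of "Suc i"] that by (simp add: p_def)
  qed auto
qed

text \<open>Common form of the second and third folding, which differ only in the word
  \<open>c\<close> at the centre: the middle node, or the longest element of the middle A2.\<close>

lemma length_series_mirrored:
  assumes n: "n \<ge> 3" and N: "N \<ge> 2 * n" and hom: "\<phi> \<in> hom (affine_B n) (affine_D N)"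
    and c: "c \<in> lists {0..N}" "\<phi> (B_gen n 0) = D_class N c"
    and \<phi>: "\<forall>i\<in>{1..n - 2}. \<phi> (B_gen n i) = D_gen N (n - i) \<otimes>\<^bsub>affine_D N\<^esub> D_gen N (N - (n - i))"
    and \<phi>1: "\<phi> (B_gen n (n - 1)) = D_gen N 0 \<otimes>\<^bsub>affine_D N\<^esub> D_gen N N"
    and \<phi>2: "\<phi> (B_gen n n) = D_gen N 1 \<otimes>\<^bsub>affine_D N\<^esub> D_gen N (N - 1)"
    and commute: "\<And>y. y < n \<Longrightarrow> y \<noteq> n - 1 \<Longrightarrow>
      \<forall>x\<in>set c. D_cartan N x y = 0 \<and> D_cartan N x (N - y) = 0"
    and fold: "coxeter_cartan.foldable (D_cartan N) 4 c [n - 1, N - (n - 1)]"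
      "coxeter_cartan.foldable (D_cartan N) 4 [n - 1, N - (n - 1)] c"
    and len: "coxeter_system.len {0..N} (affine_D_matrix N) c = A" "A > 0"
  shows "is_B_series n A 2 (length_series (affine_B n) \<phi>)"
proof (rule folding_length_series[OF n hom, where p = "mirrored_word n N c"])
  fix i assume i: "i \<le> n"
  have "\<phi> (B_gen n i) = D_class N (mirrored_word n N c i)"
  proof (cases "i = 0")
    case True
    then show ?thesis using c by (simp add: mirrored_word_def[OF n N])
  next
    case False
    have D: "D_gen N x \<otimes>\<^bsub>affine_D N\<^esub> D_gen N (N - x) = D_class N [x, N - x]"
      if "x \<le> N" for x using D_gen_mult[of "[x]" N "[N - x]"] that by (simp add: D_gen_eq)
    consider "1 \<le> i" "i \<le> n - 2" | "i = n - 1" | "i = n" using i False by linarith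
    then have "\<phi> (B_gen n i) = D_gen N (fold_node n i) \<otimes>\<^bsub>affine_D N\<^esub> D_gen N (N - fold_node n i)"
      using \<phi> \<phi>1 \<phi>2 n by cases (auto simp: fold_node_def)
    moreover have "fold_node n i \<le> N" using fold_node_less[OF n, of i] i False N by simp
    ultimately show ?thesis using D False by (simp add: mirrored_word_def[OF n N])
  qed
  then show "mirrored_word n N c i \<in> lists {0..N} \<and>
      \<phi> (B_gen n i) = D_class N (mirrored_word n N c i)"
    using mirrored_word_in[OF n N c(1) i] by simp
next
  show "coxeter_system.len {0..N} (affine_D_matrix N) (mirrored_word n N c 0) = A"
    using len by (simp add: mirrored_word_def[OF n N])
qed (use foldable_mirrored_word[OF n N _ _ commute fold] len_mirrored_word[OF n N] len in auto)

lemma length_series_D_even: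
  assumes n: "n \<ge> 3" and hom: "\<phi> \<in> hom (affine_B n) (affine_D (2 * n))"
    and \<phi>0: "\<phi> (B_gen n 0) = D_gen (2 * n) n"
    and \<phi>: "\<forall>i\<in>{1..n - 2}. \<phi> (B_gen n i) =
           D_gen (2 * n) (n - i) \<otimes>\<^bsub>affine_D (2 * n)\<^esub> D_gen (2 * n) (n + i)"
    and \<phi>1: "\<phi> (B_gen n (n - 1)) = D_gen (2 * n) 0 \<otimes>\<^bsub>affine_D (2 * n)\<^esub> D_gen (2 * n) (2 * n)"
    and \<phi>2: "\<phi> (B_gen n n) = D_gen (2 * n) 1 \<otimes>\<^bsub>affine_D (2 * n)\<^esub> D_gen (2 * n) (2 * n - 1)"
  shows "is_B_series n 1 2 (length_series (affine_B n) \<phi>)"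
proof -
  let ?N = "2 * n"
  interpret coxeter_cartan "{0..?N}" "affine_D_matrix ?N" "D_cartan ?N"
    by (rule coxeter_cartan_affine_D)
  have N: "?N \<ge> 4" using n by simp
  \<comment> \<open>Node \<open>n\<close> is its own mirror image, so its bonds to the two halves
    agree.\<close>
  have centre: "D_cartan ?N n y = (if y = n - 1 then -1 else 0)" "D_cartan ?N y n = (if y = n - 1 then -1 else 0)"
    "D_cartan ?N n (?N - y) = (if y = n - 1 then -1 else 0)" "D_cartan ?N (?N - y) n = (if y = n - 1 then -1 else 0)"
    if "y < n" for y
  proof -
    have "D_adjacent ?N n y \<or> D_adjacent ?N y n \<longleftrightarrow> y = n - 1" using that n by (auto simp: D_adjacent_def)
    then show 1: "D_cartan ?N n y = (if y = n - 1 then -1 else 0)"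
      using D_cartan_eq[OF N, of n y] that by simp
    then show 2: "D_cartan ?N y n = (if y = n - 1 then -1 else 0)" using D_cartan_sym[of ?N y n] by simp
    have "?N - n = n" by simp
    then show "D_cartan ?N n (?N - y) = (if y = n - 1 then -1 else 0)" "D_cartan ?N (?N - y) n = (if y = n - 1 then -1 else 0)"
      using D_cartan_flip[OF N, of n y] D_cartan_flip[OF N, of y n] 1 2 that by simp_all
  qed
  have "n - 1 < n" using n by simp
  then have "foldable 4 [n] [n - 1, ?N - (n - 1)]" "foldable 4 [n - 1, ?N - (n - 1)] [n]"
    using centre[of "n - 1"] cartan_fold_node_flip[OF n, of ?N "n - 1" "n - 1"] n
    by (intro foldable_A3; auto)+
  then show ?thesis
    using \<phi>0 \<phi> \<phi>1 \<phi>2 centre n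
    by (intro length_series_mirrored[OF n _ hom, of "[n]"]) (auto simp: D_gen_eq len_single)
qed

lemma length_series_D_odd:
  assumes n: "n \<ge> 3" and hom: "\<phi> \<in> hom (affine_B n) (affine_D (2 * n + 1))"
    and \<phi>0: "\<phi> (B_gen n 0) = D_gen (2 * n + 1) n \<otimes>\<^bsub>affine_D (2 * n + 1)\<^esub> D_gen (2 * n + 1) (n + 1)
            \<otimes>\<^bsub>affine_D (2 * n + 1)\<^esub> D_gen (2 * n + 1) n"
    and \<phi>: "\<forall>i\<in>{1..n - 2}. \<phi> (B_gen n i) =
           D_gen (2 * n + 1) (n - i) \<otimes>\<^bsub>affine_D (2 * n + 1)\<^esub> D_gen (2 * n + 1) (n + 1 + i)"
    and \<phi>1: "\<phi> (B_gen n (n - 1)) = D_gen (2 * n + 1) 0 \<otimes>\<^bsub>affine_D (2 * n + 1)\<^esub> D_gen (2 * n + 1) (2 * n + 1)"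
    and \<phi>2: "\<phi> (B_gen n n) = D_gen (2 * n + 1) 1 \<otimes>\<^bsub>affine_D (2 * n + 1)\<^esub> D_gen (2 * n + 1) (2 * n)"
  shows "is_B_series n 3 2 (length_series (affine_B n) \<phi>)"
proof -
  let ?N = "2 * n + 1"
  interpret coxeter_cartan "{0..?N}" "affine_D_matrix ?N" "D_cartan ?N"
    by (rule coxeter_cartan_affine_D)
  have N: "?N \<ge> 4" using n by simp
  \<comment> \<open>The mirror exchanges the two central nodes, so each bond of one reappears as a
    bond of the other.\<close>
  have flip_n: "?N - n = n + 1" "?N - (n + 1) = n" by simp_all
  have nn: "D_cartan ?N n (n + 1) = -1" "D_cartan ?N (n + 1) n = -1"
    using D_cartan_eq[OF N, of n "n + 1"] D_cartan_eq[OF N, of "n + 1" n] n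
    by (auto simp: D_adjacent_def)
  have near: "D_cartan ?N n y = (if y = n - 1 then -1 else 0)" "D_cartan ?N y n = (if y = n - 1 then -1 else 0)"
    "D_cartan ?N (n + 1) (?N - y) = (if y = n - 1 then -1 else 0)" "D_cartan ?N (?N - y) (n + 1) = (if y = n - 1 then -1 else 0)"
    "D_cartan ?N (n + 1) y = 0" "D_cartan ?N y (n + 1) = 0"
    "D_cartan ?N n (?N - y) = 0" "D_cartan ?N (?N - y) n = 0"
    if "y < n" for y
  proof -
    have "D_adjacent ?N n y \<or> D_adjacent ?N y n \<longleftrightarrow> y = n - 1" using that n by (auto simp: D_adjacent_def)
    then show 1: "D_cartan ?N n y = (if y = n - 1 then -1 else 0)"
      using D_cartan_eq[OF N, of n y] that by simp
    then show 2: "D_cartan ?N y n = (if y = n - 1 then -1 else 0)" using D_cartan_sym[of ?N y n] by simp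
    show "D_cartan ?N (n + 1) (?N - y) = (if y = n - 1 then -1 else 0)" "D_cartan ?N (?N - y) (n + 1) = (if y = n - 1 then -1 else 0)"
      using D_cartan_flip[OF N, of n y] D_cartan_flip[OF N, of y n] 1 2 that unfolding flip_n by simp_all
    have "\<not> D_adjacent ?N (n + 1) y" "\<not> D_adjacent ?N y (n + 1)" using that n by (auto simp: D_adjacent_def)
    then show 3: "D_cartan ?N (n + 1) y = 0" "D_cartan ?N y (n + 1) = 0"
      using D_cartan_eq[OF N, of "n + 1" y] D_cartan_eq[OF N, of y "n + 1"] that by auto
    show "D_cartan ?N n (?N - y) = 0" "D_cartan ?N (?N - y) n = 0"
      using D_cartan_flip[OF N, of "n + 1" y] D_cartan_flip[OF N, of y "n + 1"] 3 that unfolding flip_n by simp_all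
  qed
  have n1: "n - 1 < n" using n by simp
  have NN: "?N \<ge> 2 * n" by simp
  note facts = near[OF n1, unfolded HOL.simp_thms if_True] nn cartan_fold_node_flip[OF n NN n1 n1]
  have sub: "{n - 1, ?N - (n - 1), n, n + 1} \<subseteq> {0..?N}" by auto
  have "foldable 4 [n, n + 1, n] [n - 1, ?N - (n - 1)]" "foldable 4 [n - 1, ?N - (n - 1)] [n, n + 1, n]"
    by (intro foldable_A4[OF sub] facts)+
  moreover have "len [n, n + 1, n] = 3" using nn by (intro len_three) auto
  moreover have "\<phi> (B_gen n 0) = cl [n, n + 1, n]"
    using \<phi>0 D_gen_mult[of "[n]" ?N "[n + 1]"] D_gen_mult[of "[n, n + 1]" ?N "[n]"] by (simp add: D_gen_eq)
  moreover have "\<forall>x\<in>set [n, n + 1, n]. D_cartan ?N x y = 0 \<and> D_cartan ?N x (?N - y) = 0"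
    if "y < n" "y \<noteq> n - 1" for y using near[OF that(1)] that(2) by simp
  moreover have "\<forall>i\<in>{1..n - 2}. \<phi> (B_gen n i) = D_gen ?N (n - i) \<otimes>\<^bsub>affine_D ?N\<^esub> D_gen ?N (?N - (n - i))"
  proof
    fix i assume i: "i \<in> {1..n - 2}"
    then have "?N - (n - i) = n + 1 + i" by auto
    then show "\<phi> (B_gen n i) = D_gen ?N (n - i) \<otimes>\<^bsub>affine_D ?N\<^esub> D_gen ?N (?N - (n - i))" using \<phi> i by simp
  qed
  moreover have "\<phi> (B_gen n n) = D_gen ?N 1 \<otimes>\<^bsub>affine_D ?N\<^esub> D_gen ?N (?N - 1)" using \<phi>2 by simp
  ultimately show ?thesis
    using \<phi>1 by (intro length_series_mirrored[OF n _ hom, of "[n, n + 1, n]"]) auto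
qed

theorem theorem1p8:
  fixes n :: nat and q :: "rat fps"
  assumes "n \<ge> 3" and "q = fps_X"
  shows
    "(\<forall>\<phi> \<in> hom (affine_B n) (affine_D (n + 1)).
        \<phi> (B_gen n 0) = D_gen (n + 1) 0 \<otimes>\<^bsub>affine_D (n + 1)\<^esub> D_gen (n + 1) 1 \<and>
        (\<forall>i\<in>{1..n}. \<phi> (B_gen n i) = D_gen (n + 1) (i + 1)) \<longrightarrow>
        length_series (affine_B n) \<phi> =
          q_number 2 q * q_number 3 (- q) * q_number 4 q / ((1 - q) * (1 - q ^ 3) * (1 + q ^ n)) *
          (\<Prod>k = 3..n. (q_number (2 * k + 1) q - q ^ k) / (1 - q ^ (2 * k - 1)))) \<and>
     (\<forall>\<phi> \<in> hom (affine_B n) (affine_D (2 * n)).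
        \<phi> (B_gen n 0) = D_gen (2 * n) n \<and>
        (\<forall>i\<in>{1..n - 2}. \<phi> (B_gen n i) =
           D_gen (2 * n) (n - i) \<otimes>\<^bsub>affine_D (2 * n)\<^esub> D_gen (2 * n) (n + i)) \<and>
        \<phi> (B_gen n (n - 1)) = D_gen (2 * n) 0 \<otimes>\<^bsub>affine_D (2 * n)\<^esub> D_gen (2 * n) (2 * n) \<and>
        \<phi> (B_gen n n) = D_gen (2 * n) 1 \<otimes>\<^bsub>affine_D (2 * n)\<^esub> D_gen (2 * n) (2 * n - 1) \<longrightarrow>
        length_series (affine_B n) \<phi> =
          (\<Prod>k = 1..2 * n. q_number k ((- 1) ^ k * q)) *
          ((\<Prod>k = 1..n - 1. 1 + q ^ (2 * k)) / (\<Prod>k = 1..n. 1 - q ^ (2 * (n + k) - 3)))) \<and>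
     (\<forall>\<phi> \<in> hom (affine_B n) (affine_D (2 * n + 1)).
        \<phi> (B_gen n 0) =
          D_gen (2 * n + 1) n \<otimes>\<^bsub>affine_D (2 * n + 1)\<^esub> D_gen (2 * n + 1) (n + 1)
            \<otimes>\<^bsub>affine_D (2 * n + 1)\<^esub> D_gen (2 * n + 1) n \<and>
        (\<forall>i\<in>{1..n - 2}. \<phi> (B_gen n i) =
           D_gen (2 * n + 1) (n - i) \<otimes>\<^bsub>affine_D (2 * n + 1)\<^esub> D_gen (2 * n + 1) (n + 1 + i)) \<and>
        \<phi> (B_gen n (n - 1)) =
          D_gen (2 * n + 1) 0 \<otimes>\<^bsub>affine_D (2 * n + 1)\<^esub> D_gen (2 * n + 1) (2 * n + 1) \<and>
        \<phi> (B_gen n n) = D_gen (2 * n + 1) 1 \<otimes>\<^bsub>affine_D (2 * n + 1)\<^esub> D_gen (2 * n + 1) (2 * n) \<longrightarrow>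
        length_series (affine_B n) \<phi> =
          (\<Prod>k = 1..2 * n + 1. q_number k ((- 1) ^ k * q)) *
          ((\<Prod>k = 1..n - 1. 1 + q ^ (2 * k)) / (\<Prod>k = 1..n. 1 - q ^ (2 * (n + k) - 1))))"
  by (intro conjI ballI impI; elim conjE)
    (rule series_D_Suc[OF assms] series_D_even[OF assms] series_D_odd[OF assms],
     (rule length_series_D_Suc[OF assms(1)] length_series_D_even[OF assms(1)] length_series_D_odd[OF assms(1)];
      assumption))+

end
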